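(* Let $Q=(Q_k)$ be an $\mathcal L$-intersectable quasianalytic weight sequence of moderate growth. A mapping $f:X\to Y$ between $C^Q$-manifolds is $C^Q$ if and only if it maps $C^Q$-plots to $C^Q$-plots, i.e. if and only if $f\circ c$ is a $C^Q$-plot in $Y$ for every $C^Q$-plot $c$ in $X$.
   Context: $\mathbb N=\{0,1,2,\dots\}$. For a sequence $M=(M_k)_{k\in\mathbb N}$ of positive reals and $U\subseteq\mathbb R^n$ open, $C^M(U)$ is the set of $f\in C^\infty(U,\mathbb R)$ such that for each compact $K\subseteq U$ there are $C,\rho>0$ with $|\partial^\alpha f(x)|\le C\rho^{|\alpha|}|\alpha|!M_{|\alpha|}$ for all $\alpha\in\mathbb N^n$, $x\in K$. $M$ is quasianalytic if for all connected open $U\subseteq\mathbb R^n$ and $a\in U$ the Taylor series map at $a$ on $C^M(U)$ is injective; otherwise non-quasianalytic. $M$ is log-convex if $M_k^2\le M_{k-1}M_{k+1}$ for $k\ge1$; a weight sequence is a log-convex sequence with $M_0=1\le M_1$; moderate growth means $\sup_{j,k\ge1}(M_{j+k}/(M_jM_k))^{1/(j+k)}<\infty$. $\mathcal F^M=\{(f_k)\in\mathbb R^{\mathbb N}:\exists C,\rho>0\ \forall k:|f_k|\le C\rho^kk!M_k\}$; $\mathcal L(M)=\{L\ge M:L\text{ non-quasianalytic, log-convex}\}$; a quasianalytic $Q$ is $\mathcal L$-intersectable if $\mathcal F^Q=\bigcap_{L\in\mathcal L(Q)}\mathcal F^L$. A convenient vector space is a Hausdorff, Mackey complete locally convex space;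 its $c^\infty$-topology is the final topology with respect to smooth curves; $E^*$ is the continuous dual. For $L$ log-convex non-quasianalytic and $U\subseteq E$ $c^\infty$-open, $C^L(\mathbb R,U)=\{c:\ell\circ c\in C^L(\mathbb R,\mathbb R)\ \forall\ell\in E^*\}$ and $C^L(U,F)=\{f:f\circ c\in C^L(\mathbb R,F)\ \forall c\in C^L(\mathbb R,U)\}$. $C^Q(U,F)=\bigcap_{L\in\mathcal L(Q)}C^L(U,F)$. A $C^Q$-manifold is a smooth manifold modeled on $c^\infty$-open subsets of convenient vector spaces such that all chart changes are $C^Q$-mappings; a mapping between $C^Q$-manifolds is $C^Q$ if it is continuous and $C^Q$ in charts. A $C^Q$-plot in a $C^Q$-manifold $X$ is a $C^Q$-mapping $c:D\to X$, where $D$ is the open unit ball in some Banach space. *)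

theory Defs
  imports "HOL-Analysis.Analysis"
begin

section \<open>Denjoy--Carleman classes on open subsets of Euclidean space\<close>

text \<open>
  Points of \<open>\<real>\<^sup>n\<close> are the points of the library space \<^const>\<open>Euclidean_space\<close> \<open>n\<close>: functions
  on \<open>nat\<close> vanishing at all indices \<open>\<ge> n\<close>.  Here \<open>n\<close> is a number and not a type because
  quasianalyticity quantifies over all dimensions.
\<close>

definition partial_deriv :: "nat \<Rightarrow> ((nat \<Rightarrow> real) \<Rightarrow> real) \<Rightarrow> (nat \<Rightarrow> real) \<Rightarrow> real" where
  "partial_deriv i f x = deriv (\<lambda>t. f (x(i := t))) (x i)"

fun iter_partial :: "nat list \<Rightarrow> ((nat \<Rightarrow> real) \<Rightarrow> real) \<Rightarrow> (nat \<Rightarrow> real) \<Rightarrow> real" where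
  "iter_partial [] f = f"
| "iter_partial (i # is) f = partial_deriv i (iter_partial is f)"

definition smooth_fun :: "nat \<Rightarrow> (nat \<Rightarrow> real) set \<Rightarrow> ((nat \<Rightarrow> real) \<Rightarrow> real) \<Rightarrow> bool" where
  "smooth_fun n U f \<longleftrightarrow>
     (\<forall>is. set is \<subseteq> {..<n} \<longrightarrow>
        continuous_map (subtopology (Euclidean_space n) U) euclideanreal (iter_partial is f) \<and>
        (\<forall>i<n. \<forall>x\<in>U. (\<lambda>t. iter_partial is f (x(i := t))) field_differentiable (at (x i))))"

text \<open>
  Multi-indices are functions \<open>\<alpha> :: nat \<Rightarrow> nat\<close> of which only the values at \<open>i < n\<close> are used.
\<close>

definition mi_deriv ::
  "nat \<Rightarrow> (nat \<Rightarrow> nat) \<Rightarrow> ((nat \<Rightarrow> real) \<Rightarrow> real) \<Rightarrow> (nat \<Rightarrow> real) \<Rightarrow> real" where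
  "mi_deriv n \<alpha> f = iter_partial (concat (map (\<lambda>i. replicate (\<alpha> i) i) [0..<n])) f"

definition mi_abs :: "nat \<Rightarrow> (nat \<Rightarrow> nat) \<Rightarrow> nat" where
  "mi_abs n \<alpha> = (\<Sum>i<n. \<alpha> i)"

definition CM :: "(nat \<Rightarrow> real) \<Rightarrow> nat \<Rightarrow> (nat \<Rightarrow> real) set \<Rightarrow> ((nat \<Rightarrow> real) \<Rightarrow> real) set" where
  "CM M n U = {f. smooth_fun n U f \<and>
     (\<forall>K. compactin (Euclidean_space n) K \<and> K \<subseteq> U \<longrightarrow>
        (\<exists>C>0. \<exists>\<rho>>0. \<forall>\<alpha>. \<forall>x\<in>K.
           \<bar>mi_deriv n \<alpha> f x\<bar> \<le> C * \<rho> ^ mi_abs n \<alpha> * fact (mi_abs n \<alpha>) * M (mi_abs n \<alpha>)))}"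

definition taylor_series ::
  "nat \<Rightarrow> (nat \<Rightarrow> real) \<Rightarrow> ((nat \<Rightarrow> real) \<Rightarrow> real) \<Rightarrow> (nat \<Rightarrow> nat) \<Rightarrow> real" where
  "taylor_series n a f = (\<lambda>\<alpha>. mi_deriv n \<alpha> f a / (\<Prod>i<n. fact (\<alpha> i)))"

text \<open>
  Elements of \<open>CM M n U\<close> represent functions on \<open>U\<close>; their values outside \<open>U\<close> are irrelevant.
  This is why injectivity is stated with equality on \<open>U\<close>.
\<close>

definition quasianalytic :: "(nat \<Rightarrow> real) \<Rightarrow> bool" where
  "quasianalytic M \<longleftrightarrow>
     (\<forall>n U a. openin (Euclidean_space n) U \<and> connectedin (Euclidean_space n) U \<and> a \<in> U \<longrightarrow>
        (\<forall>f\<in>CM M n U. \<forall>g\<in>CM M n U.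
           taylor_series n a f = taylor_series n a g \<longrightarrow> (\<forall>x\<in>U. f x = g x)))"


section \<open>Weight sequences\<close>

definition log_convex :: "(nat \<Rightarrow> real) \<Rightarrow> bool" where
  "log_convex M \<longleftrightarrow> (\<forall>k\<ge>1. (M k)\<^sup>2 \<le> M (k - 1) * M (k + 1))"

definition weight_sequence :: "(nat \<Rightarrow> real) \<Rightarrow> bool" where
  "weight_sequence M \<longleftrightarrow> (\<forall>k. M k > 0) \<and> log_convex M \<and> M 0 = 1 \<and> 1 \<le> M 1"

definition moderate_growth :: "(nat \<Rightarrow> real) \<Rightarrow> bool" where
  "moderate_growth M \<longleftrightarrow>
     bdd_above {(M (j + k) / (M j * M k)) powr (1 / real (j + k)) | j k. j \<ge> 1 \<and> k \<ge> 1}"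

definition formal_class :: "(nat \<Rightarrow> real) \<Rightarrow> (nat \<Rightarrow> real) set" where
  "formal_class M = {f. \<exists>C>0. \<exists>\<rho>>0. \<forall>k. \<bar>f k\<bar> \<le> C * \<rho> ^ k * fact k * M k}"

definition nq_majorants :: "(nat \<Rightarrow> real) \<Rightarrow> (nat \<Rightarrow> real) set" where
  "nq_majorants M = {L. (\<forall>k. M k \<le> L k) \<and> \<not> quasianalytic L \<and> log_convex L}"

definition L_intersectable :: "(nat \<Rightarrow> real) \<Rightarrow> bool" where
  "L_intersectable Q \<longleftrightarrow> formal_class Q = (\<Inter>L\<in>nq_majorants Q. formal_class L)"


section \<open>Convenient vector spaces\<close>

text \<open>
  A topological vector space is represented by a topology \<open>T\<close> whose underlying set is a linear
  subspace of an ambient real vector space.  Any family of vector spaces embeds in a common ambient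
  space, so different charts of one manifold can have different model spaces.
\<close>

definition locally_convex_space :: "'e::real_vector topology \<Rightarrow> bool" where
  "locally_convex_space T \<longleftrightarrow>
     subspace (topspace T) \<and>
     continuous_map (prod_topology T T) T (\<lambda>(x, y). x + y) \<and>
     continuous_map (prod_topology euclideanreal T) T (\<lambda>(r, x). r *\<^sub>R x) \<and>
     (\<forall>U. openin T U \<and> 0 \<in> U \<longrightarrow> (\<exists>V. openin T V \<and> 0 \<in> V \<and> convex V \<and> V \<subseteq> U))"

definition bounded_in :: "'e::real_vector topology \<Rightarrow> 'e set \<Rightarrow> bool" where
  "bounded_in T B \<longleftrightarrow>
     B \<subseteq> topspace T \<and>
     (\<forall>U. openin T U \<and> 0 \<in> U \<longrightarrow> (\<exists>r>0. B \<subseteq> (\<lambda>x. r *\<^sub>R x) ` U))"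

definition Mackey_Cauchy :: "'e::real_vector topology \<Rightarrow> (nat \<Rightarrow> 'e) \<Rightarrow> bool" where
  "Mackey_Cauchy T x \<longleftrightarrow>
     range x \<subseteq> topspace T \<and>
     (\<exists>B \<mu>. bounded_in T B \<and>
        ((\<lambda>(m, n). \<mu> m n) \<longlongrightarrow> (0::real)) (sequentially \<times>\<^sub>F sequentially) \<and>
        (\<forall>m n. x m - x n \<in> (\<lambda>b. \<mu> m n *\<^sub>R b) ` B))"

definition Mackey_complete :: "'e::real_vector topology \<Rightarrow> bool" where
  "Mackey_complete T \<longleftrightarrow> (\<forall>x. Mackey_Cauchy T x \<longrightarrow> (\<exists>l. limitin T x l sequentially))"

definition convenient :: "'e::real_vector topology \<Rightarrow> bool" where
  "convenient T \<longleftrightarrow> locally_convex_space T \<and> Hausdorff_space T \<and> Mackey_complete T"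

definition continuous_dual :: "'e::real_vector topology \<Rightarrow> ('e \<Rightarrow> real) set" where
  "continuous_dual T =
     {l. (\<forall>x\<in>topspace T. \<forall>y\<in>topspace T. l (x + y) = l x + l y) \<and>
         (\<forall>r. \<forall>x\<in>topspace T. l (r *\<^sub>R x) = r * l x) \<and>
         continuous_map T euclideanreal l}"

text \<open>In the next definition \<open>d k\<close> is the \<open>k\<close>-th derivative of \<open>c\<close>.\<close>

definition smooth_curve :: "'e::real_vector topology \<Rightarrow> (real \<Rightarrow> 'e) \<Rightarrow> bool" where
  "smooth_curve T c \<longleftrightarrow>
     (\<exists>d. d 0 = c \<and>
        (\<forall>k t. d k t \<in> topspace T \<and>
           limitin T (\<lambda>h. (1 / h) *\<^sub>R (d k (t + h) - d k t)) (d (Suc k) t) (at (0::real))))"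

definition final_topology :: "'x set \<Rightarrow> ('s topology \<times> ('s \<Rightarrow> 'x)) set \<Rightarrow> 'x topology" where
  "final_topology X F =
     topology (\<lambda>W. W \<subseteq> X \<and> (\<forall>(S, g)\<in>F. openin S {s \<in> topspace S. g s \<in> W}))"

lemma openin_final_topology:
  "openin (final_topology X F) W \<longleftrightarrow>
     W \<subseteq> X \<and> (\<forall>(S, g)\<in>F. openin S {s \<in> topspace S. g s \<in> W})"
proof -
  have "istopology (\<lambda>W. W \<subseteq> X \<and> (\<forall>(S, g)\<in>F. openin S {s \<in> topspace S. g s \<in> W}))"
    unfolding istopology_def
  proof (intro conjI allI impI)
    fix A B
    assume A: "A \<subseteq> X \<and> (\<forall>(S, g)\<in>F. openin S {s \<in> topspace S. g s \<in> A})"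
      and B: "B \<subseteq> X \<and> (\<forall>(S, g)\<in>F. openin S {s \<in> topspace S. g s \<in> B})"
    show "A \<inter> B \<subseteq> X"
      using A by blast
    have "openin S {s \<in> topspace S. g s \<in> A \<inter> B}" if "(S, g) \<in> F" for S g
    proof -
      have "{s \<in> topspace S. g s \<in> A \<inter> B} =
          {s \<in> topspace S. g s \<in> A} \<inter> {s \<in> topspace S. g s \<in> B}"
        by blast
      then show ?thesis
        using A B that by fastforce
    qed
    then show "\<forall>(S, g)\<in>F. openin S {s \<in> topspace S. g s \<in> A \<inter> B}"
      by blast
  next
    fix K
    assume K: "\<forall>A\<in>K. A \<subseteq> X \<and> (\<forall>(S, g)\<in>F. openin S {s \<in> topspace S. g s \<in> A})"
    show "\<Union>K \<subseteq> X"
      using K by blast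
    have "openin S {s \<in> topspace S. g s \<in> \<Union>K}" if "(S, g) \<in> F" for S g
    proof -
      have "{s \<in> topspace S. g s \<in> \<Union>K} = (\<Union>A\<in>K. {s \<in> topspace S. g s \<in> A})"
        by blast
      moreover have "openin S {s \<in> topspace S. g s \<in> A}" if "A \<in> K" for A
        using K that \<open>(S, g) \<in> F\<close> by blast
      ultimately show ?thesis
        by auto
    qed
    then show "\<forall>(S, g)\<in>F. openin S {s \<in> topspace S. g s \<in> \<Union>K}"
      by blast
  qed
  then show ?thesis
    unfolding final_topology_def by (simp add: topology_inverse')
qed

definition cinf_topology :: "'e::real_vector topology \<Rightarrow> 'e topology" where
  "cinf_topology T = final_topology (topspace T) {(euclideanreal, c) | c. smooth_curve T c}"


section \<open>Mappings between subsets of convenient vector spaces\<close>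

text \<open>
  A mapping from \<open>U\<close> to \<open>F\<close> is a total function, used only on \<open>U\<close>.
\<close>

definition smooth_map ::
  "'e::real_vector topology \<Rightarrow> 'e set \<Rightarrow> 'f::real_vector topology \<Rightarrow> ('e \<Rightarrow> 'f) \<Rightarrow> bool" where
  "smooth_map T U S f \<longleftrightarrow>
     f ` U \<subseteq> topspace S \<and>
     (\<forall>c. smooth_curve T c \<and> range c \<subseteq> U \<longrightarrow> smooth_curve S (f \<circ> c))"

text \<open>\<open>C\<^sup>L(\<real>, \<real>)\<close> is \<open>CM L n U\<close> for \<open>n = 1\<close> and \<open>U = \<real>\<^sup>1\<close>, a point \<open>x\<close> of \<open>\<real>\<^sup>1\<close> being identified
  with its coordinate \<open>x 0\<close>.\<close>

definition CL_real :: "(nat \<Rightarrow> real) \<Rightarrow> (real \<Rightarrow> real) set" where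
  "CL_real L = {g. (\<lambda>x. g (x 0)) \<in> CM L 1 (topspace (Euclidean_space 1))}"

definition CL_curve ::
  "(nat \<Rightarrow> real) \<Rightarrow> 'e::real_vector topology \<Rightarrow> 'e set \<Rightarrow> (real \<Rightarrow> 'e) \<Rightarrow> bool" where
  "CL_curve L T U c \<longleftrightarrow> range c \<subseteq> U \<and> (\<forall>l\<in>continuous_dual T. l \<circ> c \<in> CL_real L)"

definition CL_map ::
  "(nat \<Rightarrow> real) \<Rightarrow> 'e::real_vector topology \<Rightarrow> 'e set \<Rightarrow>
     'f::real_vector topology \<Rightarrow> ('e \<Rightarrow> 'f) \<Rightarrow> bool" where
  "CL_map L T U S f \<longleftrightarrow>
     f ` U \<subseteq> topspace S \<and>
     (\<forall>c. CL_curve L T U c \<longrightarrow> CL_curve L S (topspace S) (f \<circ> c))"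

definition CQ_map ::
  "(nat \<Rightarrow> real) \<Rightarrow> 'e::real_vector topology \<Rightarrow> 'e set \<Rightarrow>
     'f::real_vector topology \<Rightarrow> ('e \<Rightarrow> 'f) \<Rightarrow> bool" where
  "CQ_map Q T U S f \<longleftrightarrow>
     f ` U \<subseteq> topspace S \<and> (\<forall>L\<in>nq_majorants Q. CL_map L T U S f)"


section \<open>Manifolds\<close>

record ('x, 'e) chart =
  chart_model :: "'e topology"
  chart_dom :: "'x set"
  chart_fun :: "'x \<Rightarrow> 'e"

record ('x, 'e) manifold =
  points :: "'x set"
  atlas :: "('x, 'e) chart set"

definition chart_inv :: "('x, 'e) chart \<Rightarrow> 'e \<Rightarrow> 'x" where
  "chart_inv u = inv_into (chart_dom u) (chart_fun u)"

definition chart_range :: "('x, 'e) chart \<Rightarrow> 'e set" where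
  "chart_range u = chart_fun u ` chart_dom u"

definition is_chart_on :: "'x set \<Rightarrow> ('x, 'e::real_vector) chart \<Rightarrow> bool" where
  "is_chart_on X u \<longleftrightarrow>
     chart_dom u \<subseteq> X \<and> convenient (chart_model u) \<and> inj_on (chart_fun u) (chart_dom u) \<and>
     openin (cinf_topology (chart_model u)) (chart_range u)"

definition CQ_manifold :: "(nat \<Rightarrow> real) \<Rightarrow> ('x, 'e::real_vector) manifold \<Rightarrow> bool" where
  "CQ_manifold Q X \<longleftrightarrow>
     (\<forall>u\<in>atlas X. is_chart_on (points X) u) \<and>
     (\<Union>u\<in>atlas X. chart_dom u) = points X \<and>
     (\<forall>u\<in>atlas X. \<forall>v\<in>atlas X.
        let D = chart_fun u ` (chart_dom u \<inter> chart_dom v); h = chart_fun v \<circ> chart_inv u in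
          openin (cinf_topology (chart_model u)) D \<and>
          smooth_map (chart_model u) D (chart_model v) h \<and>
          CQ_map Q (chart_model u) D (chart_model v) h)"

text \<open>
  The topology of a manifold: a set \<open>W\<close> is open iff its image under every chart is \<open>c\<^sup>\<infinity>\<close>-open.
\<close>

definition manifold_topology :: "('x, 'e::real_vector) manifold \<Rightarrow> 'x topology" where
  "manifold_topology X =
     final_topology (points X)
       {(subtopology (cinf_topology (chart_model u)) (chart_range u), chart_inv u) | u. u \<in> atlas X}"

definition CQ_manifold_map ::
  "(nat \<Rightarrow> real) \<Rightarrow> ('x, 'e::real_vector) manifold \<Rightarrow> ('y, 'f::real_vector) manifold \<Rightarrow>
     ('x \<Rightarrow> 'y) \<Rightarrow> bool" where
  "CQ_manifold_map Q X Y f \<longleftrightarrow>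
     f ` points X \<subseteq> points Y \<and>
     continuous_map (manifold_topology X) (manifold_topology Y) f \<and>
     (\<forall>u\<in>atlas X. \<forall>v\<in>atlas Y.
        CQ_map Q (chart_model u) (chart_fun u ` (chart_dom u \<inter> f -` chart_dom v))
          (chart_model v) (chart_fun v \<circ> f \<circ> chart_inv u))"


section \<open>Plots\<close>

text \<open>
  A Banach space is a linear subspace \<open>V\<close> of an ambient real vector space with a complete norm \<open>N\<close>
  on \<open>V\<close>.  Setting \<open>N\<close> to \<open>0\<close> outside \<open>V\<close> makes the distance satisfy the axioms of
  \<^locale>\<open>Metric_space\<close>, which requires symmetry and nonnegativity on the whole type.
\<close>

definition normed_on :: "'b::real_vector set \<Rightarrow> ('b \<Rightarrow> real) \<Rightarrow> bool" where
  "normed_on V N \<longleftrightarrow>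
     subspace V \<and>
     (\<forall>x\<in>V. 0 \<le> N x \<and> (N x = 0 \<longleftrightarrow> x = 0)) \<and>
     (\<forall>x\<in>V. \<forall>y\<in>V. N (x + y) \<le> N x + N y) \<and>
     (\<forall>r. \<forall>x\<in>V. N (r *\<^sub>R x) = \<bar>r\<bar> * N x) \<and>
     (\<forall>x. x \<notin> V \<longrightarrow> N x = 0)"

definition norm_dist :: "('b::real_vector \<Rightarrow> real) \<Rightarrow> 'b \<Rightarrow> 'b \<Rightarrow> real" where
  "norm_dist N x y = N (x - y)"

lemma Metric_space_norm_dist:
  assumes "normed_on V N"
  shows "Metric_space V (norm_dist N)"
proof
  have V: "subspace V" and hom: "\<And>r x. x \<in> V \<Longrightarrow> N (r *\<^sub>R x) = \<bar>r\<bar> * N x"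
    and out: "\<And>x. x \<notin> V \<Longrightarrow> N x = 0"
    using assms unfolding normed_on_def by auto
  fix x y
  show "0 \<le> norm_dist N x y"
    using assms unfolding normed_on_def norm_dist_def by (metis order_refl)
  show "norm_dist N x y = norm_dist N y x"
  proof (cases "x - y \<in> V")
    case True
    then show ?thesis
      using hom[of "x - y" "-1"] by (simp add: norm_dist_def)
  next
    case False
    then have "y - x \<notin> V"
      using subspace_neg[OF V, of "y - x"] by auto
    then show ?thesis
      using False out by (simp add: norm_dist_def)
  qed
  assume xy: "x \<in> V" "y \<in> V"
  show "norm_dist N x y = 0 \<longleftrightarrow> x = y"
    using assms subspace_diff[OF V xy] unfolding normed_on_def norm_dist_def by auto
  fix z
  assume "z \<in> V"
  then have "x - y \<in> V" "y - z \<in> V"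
    using xy V subspace_diff by auto
  then have "N ((x - y) + (y - z)) \<le> N (x - y) + N (y - z)"
    using assms unfolding normed_on_def by blast
  then show "norm_dist N x z \<le> norm_dist N x y + norm_dist N y z"
    by (simp add: norm_dist_def)
qed

definition banach_on :: "'b::real_vector set \<Rightarrow> ('b \<Rightarrow> real) \<Rightarrow> bool" where
  "banach_on V N \<longleftrightarrow> normed_on V N \<and> Metric_space.mcomplete V (norm_dist N)"

text \<open>The open unit ball, as a manifold with the identity as its only chart.\<close>

definition unit_ball_manifold ::
  "'b::real_vector set \<Rightarrow> ('b \<Rightarrow> real) \<Rightarrow> ('b, 'b) manifold" where
  "unit_ball_manifold V N =
     (let D = {x \<in> V. N x < 1} in
        \<lparr>points = D,
         atlas = {\<lparr>chart_model = Metric_space.mtopology V (norm_dist N),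
                   chart_dom = D, chart_fun = (\<lambda>x. x)\<rparr>}\<rparr>)"

definition CQ_plot ::
  "(nat \<Rightarrow> real) \<Rightarrow> 'b::real_vector set \<Rightarrow> ('b \<Rightarrow> real) \<Rightarrow> ('x, 'e::real_vector) manifold \<Rightarrow>
     ('b \<Rightarrow> 'x) \<Rightarrow> bool" where
  "CQ_plot Q V N X c \<longleftrightarrow> banach_on V N \<and> CQ_manifold_map Q (unit_ball_manifold V N) X c"

text \<open>
  A formula cannot quantify over the Banach spaces in all types, so an ambient type has to be chosen
  for them.  In \<open>maps_plots_to_plots\<close> it is \<open>'e \<times> 'b\<close>, where \<open>'e\<close> is the ambient type of the model
  spaces of \<open>X\<close> and \<open>'b\<close> is an arbitrary real vector space type, indicated by the \<open>itself\<close> argument.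
  Every Banach space can be realised there for a suitable \<open>'b\<close>; the factor \<open>'e\<close> ensures
  that, whatever \<open>'b\<close> is, there are enough Banach spaces to test mappings on \<open>X\<close>.
\<close>

definition maps_plots_to_plots ::
  "'b::real_vector itself \<Rightarrow> (nat \<Rightarrow> real) \<Rightarrow> ('x, 'e::real_vector) manifold \<Rightarrow>
     ('y, 'f::real_vector) manifold \<Rightarrow> ('x \<Rightarrow> 'y) \<Rightarrow> bool" where
  "maps_plots_to_plots _ Q X Y f \<longleftrightarrow>
     (\<forall>(V :: ('e \<times> 'b) set) N c. CQ_plot Q V N X c \<longrightarrow> CQ_plot Q V N Y (f \<circ> c))"

end

theory Submission
  imports Defs
begin

text \<open>
  The forward direction is composition.  The point to watch is that a curve must be tested as a whole,
  while the plot and the chart of \<open>X\<close> only control it locally.  Curves in a Banach space can be localised: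
  a \<open>C\<^sup>L\<close>-curve \<open>\<gamma>\<close> is replaced by \<open>\<gamma> s + \<phi> (\<gamma> - \<gamma> s)\<close>, where \<open>\<phi>\<close> is a \<open>C\<^sup>L\<close>-cutoff function, and the
  result stays in a small ball around \<open>\<gamma> s\<close> (\<open>localize_CL_curve\<close>).  Cutoff functions exist because \<open>L\<close> is
  non-quasianalytic: if all flat functions of one variable vanished, one could move along the coordinate axes and
  would obtain quasianalyticity in every dimension (\<open>flat_rigid_imp_quasianalytic\<close>).

  For the converse, the plots used are the affine ones, defined on the unit ball of the Banach space that is
  generated by a bounded subset of a model space (\<open>banach_disk\<close>, \<open>ex_affine_plot\<close>).  A \<open>c\<^sup>\<infinity>\<close>-open set absorbs
  bounded sets at each of its points (\<open>cinf_open_absorbs_bounded\<close>), because otherwise a smooth curve would run through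
  points outside that converge too fast.  So small multiples of the unit ball are mapped into the chart.  Continuity
  of \<open>f\<close> follows, as a smooth curve \<open>\<gamma>\<close> converges to \<open>\<gamma> s\<close> in the Banach space generated by its difference quotients.

  It remains to show that \<open>f\<close> preserves \<open>C\<^sup>L\<close>-curves in charts, for each \<open>L\<close> in \<open>\<L>(Q)\<close>.  A \<open>C\<^sup>L\<close>-curve \<open>\<gamma>\<close> in a
  convenient vector space does not factor through a Banach space as a \<open>C\<^sup>L\<close>-curve, since the rate \<open>\<rho>\<close> of its bounds
  depends on the functional with which it is tested.  But for every log-convex \<open>R \<ge> 1\<close> that grows faster than all
  exponentials, the vectors \<open>\<gamma>\<^sup>(\<^sup>k\<^sup>) / (k! L\<^sub>k R\<^sub>k)\<close> form a bounded set, and \<open>\<gamma>\<close> is locally a \<open>C\<^sup>L\<^sup>R\<close>-curve in the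
  Banach space that it generates.  The sequence \<open>L R\<close> belongs to \<open>\<L>(Q)\<close> too, and the plots of \<open>Y\<close> are of class
  \<open>C\<^sup>L\<^sup>R\<close>.  Therefore the image of \<open>\<gamma>\<close> is of class \<open>C\<^sup>L\<^sup>R\<close> for every such \<open>R\<close>, and this forces class \<open>C\<^sup>L\<close>
  (\<open>CL_real_of_multiples\<close>): bounds that fail, fail by a superexponential factor along a subsequence of orders, and
  \<open>R\<close> can be chosen to grow more slowly than this factor.

  Both parts need vectors to be recognised by continuous functionals: weakly bounded sets are bounded
  (\<open>weakly_bounded_imp_bounded\<close>), and in a convenient vector space a scalarwise smooth curve is smooth
  (\<open>smooth_curve_iff_scalarwise\<close>).
\<close>

section \<open>One-variable functions with derivative bounds\<close>

text \<open>
  Smooth functions of one variable are handled through the sequence \<open>d\<close> of all their derivatives.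
  Such sequences, unlike iterated applications of \<^const>\<open>deriv\<close>, can be added, multiplied
  and glued without differentiability side conditions.
\<close>

definition derivs_on :: "real set \<Rightarrow> (nat \<Rightarrow> real \<Rightarrow> real) \<Rightarrow> bool" where
  "derivs_on I d \<longleftrightarrow> (\<forall>k. \<forall>t\<in>I. (d k has_real_derivative d (Suc k) t) (at t))"

definition CL_derivs :: "(nat \<Rightarrow> real) \<Rightarrow> real set \<Rightarrow> (nat \<Rightarrow> real \<Rightarrow> real) \<Rightarrow> bool" where
  "CL_derivs L I d \<longleftrightarrow> derivs_on I d \<and>
     (\<exists>C>0. \<exists>\<rho>>0. \<forall>k. \<forall>t\<in>I. \<bar>d k t\<bar> \<le> C * \<rho> ^ k * fact k * L k)"

definition CL_near :: "(nat \<Rightarrow> real) \<Rightarrow> (real \<Rightarrow> real) \<Rightarrow> real \<Rightarrow> bool" where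
  "CL_near L g s \<longleftrightarrow> (\<exists>d I. open I \<and> s \<in> I \<and> (\<forall>t\<in>I. d 0 t = g t) \<and> CL_derivs L I d)"

lemma CL_derivsI:
  assumes "derivs_on I d" "C > 0" "\<rho> > 0" "\<And>k t. t \<in> I \<Longrightarrow> \<bar>d k t\<bar> \<le> C * \<rho> ^ k * fact k * L k"
  shows "CL_derivs L I d"
  using assms unfolding CL_derivs_def by blast

lemma CL_derivsE:
  assumes "CL_derivs L I d"
  obtains C \<rho> where "C > 0" "\<rho> > 0" "\<And>k t. t \<in> I \<Longrightarrow> \<bar>d k t\<bar> \<le> C * \<rho> ^ k * fact k * L k"
  using assms unfolding CL_derivs_def by blast

lemma CL_nearI:
  assumes "open I" "s \<in> I" "\<And>t. t \<in> I \<Longrightarrow> d 0 t = g t" "CL_derivs L I d"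
  shows "CL_near L g s"
  using assms unfolding CL_near_def by blast

lemma CL_nearE:
  assumes "CL_near L g s"
  obtains d I where "open I" "s \<in> I" "\<And>t. t \<in> I \<Longrightarrow> d 0 t = g t" "CL_derivs L I d"
  using assms unfolding CL_near_def by blast

lemma derivs_onD: "derivs_on I d \<Longrightarrow> t \<in> I \<Longrightarrow> (d k has_real_derivative d (Suc k) t) (at t)"
  by (simp add: derivs_on_def)

lemma derivs_on_subset: "derivs_on I d \<Longrightarrow> J \<subseteq> I \<Longrightarrow> derivs_on J d"
  by (auto simp: derivs_on_def)

lemma CL_derivs_subset: "CL_derivs L I d \<Longrightarrow> J \<subseteq> I \<Longrightarrow> CL_derivs L J d"
  unfolding CL_derivs_def by (meson derivs_on_subset subsetD)

lemma CL_derivs_derivs_on: "CL_derivs L I d \<Longrightarrow> derivs_on I d"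
  by (simp add: CL_derivs_def)

lemma derivs_on_continuous: "derivs_on I d \<Longrightarrow> continuous_on I (d k)"
  unfolding derivs_on_def by (meson DERIV_continuous_on has_field_derivative_at_within)

lemma derivs_on_eq_deriv:
  assumes "derivs_on I d" "open I" "\<And>t. t \<in> I \<Longrightarrow> d 0 t = g t" "t \<in> I"
  shows "d k t = (deriv ^^ k) g t"
  using \<open>t \<in> I\<close>
proof (induction k arbitrary: t)
  case (Suc k)
  have "(d k has_real_derivative d (Suc k) t) (at t)"
    using assms(1) Suc.prems by (rule derivs_onD)
  then have "((deriv ^^ k) g has_real_derivative d (Suc k) t) (at t)"
    by (rule has_field_derivative_transform_within_open[OF _ assms(2) Suc.prems]) (rule Suc.IH)
  then show ?case
    by (simp add: DERIV_imp_deriv)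
qed (use assms in auto)

lemma iter_partial_one_variable:
  "iter_partial (replicate k 0) (\<lambda>x. g (x 0)) x = (deriv ^^ k) g (x 0)"
proof (induction k arbitrary: x)
  case (Suc k)
  then show ?case
    by (simp add: partial_deriv_def)
qed simp

lemma continuous_map_line: "continuous_map euclideanreal (Euclidean_space 1) (\<lambda>t i. if i < 1 then t else 0)"
  using continuous_map_componentwise_Euclidean_space[of euclideanreal 1 "\<lambda>t i. t"] by simp

lemma continuous_map_coordinate: "continuous_map (Euclidean_space n) euclideanreal (\<lambda>x. x i)"
  unfolding Euclidean_space_def
  by (intro continuous_map_from_subtopology continuous_map_product_projection) simp

lemma CL_real_global_iff:
  "g \<in> CL_real L \<longleftrightarrow> derivs_on UNIV (\<lambda>k. (deriv ^^ k) g) \<and>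
     (\<forall>A. \<exists>C>0. \<exists>\<rho>>0. \<forall>k t. \<bar>t\<bar> \<le> A \<longrightarrow> \<bar>(deriv ^^ k) g t\<bar> \<le> C * \<rho> ^ k * fact k * L k)"
    (is "?lhs \<longleftrightarrow> ?rhs")
proof -
  let ?E = "Euclidean_space 1" and ?G = "\<lambda>x::nat\<Rightarrow>real. g (x 0)" and ?p = "\<lambda>t i. if i < (1::nat) then t else (0::real)"
  have lists: "set is \<subseteq> {..<1} \<longleftrightarrow> is = replicate (length is) (0::nat)" for "is"
  proof
    assume "set is \<subseteq> {..<1}"
    then have "\<forall>y\<in>set is. y = 0"
      by auto
    then show "is = replicate (length is) 0"
      by (simp add: replicate_length_same)
  next
    assume "is = replicate (length is) (0::nat)"
    then have "set is \<subseteq> {0}"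
      by (metis in_set_replicate singletonI subsetI)
    then show "set is \<subseteq> {..<1}"
      by auto
  qed
  have mi: "mi_deriv 1 \<alpha> ?G x = (deriv ^^ \<alpha> 0) g (x 0)" "mi_abs 1 \<alpha> = \<alpha> 0" for \<alpha> x
    by (simp_all add: mi_deriv_def iter_partial_one_variable mi_abs_def)
  have smooth: "smooth_fun 1 (topspace ?E) ?G \<longleftrightarrow> derivs_on UNIV (\<lambda>k. (deriv ^^ k) g)"
  proof
    assume S: "smooth_fun 1 (topspace ?E) ?G"
    show "derivs_on UNIV (\<lambda>k. (deriv ^^ k) g)"
      unfolding derivs_on_def
    proof (intro allI ballI)
      fix k t
      have "?p t \<in> topspace ?E"
        by (simp add: topspace_Euclidean_space)
      then have "(\<lambda>s. iter_partial (replicate k 0) ?G ((?p t)(0 := s))) field_differentiable (at (?p t 0))"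
        using S unfolding smooth_fun_def by (auto dest!: spec[of _ "replicate k 0"])
      then have "(deriv ^^ k) g field_differentiable (at t)"
        by (simp add: iter_partial_one_variable)
      then show "((deriv ^^ k) g has_real_derivative (deriv ^^ Suc k) g t) (at t)"
        by (simp add: DERIV_deriv_iff_field_differentiable)
    qed
  next
    assume D: "derivs_on UNIV (\<lambda>k. (deriv ^^ k) g)"
    show "smooth_fun 1 (topspace ?E) ?G"
      unfolding smooth_fun_def
    proof (intro allI impI conjI ballI)
      fix "is" :: "nat list"
      assume "set is \<subseteq> {..<1}"
      then obtain k where k: "is = replicate k 0"
        using lists by blast
      have eq: "iter_partial is ?G = (\<lambda>x. (deriv ^^ k) g (x 0))"
        by (simp add: k iter_partial_one_variable fun_eq_iff)
      have "continuous_map ?E euclideanreal ((deriv ^^ k) g \<circ> (\<lambda>x. x 0))"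
        using derivs_on_continuous[OF D] continuous_map_coordinate
        by (intro continuous_map_compose) auto
      then show "continuous_map (subtopology ?E (topspace ?E)) euclideanreal (iter_partial is ?G)"
        by (simp add: eq o_def)
      fix i :: nat and x :: "nat \<Rightarrow> real"
      assume "i < 1"
      moreover have "(deriv ^^ k) g field_differentiable (at (x 0))"
        using D unfolding derivs_on_def field_differentiable_def by blast
      ultimately show "(\<lambda>t. iter_partial is ?G (x(i := t))) field_differentiable (at (x i))"
        by (simp add: eq)
    qed
  qed
  have bounds: "(\<forall>K. compactin ?E K \<and> K \<subseteq> topspace ?E \<longrightarrow>
        (\<exists>C>0. \<exists>\<rho>>0. \<forall>\<alpha>. \<forall>x\<in>K.
           \<bar>mi_deriv 1 \<alpha> ?G x\<bar> \<le> C * \<rho> ^ mi_abs 1 \<alpha> * fact (mi_abs 1 \<alpha>) * L (mi_abs 1 \<alpha>))) \<longleftrightarrow>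
     (\<forall>A. \<exists>C>0. \<exists>\<rho>>0. \<forall>k t. \<bar>t\<bar> \<le> A \<longrightarrow> \<bar>(deriv ^^ k) g t\<bar> \<le> C * \<rho> ^ k * fact k * L k)" (is "?l = ?r")
  proof
    assume l: ?l
    show ?r
    proof
      fix A :: real
      have "compactin euclideanreal {-A..A}"
        by simp
      then have "compactin ?E (?p ` {-A..A})"
        using image_compactin continuous_map_line by blast
      moreover have "?p ` {-A..A} \<subseteq> topspace ?E"
        by (auto simp: topspace_Euclidean_space)
      ultimately obtain C \<rho> where C: "C > 0" "\<rho> > 0"
        "\<And>\<alpha> x. x \<in> ?p ` {-A..A} \<Longrightarrow>
           \<bar>mi_deriv 1 \<alpha> ?G x\<bar> \<le> C * \<rho> ^ mi_abs 1 \<alpha> * fact (mi_abs 1 \<alpha>) * L (mi_abs 1 \<alpha>)"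
        using l by meson
      have "\<bar>(deriv ^^ k) g t\<bar> \<le> C * \<rho> ^ k * fact k * L k" if "\<bar>t\<bar> \<le> A" for k t
        using C(3)[of "?p t" "\<lambda>_. k"] that unfolding mi by (auto simp: abs_le_iff)
      then show "\<exists>C>0. \<exists>\<rho>>0. \<forall>k t. \<bar>t\<bar> \<le> A \<longrightarrow> \<bar>(deriv ^^ k) g t\<bar> \<le> C * \<rho> ^ k * fact k * L k"
        using C(1,2) by blast
    qed
  next
    assume r: ?r
    show ?l
    proof (intro allI impI)
      fix K
      assume K: "compactin ?E K \<and> K \<subseteq> topspace ?E"
      then have "compact ((\<lambda>x. x 0) ` K)"
        using image_compactin[OF _ continuous_map_coordinate] by (metis compactin_euclidean_iff)
      then obtain A where A: "\<And>x. x \<in> K \<Longrightarrow> \<bar>x 0\<bar> \<le> A"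
        by (meson bounded_real compact_imp_bounded imageI)
      obtain C \<rho> where C: "C > 0" "\<rho> > 0"
        "\<forall>k t. \<bar>t\<bar> \<le> A \<longrightarrow> \<bar>(deriv ^^ k) g t\<bar> \<le> C * \<rho> ^ k * fact k * L k"
        using r by meson
      have "\<forall>\<alpha>. \<forall>x\<in>K. \<bar>mi_deriv 1 \<alpha> ?G x\<bar> \<le> C * \<rho> ^ mi_abs 1 \<alpha> * fact (mi_abs 1 \<alpha>) * L (mi_abs 1 \<alpha>)"
        unfolding mi using C(3) A by auto
      then show "\<exists>C>0. \<exists>\<rho>>0. \<forall>\<alpha>. \<forall>x\<in>K.
           \<bar>mi_deriv 1 \<alpha> ?G x\<bar> \<le> C * \<rho> ^ mi_abs 1 \<alpha> * fact (mi_abs 1 \<alpha>) * L (mi_abs 1 \<alpha>)"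
        using C(1,2) by blast
    qed
  qed
  show ?thesis
    unfolding CL_real_def CM_def mem_Collect_eq smooth bounds ..
qed

text \<open>A compact interval is covered by finitely many intervals with local bounds, and the sums of their constants
  serve for all of them.  Membership in \<open>C\<^sup>L(\<real>, \<real>)\<close> is always established in this local form.\<close>

lemma CL_real_local_iff:
  assumes L: "\<forall>k. L k > 0"
  shows "g \<in> CL_real L \<longleftrightarrow> (\<forall>s. CL_near L g s)" (is "?lhs \<longleftrightarrow> ?rhs")
proof
  assume ?lhs
  then have D: "derivs_on UNIV (\<lambda>k. (deriv ^^ k) g)" and
    b: "\<And>A. \<exists>C>0. \<exists>\<rho>>0. \<forall>k t. \<bar>t\<bar> \<le> A \<longrightarrow> \<bar>(deriv ^^ k) g t\<bar> \<le> C * \<rho> ^ k * fact k * L k"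
    unfolding CL_real_global_iff by blast+
  show ?rhs
  proof
    fix s
    obtain C \<rho> where C: "C > 0" "\<rho> > 0"
        "\<And>k t. \<bar>t\<bar> \<le> \<bar>s\<bar> + 1 \<Longrightarrow> \<bar>(deriv ^^ k) g t\<bar> \<le> C * \<rho> ^ k * fact k * L k"
      using b by meson
    have "CL_derivs L {s-1<..<s+1} (\<lambda>k. (deriv ^^ k) g)"
    proof (rule CL_derivsI[OF _ C(1,2)])
      show "derivs_on {s-1<..<s+1} (\<lambda>k. (deriv ^^ k) g)"
        using D by (rule derivs_on_subset) simp
      fix k t assume "t \<in> {s-1<..<s+1}"
      then have "\<bar>t\<bar> \<le> \<bar>s\<bar> + 1"
        by auto
      then show "\<bar>(deriv ^^ k) g t\<bar> \<le> C * \<rho> ^ k * fact k * L k"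
        by (rule C(3))
    qed
    then show "CL_near L g s"
      by (rule CL_nearI[rotated 3]) auto
  qed
next
  assume R: ?rhs
  have loc: "\<exists>I C \<rho>. open I \<and> s \<in> I \<and> C > 0 \<and> \<rho> > 0 \<and> derivs_on I (\<lambda>k. (deriv ^^ k) g) \<and>
    (\<forall>k. \<forall>t\<in>I. \<bar>(deriv ^^ k) g t\<bar> \<le> C * \<rho> ^ k * fact k * L k)" for s
  proof -
    have "CL_near L g s"
      using R by blast
    then obtain d I where I: "open I" "s \<in> I" "\<And>t. t \<in> I \<Longrightarrow> d 0 t = g t" "CL_derivs L I d"
      by (rule CL_nearE) blast
    obtain C \<rho> where C: "C > 0" "\<rho> > 0" "\<And>k t. t \<in> I \<Longrightarrow> \<bar>d k t\<bar> \<le> C * \<rho> ^ k * fact k * L k"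
      using I(4) by (rule CL_derivsE) blast
    have D: "derivs_on I d"
      using I(4) by (rule CL_derivs_derivs_on)
    have eq: "d k t = (deriv ^^ k) g t" if "t \<in> I" for k t
      using derivs_on_eq_deriv[OF D I(1)] I(3) that by blast
    have "derivs_on I (\<lambda>k. (deriv ^^ k) g)"
      unfolding derivs_on_def
    proof (intro allI ballI)
      fix k t
      assume t: "t \<in> I"
      have "((deriv ^^ k) g has_real_derivative d (Suc k) t) (at t)"
        by (rule has_field_derivative_transform_within_open[OF derivs_onD[OF D t] I(1) t]) (rule eq)
      then show "((deriv ^^ k) g has_real_derivative (deriv ^^ Suc k) g t) (at t)"
        using eq[OF t, of "Suc k"] by simp
    qed
    moreover have "\<forall>k. \<forall>t\<in>I. \<bar>(deriv ^^ k) g t\<bar> \<le> C * \<rho> ^ k * fact k * L k"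
      using C(3) eq by simp
    ultimately show ?thesis
      using I(1,2) C(1,2) by blast
  qed
  then obtain I C \<rho> where I: "\<And>s. open (I s)" "\<And>s. s \<in> I s" and C: "\<And>s. C s > 0" "\<And>s. \<rho> s > 0"
    and D: "\<And>s. derivs_on (I s) (\<lambda>k. (deriv ^^ k) g)"
    and b: "\<And>s k t. t \<in> I s \<Longrightarrow> \<bar>(deriv ^^ k) g t\<bar> \<le> C s * \<rho> s ^ k * fact k * L k"
    by metis
  have "derivs_on UNIV (\<lambda>k. (deriv ^^ k) g)"
    using D I(2) unfolding derivs_on_def by blast
  moreover have "\<exists>C>0. \<exists>\<rho>>0. \<forall>k t. \<bar>t\<bar> \<le> A \<longrightarrow> \<bar>(deriv ^^ k) g t\<bar> \<le> C * \<rho> ^ k * fact k * L k" for A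
  proof -
    have "compact {-A..A}"
      by simp
    moreover have "{-A..A} \<subseteq> (\<Union>s\<in>UNIV. I s)"
      using I(2) by blast
    ultimately obtain F where F: "finite F" "{-A..A} \<subseteq> (\<Union>s\<in>F. I s)"
      using I(1) by (metis compactE_image)
    define C' where "C' = 1 + sum C F"
    define r where "r = 1 + sum \<rho> F"
    have C': "C s \<le> C'" "\<rho> s \<le> r" if "s \<in> F" for s
      using member_le_sum[OF that, of C] member_le_sum[OF that, of \<rho>] C F(1)
      by (auto simp: C'_def r_def add_increasing less_imp_le)
    have "sum C F \<ge> 0" "sum \<rho> F \<ge> 0"
      by (rule sum_nonneg, rule less_imp_le, rule C)+
    then have pos: "C' > 0" "r > 0"
      by (auto simp: C'_def r_def)
    have "\<bar>(deriv ^^ k) g t\<bar> \<le> C' * r ^ k * fact k * L k" if t: "\<bar>t\<bar> \<le> A" for k t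
    proof -
      obtain s where s: "s \<in> F" "t \<in> I s"
        using subsetD[OF F(2), of t] t by (auto simp: abs_le_iff)
      have "\<bar>(deriv ^^ k) g t\<bar> \<le> C s * \<rho> s ^ k * fact k * L k"
        using b s by blast
      also have "\<dots> \<le> C' * r ^ k * fact k * L k"
        using C'[OF s(1)] C[of s] L[rule_format, of k] pos by (intro mult_mono power_mono) (auto intro: less_imp_le)
      finally show ?thesis .
    qed
    then show ?thesis
      using pos by blast
  qed
  ultimately show ?lhs
    unfolding CL_real_global_iff by blast
qed

lemma CL_real_cong_local:
  assumes L: "\<forall>k. L k > 0"
    and loc: "\<And>s. \<exists>g\<in>CL_real L. eventually (\<lambda>t. h t = g t) (nhds s)"
  shows "h \<in> CL_real L"
  unfolding CL_real_local_iff[OF L]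
proof
  fix s
  obtain g J where g: "g \<in> CL_real L" "open J" "s \<in> J" "\<And>t. t \<in> J \<Longrightarrow> h t = g t"
    using loc[of s] by (auto simp: eventually_nhds)
  then have "CL_near L g s"
    using CL_real_local_iff[OF L] by blast
  then obtain d I where I: "open I" "s \<in> I" "\<And>t. t \<in> I \<Longrightarrow> d 0 t = g t" "CL_derivs L I d"
    by (rule CL_nearE) blast
  show "CL_near L h s"
  proof (rule CL_nearI)
    show "open (I \<inter> J)" "s \<in> I \<inter> J"
      using g I by auto
    show "CL_derivs L (I \<inter> J) d"
      using I(4) by (rule CL_derivs_subset) simp
    show "d 0 t = h t" if "t \<in> I \<inter> J" for t
      using that g I by auto
  qed
qed

text \<open>The derivatives of the product of \<open>d 0\<close> and \<open>e 0\<close>.\<close>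

definition leibniz :: "(nat \<Rightarrow> real \<Rightarrow> real) \<Rightarrow> (nat \<Rightarrow> real \<Rightarrow> real) \<Rightarrow> nat \<Rightarrow> real \<Rightarrow> real" where
  "leibniz d e k t = (\<Sum>j\<le>k. real (k choose j) * d j t * e (k - j) t)"

lemma leibniz_0 [simp]: "leibniz d e 0 t = d 0 t * e 0 t"
  by (simp add: leibniz_def)

lemma has_derivative_leibniz:
  assumes d: "\<And>k. (d k has_real_derivative d (Suc k) t) (at t)"
    and e: "\<And>k. (e k has_real_derivative e (Suc k) t) (at t)"
  shows "(leibniz d e k has_real_derivative leibniz d e (Suc k) t) (at t)"
proof -
  have "((\<lambda>t. \<Sum>j\<le>k. real (k choose j) * d j t * e (k - j) t) has_real_derivative
      (\<Sum>j\<le>k. real (k choose j) * d (Suc j) t * e (k - j) t + real (k choose j) * d j t * e (Suc (k - j)) t)) (at t)"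
    by (auto intro!: derivative_eq_intros d e simp: algebra_simps sum.distrib)
  moreover have "(\<Sum>j\<le>k. real (k choose j) * d (Suc j) t * e (k - j) t + real (k choose j) * d j t * e (Suc (k - j)) t) =
      leibniz d e (Suc k) t"
  proof -
    have 1: "(\<Sum>j\<le>k. real (k choose j) * d (Suc j) t * e (k - j) t) = (\<Sum>j\<le>Suc k. case j of 0 \<Rightarrow> 0 | Suc i \<Rightarrow> real (k choose i) * d j t * e (Suc k - j) t)"
      by (subst sum.atMost_Suc_shift) simp
    have 2: "(\<Sum>j\<le>k. real (k choose j) * d j t * e (Suc (k - j)) t) = (\<Sum>j\<le>Suc k. real (k choose j) * d j t * e (Suc k - j) t)"
      by (auto simp: Suc_diff_le intro!: sum.cong)
    show ?thesis
      unfolding sum.distrib 1 2 leibniz_def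
      unfolding sum.distrib[symmetric]
      by (intro sum.cong refl) (auto simp: algebra_simps split: nat.split)
  qed
  ultimately show ?thesis
    unfolding leibniz_def[abs_def] by simp
qed

lemma derivs_on_leibniz: "derivs_on I d \<Longrightarrow> derivs_on I e \<Longrightarrow> derivs_on I (leibniz d e)"
  unfolding derivs_on_def using has_derivative_leibniz by blast

lemma log_convex_ratio_mono:
  assumes L: "\<forall>k. L k > 0" and lc: "log_convex L"
  shows "j \<le> k \<Longrightarrow> L (Suc j) / L j \<le> L (Suc k) / L k"
proof (induction rule: dec_induct)
  case (step k)
  have "(L (Suc k))\<^sup>2 \<le> L k * L (Suc (Suc k))"
    using lc unfolding log_convex_def by (auto dest: spec[of _ "Suc k"])
  then have "L (Suc k) / L k \<le> L (Suc (Suc k)) / L (Suc k)"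
    using L[rule_format, of k] L[rule_format, of "Suc k"] by (simp add: field_simps power2_eq_square)
  then show ?case
    using step.IH by linarith
qed simp

text \<open>The quotients \<open>L (i + 1) / L i\<close> increase, so the product of the first \<open>j\<close> of them is at most the
  product of the \<open>j\<close> consecutive ones that start at \<open>k\<close>.\<close>

lemma log_convex_mult_le:
  assumes L: "\<forall>k. L k > 0" and lc: "log_convex L"
  shows "L j * L k \<le> L 0 * L (j + k)"
proof (induction j)
  case (Suc j)
  have "L (Suc j) * L k = (L (Suc j) / L j) * (L j * L k)"
    using L[rule_format, of j] by simp
  also have "\<dots> \<le> (L (Suc (j + k)) / L (j + k)) * (L 0 * L (j + k))"
    using Suc log_convex_ratio_mono[OF L lc, of j "j + k"] L
    by (intro mult_mono[of "L (Suc j) / L j"]) (auto intro: less_imp_le)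
  also have "\<dots> = L 0 * L (Suc j + k)"
    using L[rule_format, of "j + k"] by (simp add: mult.commute)
  finally show ?case .
qed simp

lemma log_convex_le_Suc:
  assumes L: "\<forall>k. L k > 0" and lc: "log_convex L"
  shows "L k \<le> (L 0 / L 1) * L (Suc k)"
  using log_convex_mult_le[OF assms, of 1 k] L[rule_format, of 1] by (simp add: field_simps)

text \<open>Since \<open>L j * L (k - j) \<le> L 0 * L k\<close> and \<open>j! (k - j)! \<le> k!\<close>, what remains of the Leibniz sum is the
  binomial expansion of \<open>(\<rho> + \<sigma>) ^ k\<close>.\<close>

lemma CL_derivs_leibniz:
  assumes L: "\<forall>k. L k > 0" and lc: "log_convex L"
    and d: "CL_derivs L I d" and e: "CL_derivs L I e"
  shows "CL_derivs L I (leibniz d e)"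
proof -
  obtain C \<rho> where C: "C > 0" "\<rho> > 0" and bd: "\<And>k t. t \<in> I \<Longrightarrow> \<bar>d k t\<bar> \<le> C * \<rho> ^ k * fact k * L k"
    using d unfolding CL_derivs_def by blast
  obtain B \<sigma> where B: "B > 0" "\<sigma> > 0" and be: "\<And>k t. t \<in> I \<Longrightarrow> \<bar>e k t\<bar> \<le> B * \<sigma> ^ k * fact k * L k"
    using e unfolding CL_derivs_def by blast
  have "\<bar>leibniz d e k t\<bar> \<le> (C * B * L 0) * (\<rho> + \<sigma>) ^ k * fact k * L k" if t: "t \<in> I" for k t
  proof -
    have "\<bar>leibniz d e k t\<bar> \<le> (\<Sum>j\<le>k. \<bar>real (k choose j) * d j t * e (k - j) t\<bar>)"
      unfolding leibniz_def by (rule sum_abs)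
    also have "\<dots> \<le> (\<Sum>j\<le>k. (C * B * L 0 * fact k * L k) * (real (k choose j) * \<rho> ^ j * \<sigma> ^ (k - j)))"
    proof (rule sum_mono)
      fix j assume j: "j \<in> {..k}"
      have "\<bar>d j t\<bar> * \<bar>e (k - j) t\<bar> \<le> (C * \<rho> ^ j * fact j * L j) * (B * \<sigma> ^ (k-j) * fact (k-j) * L (k-j))"
        using bd[OF t, of j] be[OF t, of "k - j"] by (intro mult_mono) (auto intro: order_trans[OF abs_ge_zero])
      also have "\<dots> = (C * B * \<rho> ^ j * \<sigma> ^ (k-j)) * ((fact j * fact (k-j)) * (L j * L (k-j)))"
        by (simp add: algebra_simps)
      also have "\<dots> \<le> (C * B * \<rho> ^ j * \<sigma> ^ (k-j)) * (fact k * (L 0 * L k))"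
      proof -
        have "fact j * fact (k - j) \<le> (fact k :: real)"
          using j fact_fact_dvd_fact[of j "k - j"]
          by (metis atMost_iff dvd_imp_le fact_gt_zero le_add_diff_inverse of_nat_fact of_nat_le_iff of_nat_mult)
        moreover have "L j * L (k - j) \<le> L 0 * L k"
          using log_convex_mult_le[OF L lc, of j "k - j"] j by simp
        ultimately show ?thesis
          using C B L[rule_format]
          by (intro mult_left_mono mult_mono[of "fact j * fact (k - j)"]) (auto intro: less_imp_le)
      qed
      finally have *: "\<bar>d j t\<bar> * \<bar>e (k - j) t\<bar> \<le> (C * B * \<rho> ^ j * \<sigma> ^ (k-j)) * (fact k * (L 0 * L k))" .
      have "\<bar>real (k choose j) * d j t * e (k - j) t\<bar> = real (k choose j) * (\<bar>d j t\<bar> * \<bar>e (k - j) t\<bar>)"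
        by (simp add: abs_mult)
      also have "\<dots> \<le> real (k choose j) * ((C * B * \<rho> ^ j * \<sigma> ^ (k-j)) * (fact k * (L 0 * L k)))"
        using * by (intro mult_left_mono) auto
      finally show "\<bar>real (k choose j) * d j t * e (k - j) t\<bar> \<le>
          (C * B * L 0 * fact k * L k) * (real (k choose j) * \<rho> ^ j * \<sigma> ^ (k - j))"
        by (simp add: algebra_simps)
    qed
    also have "\<dots> = (C * B * L 0 * fact k * L k) * (\<rho> + \<sigma>) ^ k"
      by (simp add: sum_distrib_left[symmetric] binomial_ring)
    finally show ?thesis
      by (simp add: algebra_simps)
  qed
  moreover have "C * B * L 0 > 0" "\<rho> + \<sigma> > 0"
    using C B L[rule_format, of 0] by auto
  ultimately show ?thesis
    using derivs_on_leibniz[OF CL_derivs_derivs_on[OF d] CL_derivs_derivs_on[OF e]] by (intro CL_derivsI)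
qed

lemma CL_derivs_affine:
  assumes d: "CL_derivs L J d" and sub: "\<And>t. t \<in> I \<Longrightarrow> a * t + b \<in> J" and L: "\<forall>k. L k > 0"
  shows "CL_derivs L I (\<lambda>k t. a ^ k * d k (a * t + b))"
proof -
  obtain C \<rho> where C: "C > 0" "\<rho> > 0" and bd: "\<And>k t. t \<in> J \<Longrightarrow> \<bar>d k t\<bar> \<le> C * \<rho> ^ k * fact k * L k"
    using d unfolding CL_derivs_def by blast
  have "((\<lambda>t. a ^ k * d k (a * t + b)) has_real_derivative a ^ Suc k * d (Suc k) (a * t + b)) (at t)"
    if "t \<in> I" for k t
  proof -
    have "(d k has_real_derivative d (Suc k) (a * t + b)) (at (a * t + b))"
      using d sub[OF that] unfolding CL_derivs_def derivs_on_def by blast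
    then show ?thesis
      by (auto intro!: derivative_eq_intros DERIV_chain2[where f = "d k"])
  qed
  moreover have "\<bar>a ^ k * d k (a * t + b)\<bar> \<le> C * ((\<bar>a\<bar> + 1) * \<rho>) ^ k * fact k * L k" if "t \<in> I" for k t
  proof -
    have "\<bar>a ^ k * d k (a * t + b)\<bar> \<le> (\<bar>a\<bar> + 1) ^ k * (C * \<rho> ^ k * fact k * L k)"
      unfolding abs_mult power_abs
      using bd[OF sub[OF that]] by (intro mult_mono power_mono) auto
    then show ?thesis
      by (simp add: power_mult_distrib mult_ac)
  qed
  moreover have "(\<bar>a\<bar> + 1) * \<rho> > 0"
    using C by (simp add: add_nonneg_pos)
  ultimately show ?thesis
    using C(1) by (intro CL_derivsI[of _ _ C "(\<bar>a\<bar> + 1) * \<rho>"]) (auto simp: derivs_on_def)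
qed

lemma CL_derivs_add:
  assumes d: "CL_derivs L I d" and e: "CL_derivs L I e" and L: "\<forall>k. L k > 0"
  shows "CL_derivs L I (\<lambda>k t. d k t + e k t)"
proof -
  obtain C \<rho> where C: "C > 0" "\<rho> > 0" and bd: "\<And>k t. t \<in> I \<Longrightarrow> \<bar>d k t\<bar> \<le> C * \<rho> ^ k * fact k * L k"
    using d unfolding CL_derivs_def by blast
  obtain B \<sigma> where B: "B > 0" "\<sigma> > 0" and be: "\<And>k t. t \<in> I \<Longrightarrow> \<bar>e k t\<bar> \<le> B * \<sigma> ^ k * fact k * L k"
    using e unfolding CL_derivs_def by blast
  have "\<bar>d k t + e k t\<bar> \<le> (C + B) * (max \<rho> \<sigma>) ^ k * fact k * L k" if "t \<in> I" for k t
  proof -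
    have "\<bar>d k t + e k t\<bar> \<le> C * \<rho> ^ k * fact k * L k + B * \<sigma> ^ k * fact k * L k"
      using bd[OF that, of k] be[OF that, of k] by linarith
    also have "\<dots> \<le> C * (max \<rho> \<sigma>) ^ k * fact k * L k + B * (max \<rho> \<sigma>) ^ k * fact k * L k"
      using C B L[rule_format] by (intro add_mono mult_right_mono mult_left_mono power_mono) (auto intro: less_imp_le)
    finally show ?thesis
      by (simp add: algebra_simps)
  qed
  moreover have "derivs_on I (\<lambda>k t. d k t + e k t)"
    using d e unfolding CL_derivs_def derivs_on_def by (auto intro!: DERIV_add)
  moreover have "C + B > 0" "max \<rho> \<sigma> > 0"
    using C B by auto
  ultimately show ?thesis
    by (intro CL_derivsI)
qed

section \<open>From quasianalyticity in one variable to several variables\<close>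

text \<open>This is quasianalyticity in one variable, for functions with uniform bounds on an interval around \<open>0\<close>.\<close>

definition flat_rigid :: "(nat \<Rightarrow> real) \<Rightarrow> bool" where
  "flat_rigid L \<longleftrightarrow>
     (\<forall>\<epsilon>>0. \<forall>d. CL_derivs L {-\<epsilon><..<\<epsilon>} d \<and> (\<forall>k. d k 0 = 0) \<longrightarrow> (\<forall>t\<in>{-\<epsilon><..<\<epsilon>}. d 0 t = 0))"

lemma flat_rigidD:
  "flat_rigid L \<Longrightarrow> \<epsilon> > 0 \<Longrightarrow> CL_derivs L {-\<epsilon><..<\<epsilon>} d \<Longrightarrow> (\<And>k. d k 0 = 0) \<Longrightarrow> \<bar>t\<bar> < \<epsilon> \<Longrightarrow> d 0 t = 0"
  unfolding flat_rigid_def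
  by (drule spec[of _ \<epsilon>], drule mp, assumption, drule spec[of _ d]) (auto simp: abs_less_iff)

text \<open>The \<open>m\<close>-fold integral from \<open>0\<close> of a flat function with the shifted bounds is flat and satisfies the
  bounds of \<open>L\<close> itself, so it vanishes.\<close>

lemma flat_rigid_shifted:
  assumes L: "\<forall>k. L k > 0" and rigid: "flat_rigid L" and \<epsilon>: "\<epsilon> > 0"
  shows "derivs_on {-\<epsilon><..<\<epsilon>} e \<Longrightarrow> C > 0 \<Longrightarrow> \<rho> > 0 \<Longrightarrow>
    (\<And>k t. \<bar>t\<bar> < \<epsilon> \<Longrightarrow> \<bar>e k t\<bar> \<le> C * \<rho> ^ k * fact (k + m) * L (k + m)) \<Longrightarrow>
    (\<And>k. e k 0 = 0) \<Longrightarrow> \<bar>t\<bar> < \<epsilon> \<Longrightarrow> e 0 t = 0"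
proof (induction m arbitrary: e C t)
  case 0
  have "CL_derivs L {-\<epsilon><..<\<epsilon>} e"
    using 0 by (intro CL_derivsI[of _ _ C \<rho>]) (auto simp: abs_less_iff)
  then show ?case
    using flat_rigidD[OF rigid \<epsilon>, of e] 0 by blast
next
  case (Suc m)
  let ?I = "{-\<epsilon><..<\<epsilon>}"
  have "isCont (e 0) x" if "ereal (-\<epsilon>) < ereal x" "ereal x < ereal \<epsilon>" for x
    using derivs_onD[OF Suc.prems(1), of x 0] that by (auto intro: DERIV_isCont)
  then obtain F where F: "\<And>x. -\<epsilon> < x \<Longrightarrow> x < \<epsilon> \<Longrightarrow> (F has_vector_derivative e 0 x) (at x)"
    using einterval_antiderivative[of "-\<epsilon>" \<epsilon> "e 0"] \<epsilon> by auto
  define E where "E = (\<lambda>k t. case k of 0 \<Rightarrow> F t - F 0 | Suc j \<Rightarrow> e j t)"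
  have E_simps [simp]: "E 0 t = F t - F 0" "E (Suc k) t = e k t" for k t
    by (simp_all add: E_def)
  have F': "((\<lambda>t. F t - F 0) has_real_derivative e 0 x) (at x)" if "x \<in> ?I" for x
    using F[of x] that by (auto simp: has_real_derivative_iff_has_vector_derivative[symmetric] intro!: derivative_eq_intros)
  have E: "derivs_on ?I E"
    unfolding derivs_on_def
  proof (intro allI ballI)
    fix k x assume x: "x \<in> ?I"
    show "(E k has_real_derivative E (Suc k) x) (at x)"
    proof (cases k)
      case 0
      then show ?thesis using F'[OF x] by (simp add: E_def)
    next
      case (Suc j)
      have "E (Suc j) = e j" by (simp add: fun_eq_iff)
      then show ?thesis using Suc derivs_onD[OF Suc.prems(1) x, of j] by simp
    qed
  qed
  define B where "B = C * fact (Suc m) * L (Suc m)"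
  have B: "\<bar>F x - F 0\<bar> \<le> B * \<epsilon>" if x: "\<bar>x\<bar> < \<epsilon>" for x
  proof -
    have "norm ((F x - F 0) - (F 0 - F 0)) \<le> B * norm (x - 0)"
    proof (rule field_differentiable_bound[of ?I])
      show "((\<lambda>t. F t - F 0) has_field_derivative e 0 y) (at y within ?I)" if "y \<in> ?I" for y
        using F'[OF that] by (rule has_field_derivative_at_within)
      show "norm (e 0 y) \<le> B" if "y \<in> ?I" for y
        using Suc.prems(4)[of y 0] that by (auto simp: B_def abs_less_iff)
    qed (use x \<epsilon> in \<open>auto simp: abs_less_iff\<close>)
    also have "B * norm (x - 0) \<le> B * \<epsilon>"
      using x Suc.prems(2) L by (intro mult_left_mono) (auto simp: B_def intro: less_imp_le)
    finally show ?thesis by simp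
  qed
  \<comment> \<open>The first summand serves for the derivatives of \<open>E\<close>, the second for \<open>E 0\<close>.\<close>
  define C' where "C' = C / \<rho> + B * \<epsilon> / (fact m * L m)"
  have C'_pos: "C' > 0" "C / \<rho> > 0" "B * \<epsilon> / (fact m * L m) \<ge> 0"
    using Suc.prems(2,3) L \<epsilon> by (auto simp: C'_def B_def intro!: add_pos_nonneg less_imp_le)
  have bound: "\<bar>E k x\<bar> \<le> C' * \<rho> ^ k * fact (k + m) * L (k + m)" if x: "\<bar>x\<bar> < \<epsilon>" for k x
  proof (cases k)
    case 0
    have "\<bar>E 0 x\<bar> \<le> B * \<epsilon> / (fact m * L m) * (fact m * L m)"
      using B[OF x] L[rule_format, of m] by simp
    also have "\<dots> \<le> C' * (fact m * L m)"
      using C'_pos L by (intro mult_right_mono) (auto simp: C'_def intro: less_imp_le)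
    finally show ?thesis by (simp add: 0 mult_ac)
  next
    case (Suc j)
    have "\<bar>E k x\<bar> \<le> C * \<rho> ^ j * fact (j + Suc m) * L (j + Suc m)"
      using Suc.prems(4)[OF x, of j] Suc by simp
    also have "\<dots> = (C / \<rho>) * (\<rho> ^ k * fact (k + m) * L (k + m))"
      using Suc Suc.prems(3) by simp
    also have "\<dots> \<le> C' * (\<rho> ^ k * fact (k + m) * L (k + m))"
      using C'_pos L Suc.prems(3) by (intro mult_right_mono) (auto simp: C'_def intro: less_imp_le)
    finally show ?thesis by (simp add: mult_ac)
  qed
  have flat: "E k 0 = 0" for k
    using Suc.prems(5) by (cases k) auto
  have zero: "F x - F 0 = 0" if "x \<in> ?I" for x
    using Suc.IH[OF E C'_pos(1) Suc.prems(3) bound flat, of x] that by (auto simp: abs_less_iff)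
  have t: "t \<in> ?I"
    using Suc.prems(6) by (auto simp: abs_less_iff)
  have "((\<lambda>t. 0) has_real_derivative e 0 t) (at t)"
  proof (rule has_field_derivative_transform_within_open[OF F'[OF t]])
    show "open ?I" by simp
    show "t \<in> ?I" by (rule t)
    show "F x - F 0 = 0" if "x \<in> ?I" for x
      using that by (rule zero)
  qed
  then show ?case
    by (rule DERIV_unique) (rule DERIV_const)
qed

definition coord_box :: "nat \<Rightarrow> (nat \<Rightarrow> real) \<Rightarrow> real \<Rightarrow> (nat \<Rightarrow> real) set" where
  "coord_box n a \<epsilon> = {x \<in> topspace (Euclidean_space n). \<forall>i<n. \<bar>x i - a i\<bar> < \<epsilon>}"

lemma openin_Euclidean_space_contains_coord_box:
  assumes "openin (Euclidean_space n) U" "a \<in> U"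
  obtains \<epsilon> where "\<epsilon> > 0" "coord_box n a \<epsilon> \<subseteq> U"
proof -
  let ?V = "{x. \<forall>i\<ge>n. x i = (0::real)}"
  obtain W where W: "openin (powertop_real UNIV) W" "U = W \<inter> ?V"
    using assms(1) unfolding Euclidean_space_def openin_subtopology by blast
  then obtain X where X: "a \<in> PiE UNIV X" "\<And>i. open (X i)" "PiE UNIV X \<subseteq> W"
    using product_topology_open_contains_basis[OF W(1), of a] assms(2) by auto
  have "\<exists>e>0. ball (a i) e \<subseteq> X i" for i
    using X(1,2) by (metis PiE_mem UNIV_I open_contains_ball)
  then obtain e where e: "\<And>i. e i > 0" "\<And>i. ball (a i) (e i) \<subseteq> X i"
    by metis
  define \<epsilon> where "\<epsilon> = Min (insert 1 (e ` {..<n}))"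
  have pos: "\<epsilon> > 0"
    using e(1) by (auto simp: \<epsilon>_def)
  have "coord_box n a \<epsilon> \<subseteq> U"
  proof
    fix x assume x: "x \<in> coord_box n a \<epsilon>"
    have "x i \<in> X i" for i
    proof (cases "i < n")
      case True
      then have "\<bar>x i - a i\<bar> < \<epsilon>" "\<epsilon> \<le> e i"
        using x by (auto simp: coord_box_def \<epsilon>_def)
      then show ?thesis
        using e(2)[of i] by (auto simp: dist_real_def abs_minus_commute)
    next
      case False
      then have "x i = a i"
        using x assms(2) W(2) by (auto simp: coord_box_def topspace_Euclidean_space)
      then show ?thesis
        using X(1) by auto
    qed
    then have "x \<in> PiE UNIV X"
      by (simp add: PiE_UNIV_domain)
    then show "x \<in> U"
      using X(3) W(2) x by (auto simp: coord_box_def topspace_Euclidean_space)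
  qed
  then show ?thesis
    using that pos by blast
qed

lemma openin_coord_box: "openin (Euclidean_space n) (coord_box n a \<epsilon>)"
proof (cases "n = 0")
  case True
  then have "coord_box n a \<epsilon> = topspace (Euclidean_space n)"
    by (auto simp: coord_box_def)
  then show ?thesis by simp
next
  case False
  have "openin (Euclidean_space n) {x \<in> topspace (Euclidean_space n). x i \<in> ball (a i) \<epsilon>}" for i
    using continuous_map_coordinate[of n i] by (auto simp: continuous_map_def)
  then have "openin (Euclidean_space n) (\<Inter>i\<in>{..<n}. {x \<in> topspace (Euclidean_space n). x i \<in> ball (a i) \<epsilon>})"
    using False by (intro openin_INT2) auto
  moreover have "(\<Inter>i\<in>{..<n}. {x \<in> topspace (Euclidean_space n). x i \<in> ball (a i) \<epsilon>}) = coord_box n a \<epsilon>"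
    using False by (auto simp: coord_box_def dist_real_def abs_minus_commute)
  ultimately show ?thesis by simp
qed

lemma compactin_closed_box:
  assumes "a \<in> topspace (Euclidean_space n)"
  shows "compactin (Euclidean_space n) {x \<in> topspace (Euclidean_space n). \<forall>i<n. \<bar>x i - a i\<bar> \<le> \<epsilon>}"
proof -
  let ?K = "{x \<in> topspace (Euclidean_space n). \<forall>i<n. \<bar>x i - a i\<bar> \<le> \<epsilon>}"
  let ?X = "\<lambda>i. if i < n then {a i - \<epsilon>..a i + \<epsilon>} else {0}"
  have eq: "?K = PiE UNIV ?X"
  proof (intro set_eqI)
    fix x
    have "x i \<in> ?X i \<longleftrightarrow> (if i < n then \<bar>x i - a i\<bar> \<le> \<epsilon> else x i = 0)" for i
      by auto
    then have "(\<forall>i. x i \<in> ?X i) \<longleftrightarrow> (\<forall>i\<ge>n. x i = 0) \<and> (\<forall>i<n. \<bar>x i - a i\<bar> \<le> \<epsilon>)"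
      by (metis not_less)
    then show "x \<in> ?K \<longleftrightarrow> x \<in> PiE UNIV ?X"
      by (simp add: topspace_Euclidean_space PiE_UNIV_domain Pi_iff)
  qed
  have "compactin (powertop_real UNIV) (PiE UNIV ?X)"
    by (simp add: compactin_PiE)
  then show ?thesis
    unfolding Euclidean_space_def compactin_subtopology eq[symmetric, unfolded Euclidean_space_def]
    by (auto simp: eq[symmetric] topspace_Euclidean_space)
qed

lemma mi_deriv_indices:
  "set (concat (map (\<lambda>i. replicate (\<alpha> i) i) [0..<n])) \<subseteq> {..<n}"
  by auto

lemma mi_deriv_Suc:
  assumes "\<forall>j<m. \<alpha> j = 0" "m < n"
  shows "mi_deriv n (\<alpha>(m := Suc k)) f = partial_deriv m (mi_deriv n (\<alpha>(m := k)) f)"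
proof -
  have split: "[0..<n] = [0..<m] @ m # [Suc m..<n]"
    using assms(2) upt_add_eq_append[of 0 m "n - m"] by (simp add: upt_conv_Cons)
  have "concat (map (\<lambda>i. replicate ((\<alpha>(m := j)) i) i) [0..<n]) =
      replicate j m @ concat (map (\<lambda>i. replicate (\<alpha> i) i) [Suc m..<n])" for j
  proof -
    have "concat (map (\<lambda>i. replicate ((\<alpha>(m := j)) i) i) [0..<m]) = []"
      using assms(1) by simp
    moreover have "map (\<lambda>i. replicate ((\<alpha>(m := j)) i) i) [Suc m..<n] = map (\<lambda>i. replicate (\<alpha> i) i) [Suc m..<n]"
      by simp
    ultimately show ?thesis
      by (simp only: split map_append concat_append append_Nil list.map concat.simps fun_upd_same)
  qed
  then show ?thesis
    unfolding mi_deriv_def by simp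
qed

lemma mi_abs_upd: "m < n \<Longrightarrow> mi_abs n (\<alpha>(m := k)) = k + mi_abs n (\<alpha>(m := 0))"
  unfolding mi_abs_def by (simp add: sum.remove[of "{..<n}" m])

text \<open>One coordinate
  is freed at a time.  After the first \<open>m\<close> coordinates have been freed, the derivatives that are known
  to agree are those in the remaining coordinates only; as functions of the next coordinate they are
  controlled by a shift of \<open>L\<close>.\<close>

lemma equal_Taylor_imp_equal_on_box:
  assumes L: "\<forall>k. L k > 0" and rigid: "flat_rigid L"
    and U: "openin (Euclidean_space n) U" "a \<in> U"
    and f: "f \<in> CM L n U" and g: "g \<in> CM L n U"
    and eq: "\<And>\<alpha>. mi_deriv n \<alpha> f a = mi_deriv n \<alpha> g a"
  obtains \<epsilon> where "\<epsilon> > 0" "coord_box n a \<epsilon> \<subseteq> U" "\<And>x. x \<in> coord_box n a \<epsilon> \<Longrightarrow> f x = g x"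
proof -
  let ?E = "Euclidean_space n"
  obtain r where r: "r > 0" "coord_box n a r \<subseteq> U"
    using openin_Euclidean_space_contains_coord_box U by blast
  define \<epsilon> where "\<epsilon> = r / 2"
  have \<epsilon>: "\<epsilon> > 0" "\<epsilon> < r"
    using r by (auto simp: \<epsilon>_def)
  have a: "a \<in> topspace ?E"
    using U openin_subset by blast
  let ?K = "{x \<in> topspace ?E. \<forall>i<n. \<bar>x i - a i\<bar> \<le> \<epsilon>}"
  have K: "compactin ?E ?K \<and> ?K \<subseteq> U"
    using compactin_closed_box[OF a] r \<epsilon> by (force simp: coord_box_def)
  have box_K: "coord_box n a \<epsilon> \<subseteq> ?K"
    by (force simp: coord_box_def)
  have box_U: "coord_box n a \<epsilon> \<subseteq> U"
    using box_K K by blast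
  obtain C1 \<rho>1 where C1: "C1 > 0" "\<rho>1 > 0" "\<And>\<alpha> x. x \<in> ?K \<Longrightarrow>
      \<bar>mi_deriv n \<alpha> f x\<bar> \<le> C1 * \<rho>1 ^ mi_abs n \<alpha> * fact (mi_abs n \<alpha>) * L (mi_abs n \<alpha>)"
    using f K unfolding CM_def by blast
  obtain C2 \<rho>2 where C2: "C2 > 0" "\<rho>2 > 0" "\<And>\<alpha> x. x \<in> ?K \<Longrightarrow>
      \<bar>mi_deriv n \<alpha> g x\<bar> \<le> C2 * \<rho>2 ^ mi_abs n \<alpha> * fact (mi_abs n \<alpha>) * L (mi_abs n \<alpha>)"
    using g K unfolding CM_def by blast
  define C where "C = C1 + C2"
  define \<rho> where "\<rho> = max \<rho>1 \<rho>2"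
  have C: "C > 0" "\<rho> > 0"
    using C1 C2 by (auto simp: C_def \<rho>_def)
  define D where "D = (\<lambda>\<alpha> x. mi_deriv n \<alpha> f x - mi_deriv n \<alpha> g x)"
  have bound: "\<bar>D \<alpha> x\<bar> \<le> C * \<rho> ^ mi_abs n \<alpha> * fact (mi_abs n \<alpha>) * L (mi_abs n \<alpha>)" if "x \<in> ?K" for \<alpha> x
  proof -
    let ?m = "mi_abs n \<alpha>"
    have "\<bar>D \<alpha> x\<bar> \<le> C1 * \<rho>1 ^ ?m * fact ?m * L ?m + C2 * \<rho>2 ^ ?m * fact ?m * L ?m"
      unfolding D_def using C1(3)[OF that, of \<alpha>] C2(3)[OF that, of \<alpha>] by linarith
    also have "\<dots> \<le> C1 * \<rho> ^ ?m * fact ?m * L ?m + C2 * \<rho> ^ ?m * fact ?m * L ?m"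
      using C1 C2 L unfolding \<rho>_def
      by (intro add_mono mult_right_mono mult_left_mono power_mono) (auto intro: less_imp_le)
    finally show ?thesis
      by (simp add: C_def algebra_simps)
  qed
  have deriv1: "((\<lambda>t. mi_deriv n (\<alpha>(m := k)) h (x(m := t))) has_real_derivative
      mi_deriv n (\<alpha>(m := Suc k)) h x) (at (x m))"
    if "h \<in> CM L n U" "m < n" "\<forall>j<m. \<alpha> j = 0" "x \<in> U" for h \<alpha> m k x
  proof -
    have "smooth_fun n U h"
      using that(1) by (simp add: CM_def)
    then have "(\<lambda>t. mi_deriv n (\<alpha>(m := k)) h (x(m := t))) field_differentiable (at (x m))"
      unfolding smooth_fun_def mi_deriv_def using that(2,4) mi_deriv_indices by blast
    then show ?thesis
      unfolding mi_deriv_Suc[OF that(3,2)] partial_deriv_def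
      by (simp add: DERIV_deriv_iff_field_differentiable)
  qed
  have stage: "m \<le> n \<Longrightarrow> x \<in> coord_box n a \<epsilon> \<Longrightarrow> \<forall>j. m \<le> j \<longrightarrow> x j = a j \<Longrightarrow> \<forall>j<m. \<alpha> j = 0 \<Longrightarrow> D \<alpha> x = 0" for m x \<alpha>
  proof (induction m arbitrary: x \<alpha>)
    case 0
    then have "x = a" by auto
    then show ?case using eq by (simp add: D_def)
  next
    case (Suc m)
    have m: "m < n" "\<forall>j<m. \<alpha> j = 0" "\<alpha>(m := 0) = \<alpha>"
      using Suc.prems by auto
    define e where "e = (\<lambda>k t. D (\<alpha>(m := k)) (x(m := a m + t)))"
    have inbox: "x(m := a m + t) \<in> coord_box n a \<epsilon>" if "\<bar>t\<bar> < \<epsilon>" for t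
      using Suc.prems(2) that m(1) by (auto simp: coord_box_def topspace_Euclidean_space)
    have "D (\<alpha>(m := 0)) (x(m := a m + (x m - a m))) = 0"
      unfolding e_def[symmetric]
    proof (rule flat_rigid_shifted[OF L rigid \<epsilon>(1), of e "C * \<rho> ^ mi_abs n \<alpha>" \<rho> "mi_abs n \<alpha>", unfolded e_def])
      show "derivs_on {-\<epsilon><..<\<epsilon>} (\<lambda>k t. D (\<alpha>(m := k)) (x(m := a m + t)))"
        unfolding derivs_on_def
      proof (intro allI ballI)
        fix k t assume t: "t \<in> {-\<epsilon><..<\<epsilon>}"
        have "x(m := a m + t) \<in> U"
          using inbox[of t] box_U t by (auto simp: abs_less_iff)
        then have "((\<lambda>s. D (\<alpha>(m := k)) (x(m := s))) has_real_derivative D (\<alpha>(m := Suc k)) (x(m := a m + t))) (at (a m + t))"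
          unfolding D_def
          using deriv1[OF f m(1,2), of "x(m := a m + t)" k] deriv1[OF g m(1,2), of "x(m := a m + t)" k]
          by (auto intro!: DERIV_diff)
        then show "((\<lambda>t. D (\<alpha>(m := k)) (x(m := a m + t))) has_real_derivative D (\<alpha>(m := Suc k)) (x(m := a m + t))) (at t)"
          by (simp add: DERIV_shift add.commute[of "a m"])
      qed
      show "\<bar>D (\<alpha>(m := k)) (x(m := a m + t))\<bar> \<le> C * \<rho> ^ mi_abs n \<alpha> * \<rho> ^ k * fact (k + mi_abs n \<alpha>) * L (k + mi_abs n \<alpha>)"
        if "\<bar>t\<bar> < \<epsilon>" for k t
      proof -
        have "mi_abs n (\<alpha>(m := k)) = k + mi_abs n \<alpha>"
          using mi_abs_upd[OF m(1), of \<alpha> k] m(3) by simp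
        then show ?thesis
          using bound[of "x(m := a m + t)" "\<alpha>(m := k)"] inbox[OF that] box_K by (auto simp: power_add mult_ac)
      qed
      show "D (\<alpha>(m := k)) (x(m := a m + 0)) = 0" for k
      proof -
        have "x(m := a m) \<in> coord_box n a \<epsilon>"
          using inbox[of 0] \<epsilon> by simp
        moreover have "\<forall>j. m \<le> j \<longrightarrow> (x(m := a m)) j = a j" "\<forall>j<m. (\<alpha>(m := k)) j = 0"
          using Suc.prems(3) m(2) by auto
        ultimately show ?thesis
          using Suc.IH Suc.prems(1) by simp
      qed
      show "\<bar>x m - a m\<bar> < \<epsilon>"
        using Suc.prems(2) m(1) by (auto simp: coord_box_def)
    qed (use C in auto)
    then show ?case
      using m(3) by simp
  qed
  have "f x = g x" if x: "x \<in> coord_box n a \<epsilon>" for x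
  proof -
    have "\<forall>j. n \<le> j \<longrightarrow> x j = a j"
      using x a by (auto simp: coord_box_def topspace_Euclidean_space)
    then have "D (\<lambda>_. 0) x = 0"
      using stage[of n x "\<lambda>_. 0"] x by simp
    moreover have "mi_deriv n (\<lambda>_. 0) h = h" for h
    proof -
      have "concat (map (\<lambda>i. replicate 0 i) [0..<n]) = []"
        by simp
      then show ?thesis
        by (simp only: mi_deriv_def iter_partial.simps)
    qed
    ultimately show ?thesis
      by (simp add: D_def)
  qed
  then show ?thesis
    using that \<epsilon>(1) box_U by blast
qed

lemma iter_partial_cong_open:
  assumes W: "openin (Euclidean_space n) W" and eq: "\<And>x. x \<in> W \<Longrightarrow> f x = g x"
  shows "set is \<subseteq> {..<n} \<Longrightarrow> x \<in> W \<Longrightarrow> iter_partial is f x = iter_partial is g x"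
proof (induction "is" arbitrary: x)
  case (Cons i "is")
  obtain \<epsilon> where \<epsilon>: "\<epsilon> > 0" "coord_box n x \<epsilon> \<subseteq> W"
    using openin_Euclidean_space_contains_coord_box[OF W Cons.prems(2)] by blast
  have x: "x \<in> topspace (Euclidean_space n)"
    using W Cons.prems(2) openin_subset by blast
  have "x(i := t) \<in> W" if "\<bar>t - x i\<bar> < \<epsilon>" for t
    using \<epsilon> x Cons.prems(1) that by (intro subsetD[OF \<epsilon>(2)]) (auto simp: coord_box_def topspace_Euclidean_space)
  then have "\<forall>\<^sub>F t in nhds (x i). iter_partial is f (x(i := t)) = iter_partial is g (x(i := t))"
    unfolding eventually_nhds_metric using Cons \<epsilon>(1) by (auto simp: dist_real_def)
  then show ?case
    by (simp add: partial_deriv_def deriv_cong_ev)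
qed (use eq in auto)

text \<open>The interior of the set where \<open>f\<close> and \<open>g\<close> agree consists of the points where all their derivatives agree:
  one inclusion is the preceding result on boxes.  Hence it is closed in \<open>U\<close> as well as open.\<close>

theorem flat_rigid_imp_quasianalytic:
  assumes L: "\<forall>k. L k > 0" and rigid: "flat_rigid L"
  shows "quasianalytic L"
  unfolding quasianalytic_def
proof (intro allI impI ballI)
  fix n U a f g x
  let ?E = "Euclidean_space n"
  assume U: "openin ?E U \<and> connectedin ?E U \<and> a \<in> U"
    and f: "f \<in> CM L n U" and g: "g \<in> CM L n U" and T: "taylor_series n a f = taylor_series n a g"
    and x: "x \<in> U"
  define Z where "Z = \<Union>{W. openin ?E W \<and> W \<subseteq> U \<and> (\<forall>y\<in>W. f y = g y)}"
  have Z_open: "openin ?E Z"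
    unfolding Z_def by blast
  have box_Z: "y \<in> Z" if y: "y \<in> U" and yeq: "\<forall>\<alpha>. mi_deriv n \<alpha> f y = mi_deriv n \<alpha> g y" for y
  proof -
    obtain \<epsilon> where "\<epsilon> > 0" "coord_box n y \<epsilon> \<subseteq> U" "\<And>x. x \<in> coord_box n y \<epsilon> \<Longrightarrow> f x = g x"
      using equal_Taylor_imp_equal_on_box[OF L rigid _ y f g yeq[rule_format]] U by blast
    moreover have "y \<in> coord_box n y \<epsilon>"
      using y U openin_subset[of ?E U] \<open>\<epsilon> > 0\<close> by (auto simp: coord_box_def)
    ultimately show ?thesis
      unfolding Z_def by (intro UnionI[of "coord_box n y \<epsilon>"]) (auto simp: openin_coord_box)
  qed
  have Z_eq: "mi_deriv n \<alpha> f y = mi_deriv n \<alpha> g y" if yZ: "y \<in> Z" for y \<alpha>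
  proof -
    obtain W where W: "openin ?E W" "\<forall>y\<in>W. f y = g y" "y \<in> W"
      using yZ by (auto simp: Z_def)
    show ?thesis
      unfolding mi_deriv_def
      by (rule iter_partial_cong_open[OF W(1) _ mi_deriv_indices W(3)]) (use W(2) in blast)
  qed
  have cont: "continuous_map (subtopology ?E U) euclideanreal (mi_deriv n \<alpha> h)" if "h \<in> CM L n U" for h \<alpha>
    using that mi_deriv_indices unfolding CM_def smooth_fun_def mi_deriv_def by blast
  let ?V = "\<lambda>\<alpha>. {y \<in> topspace (subtopology ?E U). mi_deriv n \<alpha> f y - mi_deriv n \<alpha> g y \<in> - {0}}"
  have "openin (subtopology ?E U) (?V \<alpha>)" for \<alpha>
    using continuous_map_diff[OF cont[OF f] cont[OF g], of \<alpha> \<alpha>]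
    by (rule openin_continuous_map_preimage) auto
  then have "openin ?E (\<Union>\<alpha>. ?V \<alpha>)"
    using U by (intro openin_Union) (auto simp: openin_open_subtopology)
  moreover have "U - Z = (\<Union>\<alpha>. ?V \<alpha>)"
  proof -
    have "U \<subseteq> topspace ?E"
      using U openin_subset by blast
    moreover have "y \<in> Z \<longleftrightarrow> (\<forall>\<alpha>. mi_deriv n \<alpha> f y = mi_deriv n \<alpha> g y)" if "y \<in> U" for y
      using box_Z[OF that] Z_eq[of y] by blast
    ultimately show ?thesis
      by auto
  qed
  ultimately have "openin ?E (U - Z)"
    by simp
  moreover have "a \<in> Z"
  proof (rule box_Z, goal_cases _ eq, use U in simp, intro allI)
    fix \<alpha>
    have "mi_deriv n \<alpha> f a / (\<Prod>i<n. fact (\<alpha> i)) = mi_deriv n \<alpha> g a / (\<Prod>i<n. fact (\<alpha> i))"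
      using T unfolding taylor_series_def by metis
    then show "mi_deriv n \<alpha> f a = mi_deriv n \<alpha> g a"
      by simp
  qed
  ultimately have "(U - Z) \<inter> U = {}"
    using U Z_open unfolding connectedin by blast
  then show "f x = g x"
    using x unfolding Z_def by blast
qed

section \<open>Bump functions\<close>

lemma derivs_on_zero_extension:
  assumes d: "derivs_on I d" and I: "open I" and J: "closed J" "J \<subseteq> I"
    and zero: "\<And>k t. t \<in> I \<Longrightarrow> t \<notin> J \<Longrightarrow> d k t = 0"
  shows "derivs_on UNIV (\<lambda>k t. if t \<in> I then d k t else 0)"
  unfolding derivs_on_def
proof (intro allI ballI)
  fix k t
  let ?e = "\<lambda>k t. if t \<in> I then d k t else 0"
  show "(?e k has_real_derivative ?e (Suc k) t) (at t)"
  proof (cases "t \<in> I")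
    case True
    have "(?e k has_real_derivative d (Suc k) t) (at t)"
      by (rule has_field_derivative_transform_within_open[OF derivs_onD[OF d True, of k] I True]) simp
    then show ?thesis using True by simp
  next
    case False
    have "open (- J)" "t \<in> - J"
      using J False by auto
    moreover have "0 = ?e k x" if "x \<in> - J" for x
      using zero that by auto
    ultimately have "(?e k has_real_derivative 0) (at t)"
      using has_field_derivative_transform_within_open[OF DERIV_const[of 0], of "-J" t "?e k"] by blast
    then show ?thesis using False by simp
  qed
qed

lemma CL_derivs_zero_extension:
  assumes L: "\<forall>k. L k > 0" and d: "CL_derivs L I d" and I: "open I" and J: "closed J" "J \<subseteq> I"
    and zero: "\<And>k t. t \<in> I \<Longrightarrow> t \<notin> J \<Longrightarrow> d k t = 0"
  shows "CL_derivs L UNIV (\<lambda>k t. if t \<in> I then d k t else 0)"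
proof -
  obtain C \<rho> where C: "C > 0" "\<rho> > 0" "\<And>k t. t \<in> I \<Longrightarrow> \<bar>d k t\<bar> \<le> C * \<rho> ^ k * fact k * L k"
    using d by (rule CL_derivsE) blast
  show ?thesis
  proof (rule CL_derivsI[OF _ C(1,2)])
    show "derivs_on UNIV (\<lambda>k t. if t \<in> I then d k t else 0)"
      by (rule derivs_on_zero_extension[OF CL_derivs_derivs_on[OF d] I J zero])
    show "\<bar>if t \<in> I then d k t else 0\<bar> \<le> C * \<rho> ^ k * fact k * L k" for k t
      using C(3)[of t k] C(1,2) L by (auto intro: less_imp_le)
  qed
qed

lemma not_flat_rigid_imp_flat_nonzero:
  assumes L: "\<forall>k. L k > 0" and "\<not> flat_rigid L"
  obtains \<epsilon> d t where "\<epsilon> > 0" "CL_derivs L {-\<epsilon><..<\<epsilon>} d" "\<And>k. d k 0 = 0" "0 < t" "t < \<epsilon>" "d 0 t \<noteq> 0"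
proof -
  obtain \<epsilon> d t where d: "\<epsilon> > 0" "CL_derivs L {-\<epsilon><..<\<epsilon>} d" "\<forall>k. d k 0 = 0" "t \<in> {-\<epsilon><..<\<epsilon>}" "d 0 t \<noteq> 0"
    using assms(2) unfolding flat_rigid_def by auto
  have "t \<noteq> 0"
    using d by metis
  then consider "t > 0" | "t < 0" by linarith
  then show ?thesis
  proof cases
    case 1
    then show ?thesis
      using that[OF d(1,2), of t] d by auto
  next
    case 2
    have "CL_derivs L {-\<epsilon><..<\<epsilon>} (\<lambda>k t. (-1) ^ k * d k ((-1) * t + 0))"
      by (rule CL_derivs_affine[OF d(2) _ L]) auto
    then show ?thesis
      by (rule that[OF d(1), of _ "- t"]) (use d 2 in auto)
  qed
qed

text \<open>At \<open>s\<close> the difference quotients of the cut function are dominated by those of \<open>d k\<close>, which tend to \<open>0\<close>.\<close>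

lemma derivs_on_cut:
  assumes d: "derivs_on I d" and I: "open I" "s \<in> I" and flat: "\<And>k. d k s = 0"
  shows "derivs_on (I \<union> {..<s}) (\<lambda>k t. if s < t then d k t else 0)"
  unfolding derivs_on_def
proof (intro allI ballI)
  fix k t
  let ?e = "\<lambda>k t. if s < t then d k t else 0"
  assume t: "t \<in> I \<union> {..<s}"
  consider "s < t" | "t < s" | "t = s" by linarith
  then show "(?e k has_real_derivative ?e (Suc k) t) (at t)"
  proof cases
    case 1
    have "t \<in> I" using t 1 by auto
    then have "(d k has_real_derivative d (Suc k) t) (at t)"
      using d by (simp add: derivs_onD)
    then have "(?e k has_real_derivative d (Suc k) t) (at t)"
      by (rule has_field_derivative_transform_within_open[of _ _ _ "{s<..}"]) (use 1 in auto)
    then show ?thesis using 1 by simp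
  next
    case 2
    have "((\<lambda>_. 0) has_real_derivative 0) (at t)"
      by (rule DERIV_const)
    then have "(?e k has_real_derivative 0) (at t)"
      by (rule has_field_derivative_transform_within_open[of _ _ _ "{..<s}"]) (use 2 in auto)
    then show ?thesis using 2 by simp
  next
    case 3
    have "(d k has_real_derivative d (Suc k) s) (at s)"
      using d I(2) by (simp add: derivs_onD)
    then have "((\<lambda>h. (d k (s + h) - d k s) / h) \<longlongrightarrow> 0) (at 0)"
      by (simp add: DERIV_def flat)
    then have "((\<lambda>h. (?e k (s + h) - ?e k s) / h) \<longlongrightarrow> 0) (at 0)"
      by (rule Lim_null_comparison[OF always_eventually, rotated, OF tendsto_norm_zero]) (auto simp: flat divide_nonneg_nonpos)
    then show ?thesis
      using 3 by (simp add: DERIV_def)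
  qed
qed

text \<open>Take a flat function that does not vanish identically to the right of \<open>0\<close>, and let \<open>s\<close> be the infimum of the
  points \<open>t > 0\<close> where it is nonzero.  It is flat at \<open>s\<close>, because it vanishes between \<open>0\<close> and \<open>s\<close>, and it is nonzero
  at points \<open>s + p\<close> as close to \<open>s\<close> as desired.  Smallness of \<open>p\<close> leaves room for the reflection at \<open>p\<close> used below.\<close>

lemma ex_CL_cut:
  assumes L: "\<forall>k. L k > 0" and "\<not> flat_rigid L"
  obtains \<delta> e p where "CL_derivs L {..<\<delta>} e" "\<And>k t. t \<le> 0 \<Longrightarrow> e k t = 0" "0 < p" "2 * p < \<delta>" "e 0 p \<noteq> 0"
proof -
  obtain \<epsilon> d t1 where d: "\<epsilon> > 0" "CL_derivs L {-\<epsilon><..<\<epsilon>} d" "\<And>k. d k 0 = 0" "0 < t1" "t1 < \<epsilon>" "d 0 t1 \<noteq> 0"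
    using not_flat_rigid_imp_flat_nonzero[OF assms] by blast
  define S where "S = {t. 0 < t \<and> t < \<epsilon> \<and> d 0 t \<noteq> 0}"
  define s where "s = Inf S"
  have S: "t1 \<in> S" "bdd_below S"
    using d by (auto simp: S_def intro!: bdd_belowI[of _ 0])
  have s: "0 \<le> s" "s < \<epsilon>"
    using S d cInf_lower[of t1 S] cInf_greatest[of S 0] by (auto simp: s_def S_def)
  have before: "d 0 t = 0" if "0 < t" "t < s" for t
  proof (rule ccontr)
    assume "d 0 t \<noteq> 0"
    then have "t \<in> S" using that s by (simp add: S_def)
    then show False using cInf_lower[OF _ S(2), of t] that by (simp add: s_def)
  qed
  have D: "derivs_on {-\<epsilon><..<\<epsilon>} d"
    using d(2) by (rule CL_derivs_derivs_on)
  have flat: "d k s = 0" for k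
  proof (cases "s = 0")
    case False
    then have s0: "0 < s" using s by simp
    have zero: "d k t = 0" if "t \<in> {0<..<s}" for t
    proof -
      have sub: "{0<..<s} \<subseteq> {-\<epsilon><..<\<epsilon>}" using s d(1) by auto
      have "d k t = (deriv ^^ k) (\<lambda>_. 0) t"
        by (rule derivs_on_eq_deriv[OF derivs_on_subset[OF D sub] _ _ that]) (auto intro: before)
      also have "(deriv ^^ k) (\<lambda>_. 0 :: real) = (\<lambda>_. 0)"
        by (induction k) auto
      finally show ?thesis .
    qed
    have "closure {0<..<s} = {0..s}"
      using s0 by simp
    moreover have "continuous_on {0..s} (d k)"
      using derivs_on_continuous[OF D] by (rule continuous_on_subset) (use s d(1) in auto)
    ultimately have "d k s = 0"
      using continuous_constant_on_closure[of "{0<..<s}" "d k" 0 s] zero s0 by auto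
    then show ?thesis .
  qed (use d(3) in simp)
  have "\<exists>t\<in>S. t < s + (\<epsilon> - s) / 2"
    using S(1) s unfolding s_def by (intro cInf_lessD) (auto simp: field_simps)
  then obtain t where t: "t \<in> S" "t < s + (\<epsilon> - s) / 2" by blast
  have "s \<le> t" using t(1) S(2) unfolding s_def by (rule cInf_lower)
  moreover have "s \<noteq> t" using t(1) flat[of 0] by (auto simp: S_def)
  ultimately have st: "s < t" by simp
  let ?c = "\<lambda>k t. if s < t then d k t else 0"
  obtain C \<rho> where C: "C > 0" "\<rho> > 0" "\<And>k t. t \<in> {-\<epsilon><..<\<epsilon>} \<Longrightarrow> \<bar>d k t\<bar> \<le> C * \<rho> ^ k * fact k * L k"
    using d(2) by (rule CL_derivsE) blast
  have "CL_derivs L {..<\<epsilon>} ?c"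
  proof (rule CL_derivsI[OF _ C(1,2)])
    have "derivs_on ({-\<epsilon><..<\<epsilon>} \<union> {..<s}) ?c"
      using s by (intro derivs_on_cut[OF D]) (auto simp: flat)
    then show "derivs_on {..<\<epsilon>} ?c"
      by (rule derivs_on_subset) (use s in auto)
    show "\<bar>?c k t\<bar> \<le> C * \<rho> ^ k * fact k * L k" if "t \<in> {..<\<epsilon>}" for k t
      using C(3)[of t k] C(1,2) L s that by (auto intro: less_imp_le)
  qed
  then have "CL_derivs L {..<\<epsilon> - s} (\<lambda>k t. 1 ^ k * ?c k (1 * t + s))"
    by (rule CL_derivs_affine[OF _ _ L]) auto
  then show ?thesis
    by (rule that[of _ _ "t - s"]) (use st t in \<open>auto simp: S_def field_simps\<close>)
qed

text \<open>The product of the cut function with its reflection at \<open>p\<close> vanishes outside \<open>[0, 2 p]\<close> and is nonzero at \<open>p\<close>;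
  its square is also nonnegative.\<close>

lemma ex_CL_bump:
  assumes L: "\<forall>k. L k > 0" and lc: "log_convex L" and "\<not> flat_rigid L"
  obtains d c p where "CL_derivs L UNIV d" "\<And>t. d 0 t \<ge> 0" "c > 0" "\<And>k t. t \<le> 0 \<Longrightarrow> d k t = 0"
    "\<And>k t. c \<le> t \<Longrightarrow> d k t = 0" "d 0 p > 0"
proof -
  obtain \<delta> e p where e: "CL_derivs L {..<\<delta>} e" "\<And>k t. t \<le> 0 \<Longrightarrow> e k t = 0" "0 < p" "2 * p < \<delta>" "e 0 p \<noteq> 0"
    using ex_CL_cut[OF L assms(3)] by blast
  let ?I = "{2*p - \<delta><..<\<delta>}"
  define b where "b = leibniz e (\<lambda>k t. (-1) ^ k * e k ((-1) * t + 2*p))"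
  have "CL_derivs L ?I (\<lambda>k t. (-1) ^ k * e k ((-1) * t + 2*p))"
    by (rule CL_derivs_affine[OF e(1) _ L]) auto
  moreover have "CL_derivs L ?I e"
    using e(1) by (rule CL_derivs_subset) auto
  ultimately have b: "CL_derivs L ?I b"
    unfolding b_def by (intro CL_derivs_leibniz[OF L lc])
  have b_zero: "b k t = 0" if "t \<le> 0 \<or> 2*p \<le> t" for k t
    unfolding b_def leibniz_def using that e(2) by (intro sum.neutral) auto
  let ?b = "\<lambda>k t. if t \<in> ?I then b k t else 0"
  have "CL_derivs L UNIV ?b"
    by (rule CL_derivs_zero_extension[OF L b, of "{0..2*p}"]) (use e b_zero in auto)
  then have "CL_derivs L UNIV (leibniz ?b ?b)"
    by (intro CL_derivs_leibniz[OF L lc])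
  moreover have "leibniz ?b ?b k t = 0" if "t \<le> 0 \<or> 2*p \<le> t" for k t
    unfolding leibniz_def using b_zero[OF that] by (intro sum.neutral) auto
  moreover have "leibniz ?b ?b 0 p > 0"
  proof -
    have "0 < e 0 p * e 0 p"
      using e(5) not_real_square_gt_zero by metis
    then show ?thesis
      using e by (auto simp: b_def intro: mult_pos_pos)
  qed
  ultimately show ?thesis
    using e(3) by (intro that[of "leibniz ?b ?b" "2*p" p]) auto
qed

text \<open>The normalised integral of a bump is a smooth step from \<open>0\<close> to \<open>1\<close>.\<close>

lemma ex_CL_step:
  assumes L: "\<forall>k. L k > 0" and lc: "log_convex L" and "\<not> flat_rigid L"
  obtains s c where "CL_derivs L UNIV s" "\<And>t. 0 \<le> s 0 t" "\<And>t. s 0 t \<le> 1" "c > 0"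
    "\<And>k t. t \<le> 0 \<Longrightarrow> s k t = 0" "\<And>t. c \<le> t \<Longrightarrow> s 0 t = 1"
proof -
  obtain d c p where d: "CL_derivs L UNIV d" "\<And>t. d 0 t \<ge> 0" "c > 0" "\<And>k t. t \<le> 0 \<Longrightarrow> d k t = 0"
    "\<And>k t. c \<le> t \<Longrightarrow> d k t = 0" "d 0 p > 0"
    using ex_CL_bump[OF assms] by blast
  have D: "\<And>k t. (d k has_real_derivative d (Suc k) t) (at t)"
    using d(1) unfolding CL_derivs_def derivs_on_def by blast
  have "\<And>x. isCont (d 0) x"
    using D DERIV_isCont by blast
  then obtain G where "\<And>x. (G has_vector_derivative d 0 x) (at x)"
    using einterval_antiderivative[of "-\<infinity>" \<infinity> "d 0"] by auto
  then have G: "(G has_real_derivative d 0 x) (at x)" for x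
    by (simp add: has_real_derivative_iff_has_vector_derivative)
  define F where "F = (\<lambda>t. G t - G 0)"
  have F: "(F has_real_derivative d 0 x) (at x)" for x
    unfolding F_def using G by (auto intro!: derivative_eq_intros)
  have mono: "F x \<le> F y" if "x \<le> y" for x y
    using DERIV_nonneg_imp_nondecreasing[OF that, of F] F d(2) by blast
  have const: "(F has_real_derivative 0) (at x)" if "x \<le> 0 \<or> c \<le> x" for x
    using F[of x] d(4,5) that by auto
  have cont: "continuous_on A F" for A
    using DERIV_isCont[OF F] by (auto intro: continuous_at_imp_continuous_on)
  have F_neg: "F t = 0" if "t \<le> 0" for t
    using DERIV_isconst2[of t 0 F 0, OF _ cont const] that
    by (cases "t = 0") (auto simp: F_def)
  have F_pos: "F t = F c" if "c \<le> t" for t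
    using DERIV_isconst2[of c t F t, OF _ cont const] that by (cases "t = c") auto
  have F_range: "0 \<le> F t" "F t \<le> F c" for t
    using mono[of 0 t] mono[of t c] F_neg[of t] F_neg[of 0] F_pos[of t] d(3) mono[of 0 c] by linarith+
  have Fc: "F c > 0"
  proof (rule ccontr)
    assume "\<not> F c > 0"
    then have "F t = 0" for t
      using F_range[of t] by linarith
    then have "F = (\<lambda>_. 0)"
      by (simp add: fun_eq_iff)
    then have "((\<lambda>_. 0) has_real_derivative d 0 p) (at p)"
      using F[of p] by simp
    then have "d 0 p = 0"
      by (rule DERIV_unique) (rule DERIV_const)
    then show False using d(6) by simp
  qed
  define s where "s = (\<lambda>k t. case k of 0 \<Rightarrow> F t / F c | Suc j \<Rightarrow> d j t / F c)"
  have s_simps [simp]: "s 0 t = F t / F c" "s (Suc k) t = d k t / F c" for k t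
    by (simp_all add: s_def)
  obtain C \<rho> where C: "C > 0" "\<rho> > 0" "\<And>k t. \<bar>d k t\<bar> \<le> C * \<rho> ^ k * fact k * L k"
    using d(1) by (rule CL_derivsE) blast
  define A where "A = C * L 0 / (L 1 * \<rho> * F c)"
  have A: "A > 0"
    using C L Fc by (simp add: A_def)
  have "CL_derivs L UNIV s"
  proof (rule CL_derivsI[of _ _ "A + 1 / L 0" \<rho>])
    show "derivs_on UNIV s"
      unfolding derivs_on_def
    proof (intro allI ballI)
      fix k t
      show "(s k has_real_derivative s (Suc k) t) (at t)"
      proof (cases k)
        case 0
        have "s 0 = (\<lambda>t. F t / F c)" by (simp add: fun_eq_iff)
        then show ?thesis using 0 F[of t] by (auto intro!: DERIV_cdivide)
      next
        case (Suc j)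
        have "s (Suc j) = (\<lambda>t. d j t / F c)" by (simp add: fun_eq_iff)
        then show ?thesis using Suc D[of j t] by (auto intro!: DERIV_cdivide)
      qed
    qed
    show "A + 1 / L 0 > 0"
      using A L[rule_format, of 0] by (simp add: add_pos_pos)
    show "\<bar>s k t\<bar> \<le> (A + 1 / L 0) * \<rho> ^ k * fact k * L k" for k t
    proof (cases k)
      case 0
      have "\<bar>s 0 t\<bar> \<le> 1"
        using F_range[of t] Fc by simp
      also have "1 \<le> (A + 1 / L 0) * L 0"
        using A L[rule_format, of 0] by (simp add: field_simps)
      finally show ?thesis using 0 by simp
    next
      case (Suc j)
      have "\<bar>s k t\<bar> \<le> C * \<rho> ^ j * fact j * L j / F c"
        using C(3)[of j t] Fc Suc by (simp add: divide_right_mono)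
      also have "\<dots> = (C * \<rho> ^ j / F c) * (fact j * L j)"
        by simp
      also have "\<dots> \<le> (C * \<rho> ^ j / F c) * (fact k * ((L 0 / L 1) * L k))"
        using log_convex_le_Suc[OF L lc, of j] Suc C L Fc fact_mono[of j k, where 'a=real]
        by (intro mult_left_mono mult_mono[of "fact j"]) (auto intro: less_imp_le)
      also have "\<dots> = A * \<rho> ^ k * fact k * L k"
        using Suc C(2) by (simp add: A_def field_simps)
      also have "\<dots> \<le> (A + 1 / L 0) * \<rho> ^ k * fact k * L k"
        using C(2) L by (intro mult_right_mono) (auto intro: less_imp_le)
      finally show ?thesis .
    qed
  qed (use C in auto)
  moreover have "s k t = 0" if "t \<le> 0" for k t
    using F_neg[OF that] d(4)[OF that] by (cases k) auto
  moreover have "0 \<le> s 0 t" "s 0 t \<le> 1" for t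
    using F_range[of t] Fc by auto
  moreover have "s 0 t = 1" if "c \<le> t" for t
    using F_pos[OF that] Fc by simp
  ultimately show ?thesis
    using d(3) that[of s c] by blast
qed

text \<open>The product of an ascending and a descending step.\<close>

theorem ex_CL_cutoff:
  assumes L: "\<forall>k. L k > 0" and lc: "log_convex L" and nq: "\<not> quasianalytic L" and \<eta>: "\<eta> > 0"
  obtains \<phi> where "CL_derivs L UNIV \<phi>" "\<And>t. 0 \<le> \<phi> 0 t" "\<And>t. \<phi> 0 t \<le> 1"
    "\<And>t. \<bar>t - s\<bar> \<le> \<eta> / 2 \<Longrightarrow> \<phi> 0 t = 1" "\<And>k t. \<bar>t - s\<bar> \<ge> \<eta> \<Longrightarrow> \<phi> k t = 0"
proof -
  have "\<not> flat_rigid L"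
    using flat_rigid_imp_quasianalytic[OF L] nq by blast
  then obtain g c where g: "CL_derivs L UNIV g" "\<And>t. 0 \<le> g 0 t" "\<And>t. g 0 t \<le> 1" "c > 0"
    "\<And>k t. t \<le> 0 \<Longrightarrow> g k t = 0" "\<And>t. c \<le> t \<Longrightarrow> g 0 t = 1"
    using ex_CL_step[OF L lc] by blast
  define a where "a = 2 * c / \<eta>"
  have a: "a > 0" "a * \<eta> = 2 * c"
    using g(4) \<eta> by (auto simp: a_def)
  define l where "l = (\<lambda>k t. a ^ k * g k (a * t + (2 * c - a * s)))"
  define r where "r = (\<lambda>k t. (-a) ^ k * g k ((-a) * t + (2 * c + a * s)))"
  have "CL_derivs L UNIV l" "CL_derivs L UNIV r"
    unfolding l_def r_def by (rule CL_derivs_affine[OF g(1) _ L], simp)+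
  then have "CL_derivs L UNIV (leibniz l r)"
    by (intro CL_derivs_leibniz[OF L lc])
  moreover have "leibniz l r 0 t = 1" if "\<bar>t - s\<bar> \<le> \<eta> / 2" for t
  proof -
    have "a * \<bar>t - s\<bar> \<le> a * (\<eta> / 2)"
      using that a by (intro mult_left_mono) auto
    then have "\<bar>a * (t - s)\<bar> \<le> c"
      using a by (simp add: abs_mult)
    then have "c \<le> a * t + (2 * c - a * s)" "c \<le> (-a) * t + (2 * c + a * s)"
      by (auto simp: algebra_simps abs_le_iff)
    then show ?thesis
      using g(6) by (simp add: l_def r_def)
  qed
  moreover have "leibniz l r k t = 0" if "\<bar>t - s\<bar> \<ge> \<eta>" for k t
  proof -
    have "a * \<bar>t - s\<bar> \<ge> a * \<eta>"
      using that a by (intro mult_left_mono) auto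
    then have "\<bar>a * (t - s)\<bar> \<ge> 2 * c"
      using a by (simp add: abs_mult)
    then consider "a * t + (2 * c - a * s) \<le> 0" | "(-a) * t + (2 * c + a * s) \<le> 0"
      by (fastforce simp: algebra_simps abs_if split: if_splits)
    then show ?thesis
    proof cases
      case 1
      then have "l j t = 0" for j using g(5) by (simp add: l_def)
      then show ?thesis by (simp add: leibniz_def)
    next
      case 2
      then have "r j t = 0" for j using g(5) by (simp add: r_def)
      then show ?thesis by (simp add: leibniz_def)
    qed
  qed
  moreover have "0 \<le> leibniz l r 0 t" "leibniz l r 0 t \<le> 1" for t
    using g(2,3) by (auto simp: l_def r_def intro: mult_le_one)
  ultimately show ?thesis
    by (intro that[of "leibniz l r"]) auto
qed

section \<open>Hahn--Banach and Mackey's theorem\<close>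

definition linear_form_on :: "'e::real_vector set \<Rightarrow> ('e \<Rightarrow> real) \<Rightarrow> bool" where
  "linear_form_on E l \<longleftrightarrow>
     (\<forall>x\<in>E. \<forall>y\<in>E. l (x + y) = l x + l y) \<and> (\<forall>r. \<forall>x\<in>E. l (r *\<^sub>R x) = r * l x)"

definition sublinear_on :: "'e::real_vector set \<Rightarrow> ('e \<Rightarrow> real) \<Rightarrow> bool" where
  "sublinear_on E q \<longleftrightarrow>
     (\<forall>x\<in>E. \<forall>y\<in>E. q (x + y) \<le> q x + q y) \<and> (\<forall>r>0. \<forall>x\<in>E. q (r *\<^sub>R x) \<le> r * q x)"

definition seminorm_on :: "'e::real_vector set \<Rightarrow> ('e \<Rightarrow> real) \<Rightarrow> bool" where
  "seminorm_on E p \<longleftrightarrow>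
     (\<forall>x\<in>E. \<forall>y\<in>E. p (x + y) \<le> p x + p y) \<and> (\<forall>r. \<forall>x\<in>E. p (r *\<^sub>R x) = \<bar>r\<bar> * p x)"

lemma sublinear_onD:
  assumes "sublinear_on E q"
  shows "x \<in> E \<Longrightarrow> y \<in> E \<Longrightarrow> q (x + y) \<le> q x + q y"
    and "r > 0 \<Longrightarrow> x \<in> E \<Longrightarrow> q (r *\<^sub>R x) \<le> r * q x"
  using assms by (auto simp: sublinear_on_def)

lemma sublinear_on_scale:
  assumes E: "subspace E" and q: "sublinear_on E q" and "r \<ge> 0" "x \<in> E"
  shows "q (r *\<^sub>R x) = r * q x"
proof (cases "r = 0")
  case True
  have "q 0 \<le> 2 * q 0" "q 0 \<le> (1/2) * q 0"
    using sublinear_onD(2)[OF q, of 2 0] sublinear_onD(2)[OF q, of "1/2" 0] subspace_0[OF E] by auto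
  then show ?thesis using True by simp
next
  case False
  then have r: "r > 0" using assms by simp
  have "q ((1/r) *\<^sub>R (r *\<^sub>R x)) \<le> (1/r) * q (r *\<^sub>R x)"
    using r E assms(4) by (intro sublinear_onD(2)[OF q]) (auto simp: subspace_scale)
  then have "r * q x \<le> q (r *\<^sub>R x)"
    using r by (simp add: field_simps)
  then show ?thesis
    using sublinear_onD(2)[OF q r assms(4)] by simp
qed

lemma sublinear_on_lower:
  assumes E: "subspace E" and q: "sublinear_on E q" and x: "x \<in> E"
  shows "- q (- x) \<le> q x"
proof -
  have "q (x + - x) \<le> q x + q (- x)"
    using E x by (intro sublinear_onD(1)[OF q]) (auto simp: subspace_neg)
  moreover have "q 0 = 0"
    using sublinear_on_scale[OF E q, of 0 x] x by simp
  ultimately show ?thesis by simp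
qed

text \<open>Moving a sublinear functional down in the direction \<open>y\<close> keeps it sublinear.  A minimal one is
  fixed by all these moves, which makes it additive.\<close>

definition lower_along :: "'e::real_vector set \<Rightarrow> ('e \<Rightarrow> real) \<Rightarrow> 'e \<Rightarrow> 'e \<Rightarrow> real" where
  "lower_along E q y x = (if x \<in> E then INF t\<in>{0..}. q (x + t *\<^sub>R y) - t * q y else 0)"

lemma lower_along_props:
  assumes E: "subspace E" and q: "sublinear_on E q" and y: "y \<in> E"
  shows lower_along_le: "x \<in> E \<Longrightarrow> t \<ge> 0 \<Longrightarrow> lower_along E q y x \<le> q (x + t *\<^sub>R y) - t * q y"
    and sublinear_lower_along: "sublinear_on E (lower_along E q y)"
proof -
  let ?f = "\<lambda>x t. q (x + t *\<^sub>R y) - t * q y"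
  have mem: "x + t *\<^sub>R y \<in> E" if "x \<in> E" for x t
    using that E y by (simp add: subspace_add subspace_scale)
  have bdd: "bdd_below (?f x ` {0..})" if x: "x \<in> E" for x
  proof (rule bdd_belowI2[of _ "- q (- x)"])
    fix t :: real assume "t \<in> {0..}"
    then have "t * q y = q ((x + t *\<^sub>R y) + (- x))"
      using sublinear_on_scale[OF E q, of t y] y by simp
    also have "\<dots> \<le> q (x + t *\<^sub>R y) + q (- x)"
      using x mem[OF x] E by (intro sublinear_onD(1)[OF q]) (auto simp: subspace_neg)
    finally show "- q (- x) \<le> ?f x t" by simp
  qed
  show le: "lower_along E q y x \<le> ?f x t" if "x \<in> E" "t \<ge> 0" for x t
    unfolding lower_along_def using that bdd by (auto intro: cINF_lower)
  have greatest: "m \<le> lower_along E q y x" if "x \<in> E" "\<And>t. t \<ge> 0 \<Longrightarrow> m \<le> ?f x t" for m x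
    unfolding lower_along_def using that by (auto intro!: cINF_greatest)
  show "sublinear_on E (lower_along E q y)"
    unfolding sublinear_on_def
  proof (intro conjI ballI allI impI)
    fix x x' assume x: "x \<in> E" "x' \<in> E"
    have xx: "x + x' \<in> E" using x E by (simp add: subspace_add)
    have "lower_along E q y (x + x') \<le> ?f x t + ?f x' t'" if "t \<ge> 0" "t' \<ge> 0" for t t'
    proof -
      have "lower_along E q y (x + x') \<le> ?f (x + x') (t + t')"
        using le[OF xx] that by auto
      also have "q (x + x' + (t + t') *\<^sub>R y) \<le> q (x + t *\<^sub>R y) + q (x' + t' *\<^sub>R y)"
        using sublinear_onD(1)[OF q mem[OF x(1), of t] mem[OF x(2), of t']] by (simp add: algebra_simps)
      finally show ?thesis by (simp add: algebra_simps)
    qed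
    then have "lower_along E q y (x + x') - ?f x' t' \<le> lower_along E q y x" if "t' \<ge> 0" for t'
      using that by (intro greatest[OF x(1)]) (auto simp: algebra_simps)
    then have "lower_along E q y (x + x') - lower_along E q y x \<le> lower_along E q y x'"
      by (intro greatest[OF x(2)]) (auto simp: algebra_simps)
    then show "lower_along E q y (x + x') \<le> lower_along E q y x + lower_along E q y x'"
      by simp
  next
    fix r :: real and x assume r: "r > 0" and x: "x \<in> E"
    have rx: "r *\<^sub>R x \<in> E" using x E by (simp add: subspace_scale)
    have "lower_along E q y (r *\<^sub>R x) / r \<le> ?f x t" if "t \<ge> 0" for t
    proof -
      have "lower_along E q y (r *\<^sub>R x) \<le> ?f (r *\<^sub>R x) (r * t)"
        using le[OF rx] r that by auto
      also have "q (r *\<^sub>R x + (r * t) *\<^sub>R y) \<le> r * q (x + t *\<^sub>R y)"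
        using sublinear_onD(2)[OF q r mem[OF x, of t]] by (simp add: algebra_simps)
      finally show ?thesis using r by (simp add: field_simps)
    qed
    then have "lower_along E q y (r *\<^sub>R x) / r \<le> lower_along E q y x"
      by (intro greatest[OF x])
    then show "lower_along E q y (r *\<^sub>R x) \<le> r * lower_along E q y x"
      using r by (simp add: field_simps)
  qed
qed

lemma ex_minimal_sublinear:
  assumes E: "subspace E" and q0: "sublinear_on E q0" "\<And>x. x \<notin> E \<Longrightarrow> q0 x = 0"
  obtains m where "sublinear_on E m" "\<And>x. m x \<le> q0 x"
    "\<And>q. sublinear_on E q \<Longrightarrow> (\<And>x. x \<in> E \<Longrightarrow> q x \<le> m x) \<Longrightarrow> (\<And>x. x \<notin> E \<Longrightarrow> q x = 0) \<Longrightarrow> q = m"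
proof -
  define A where "A = {q. sublinear_on E q \<and> (\<forall>x. q x \<le> q0 x) \<and> (\<forall>x. x \<notin> E \<longrightarrow> q x = 0)}"
  define P where "P = (\<lambda>q q' :: 'a \<Rightarrow> real. \<forall>x. q' x \<le> q x)"
  have po: "partial_order_on A (relation_of P A)"
    by (rule partial_order_on_relation_ofI) (auto simp: P_def fun_eq_iff intro: order_trans antisym)
  have low: "- q0 (- x) \<le> q x" if "q \<in> A" "x \<in> E" for q x
  proof -
    have "q (- x) \<le> q0 (- x)" "sublinear_on E q"
      using that by (auto simp: A_def)
    then show ?thesis
      using sublinear_on_lower[OF E, of q x] that(2) by linarith
  qed
  have chain: "\<exists>u\<in>A. \<forall>q\<in>C. P q u" if C: "C \<in> Chains (relation_of P A)" for C
  proof (cases "C = {}")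
    case True
    then show ?thesis using q0 by (auto simp: A_def)
  next
    case False
    have CA: "C \<subseteq> A"
      using C by (auto simp: Chains_def relation_of_def)
    have comp: "P q q' \<or> P q' q" if "q \<in> C" "q' \<in> C" for q q'
      using C that by (auto simp: Chains_def relation_of_def)
    define u where "u = (\<lambda>x. if x \<in> E then INF q\<in>C. q x else 0)"
    have bdd: "bdd_below ((\<lambda>q. q x) ` C)" if "x \<in> E" for x
      using low that CA by (intro bdd_belowI2[of _ "- q0 (- x)"]) auto
    have u_le: "u x \<le> q x" if "q \<in> C" for q x
      using that CA bdd by (auto simp: u_def A_def intro!: cINF_lower)
    have u_ge: "b \<le> u x" if "x \<in> E" "\<And>q. q \<in> C \<Longrightarrow> b \<le> q x" for b x
      using that False by (auto simp: u_def intro!: cINF_greatest)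
    have sub: "sublinear_on E u"
      unfolding sublinear_on_def
    proof (intro conjI ballI allI impI)
      fix x y assume xy: "x \<in> E" "y \<in> E"
      have *: "u (x + y) \<le> q x + q' y" if qq: "q \<in> C" "q' \<in> C" for q q'
      proof -
        have "sublinear_on E q" "sublinear_on E q'" using qq CA by (auto simp: A_def)
        then have s: "q (x + y) \<le> q x + q y" "q' (x + y) \<le> q' x + q' y"
          using xy by (auto intro: sublinear_onD(1))
        show ?thesis
          using comp[OF qq] s u_le[OF qq(1), of "x + y"] u_le[OF qq(2), of "x + y"]
          unfolding P_def by (smt (verit))
      qed
      then have "u (x + y) - q' y \<le> u x" if "q' \<in> C" for q'
        using that by (intro u_ge[OF xy(1)]) (auto simp: algebra_simps)
      then have "u (x + y) - u x \<le> u y"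
        by (intro u_ge[OF xy(2)]) (auto simp: algebra_simps)
      then show "u (x + y) \<le> u x + u y" by simp
    next
      fix r :: real and x assume r: "r > 0" and x: "x \<in> E"
      have "u (r *\<^sub>R x) / r \<le> u x"
      proof (rule u_ge[OF x])
        fix q assume q: "q \<in> C"
        have "q (r *\<^sub>R x) \<le> r * q x"
          using q CA r x by (intro sublinear_onD(2)) (auto simp: A_def)
        then have "u (r *\<^sub>R x) \<le> r * q x"
          using u_le[OF q, of "r *\<^sub>R x"] by simp
        then show "u (r *\<^sub>R x) / r \<le> q x"
          using r by (simp add: field_simps)
      qed
      then show "u (r *\<^sub>R x) \<le> r * u x"
        using r by (simp add: field_simps)
    qed
    obtain q1 where q1: "q1 \<in> C" using False by blast
    have "u x \<le> q0 x" for x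
    proof -
      have "q1 x \<le> q0 x"
        using q1 CA unfolding A_def by blast
      then show ?thesis
        using u_le[OF q1, of x] by linarith
    qed
    then have "u \<in> A"
      using sub by (auto simp: A_def u_def)
    then show ?thesis
      using u_le by (auto simp: P_def)
  qed
  obtain m where m: "m \<in> A" "\<And>q. q \<in> A \<Longrightarrow> P m q \<Longrightarrow> q = m"
    using predicate_Zorn[OF po chain] by metis
  show ?thesis
  proof (rule that[of m])
    show "sublinear_on E m" "\<And>x. m x \<le> q0 x"
      using m(1) by (auto simp: A_def)
    fix q assume q: "sublinear_on E q" "\<And>x. x \<in> E \<Longrightarrow> q x \<le> m x" "\<And>x. x \<notin> E \<Longrightarrow> q x = 0"
    have le: "q x \<le> m x" for x
      using q(2,3)[of x] m(1) by (cases "x \<in> E") (auto simp: A_def)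
    then have "q x \<le> q0 x" for x
      using m(1) by (auto simp: A_def intro: order_trans)
    then show "q = m"
      using q le by (intro m(2)) (auto simp: A_def P_def)
  qed
qed

text \<open>A minimal sublinear functional below \<open>p\<close> is linear.  To obtain the value \<open>p x0\<close> at \<open>x0\<close>, the descent starts from
  \<open>p\<close> already lowered along \<open>x0\<close>, whose value at \<open>- x0\<close> is at most \<open>- p x0\<close>.\<close>

theorem Hahn_Banach_seminorm:
  assumes E: "subspace E" and p: "seminorm_on E p" and x0: "x0 \<in> E"
  obtains l where "linear_form_on E l" "\<And>x. x \<in> E \<Longrightarrow> \<bar>l x\<bar> \<le> p x" "l x0 = p x0"
proof -
  have sp: "sublinear_on E p"
    using p by (auto simp: sublinear_on_def seminorm_on_def)
  let ?q = "lower_along E p x0"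
  have q: "sublinear_on E ?q" "\<And>x. x \<notin> E \<Longrightarrow> ?q x = 0"
    using sublinear_lower_along[OF E sp x0] by (auto simp: lower_along_def)
  obtain m where m: "sublinear_on E m" "\<And>x. m x \<le> ?q x"
    "\<And>q. sublinear_on E q \<Longrightarrow> (\<And>x. x \<in> E \<Longrightarrow> q x \<le> m x) \<Longrightarrow> (\<And>x. x \<notin> E \<Longrightarrow> q x = 0) \<Longrightarrow> q = m"
    using ex_minimal_sublinear[OF E q] by blast
  have add: "m (x + y) = m x + m y" if xy: "x \<in> E" "y \<in> E" for x y
  proof -
    have "lower_along E m y = m"
    proof (rule m(3))
      show "sublinear_on E (lower_along E m y)"
        using sublinear_lower_along[OF E m(1) xy(2)] .
      show "lower_along E m y x \<le> m x" if "x \<in> E" for x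
        using lower_along_le[OF E m(1) xy(2) that, of 0] by simp
    qed (simp add: lower_along_def)
    then have "m x \<le> m (x + y) - m y"
      using lower_along_le[OF E m(1) xy(2,1), of 1] by simp
    then show ?thesis
      using sublinear_onD(1)[OF m(1) xy] by simp
  qed
  have neg: "m (- x) = - m x" if "x \<in> E" for x
    using add[OF that subspace_neg[OF E that]] sublinear_on_scale[OF E m(1), of 0 x] that by simp
  have scale: "m (r *\<^sub>R x) = r * m x" if x: "x \<in> E" for r x
  proof (cases "r \<ge> 0")
    case True
    then show ?thesis using sublinear_on_scale[OF E m(1) _ x] by simp
  next
    case False
    then have "m (- (r *\<^sub>R x)) = - (r * m x)"
      using sublinear_on_scale[OF E m(1) _ x, of "- r"] by simp
    then show ?thesis
      using neg[of "r *\<^sub>R x"] subspace_scale[OF E x, of r] by simp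
  qed
  have le: "m x \<le> p x" if "x \<in> E" for x
    using m(2)[of x] lower_along_le[OF E sp x0 that, of 0] by simp
  have sym: "p (- x) = p x" if "x \<in> E" for x
  proof -
    have "p ((-1) *\<^sub>R x) = \<bar>-1\<bar> * p x"
      using p that unfolding seminorm_on_def by blast
    then show ?thesis by simp
  qed
  have abs: "\<bar>m x\<bar> \<le> p x" if "x \<in> E" for x
    using le[OF that] le[OF subspace_neg[OF E that]] neg[OF that] sym[OF that] by simp
  have "m (- x0) \<le> p (- x0 + 1 *\<^sub>R x0) - 1 * p x0"
    using m(2)[of "- x0"] lower_along_le[OF E sp x0 subspace_neg[OF E x0], of 1] by simp
  moreover have "p 0 = 0"
    using sublinear_on_scale[OF E sp, of 0 x0] x0 by simp
  ultimately have "p x0 \<le> m x0"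
    using neg[OF x0] by simp
  then show ?thesis
    using that[of m] add scale abs le[OF x0] by (auto simp: linear_form_on_def)
qed

lemma lcs_subspace: "locally_convex_space T \<Longrightarrow> subspace (topspace T)"
  by (simp add: locally_convex_space_def)

lemma lcs_affine_continuous:
  assumes T: "locally_convex_space T" and a: "a \<in> topspace T"
  shows "continuous_map T T (\<lambda>x. r *\<^sub>R x + a)"
proof -
  have add: "continuous_map (prod_topology T T) T (\<lambda>(x, y). x + y)"
    and scale: "continuous_map (prod_topology euclideanreal T) T (\<lambda>(r, x). r *\<^sub>R x)"
    using T by (auto simp: locally_convex_space_def)
  have "continuous_map T T ((\<lambda>(r, x). r *\<^sub>R x) \<circ> (\<lambda>x. (r, x)))"
    by (rule continuous_map_compose[OF _ scale]) (auto intro!: continuous_map_pairedI)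
  then have "continuous_map T T (\<lambda>x. r *\<^sub>R x)"
    by (simp add: o_def)
  then have "continuous_map T (prod_topology T T) (\<lambda>x. (r *\<^sub>R x, a))"
    using a by (auto intro!: continuous_map_pairedI)
  then have "continuous_map T T ((\<lambda>(x, y). x + y) \<circ> (\<lambda>x. (r *\<^sub>R x, a)))"
    by (rule continuous_map_compose[OF _ add])
  then show ?thesis
    by (simp add: o_def)
qed

lemma lcs_open_preimage_affine:
  assumes T: "locally_convex_space T" and a: "a \<in> topspace T" and U: "openin T U"
  shows "openin T {x \<in> topspace T. r *\<^sub>R x + a \<in> U}"
  using lcs_affine_continuous[OF T a, of r] U by (auto simp: continuous_map_def)

text \<open>The Minkowski functional of a symmetric convex open neighbourhood of \<open>0\<close>.\<close>

lemma lcs_gauge: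
  assumes T: "locally_convex_space T" and U: "openin T U" "0 \<in> U"
  obtains p W where "seminorm_on (topspace T) p" "\<And>x. x \<in> topspace T \<Longrightarrow> p x < 1 \<Longrightarrow> x \<in> U"
    "openin T W" "0 \<in> W" "\<And>x. x \<in> W \<Longrightarrow> p x \<le> 1"
proof -
  let ?E = "topspace T"
  have E: "subspace ?E" using T by (rule lcs_subspace)
  obtain V where V: "openin T V" "0 \<in> V" "convex V" "V \<subseteq> U"
    using T U unfolding locally_convex_space_def by meson
  define W where "W = V \<inter> {x \<in> ?E. (-1) *\<^sub>R x + 0 \<in> V}"
  have W_open: "openin T W"
    unfolding W_def using V(1) lcs_open_preimage_affine[OF T subspace_0[OF E] V(1)] by blast
  have W0: "0 \<in> W" using V(2) subspace_0[OF E] by (simp add: W_def)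
  have WE: "W \<subseteq> ?E" using W_open openin_subset by blast
  have W_conv: "convex W"
  proof (rule convexI)
    fix x y and u v :: real assume *: "x \<in> W" "y \<in> W" "0 \<le> u" "0 \<le> v" "u + v = 1"
    have mem: "x \<in> V" "y \<in> V" "- x \<in> V" "- y \<in> V"
      using * by (auto simp: W_def)
    have "u *\<^sub>R x + v *\<^sub>R y \<in> V"
      using mem * by (intro convexD[OF V(3)])
    moreover have "u *\<^sub>R (- x) + v *\<^sub>R (- y) \<in> V"
      using mem * by (intro convexD[OF V(3)])
    moreover have "u *\<^sub>R x + v *\<^sub>R y \<in> ?E"
      using * WE E by (auto intro!: subspace_add subspace_scale)
    ultimately show "u *\<^sub>R x + v *\<^sub>R y \<in> W"
      by (simp add: W_def)
  qed
  have W_sym: "- x \<in> W" if "x \<in> W" for x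
    using that E by (auto simp: W_def subspace_neg)
  have W_shrink: "s *\<^sub>R x \<in> W" if "x \<in> W" "0 \<le> s" "s \<le> 1" for s x
    using convexD[OF W_conv that(1) W0, of s "1 - s"] that by simp
  define S where "S = (\<lambda>x. {t. t > 0 \<and> (1 / t) *\<^sub>R x \<in> W})"
  define p where "p = (\<lambda>x. Inf (S x))"
  have S_up: "t' \<in> S x" if "t \<in> S x" "t \<le> t'" for t t' x
  proof -
    have t: "t > 0" "t' > 0" "(1 / t) *\<^sub>R x \<in> W"
      using that by (auto simp: S_def)
    then have "(t / t') *\<^sub>R ((1 / t) *\<^sub>R x) \<in> W"
      using that(2) by (intro W_shrink[OF t(3)]) auto
    then show ?thesis using t by (simp add: S_def)
  qed
  have S_ne: "S x \<noteq> {}" if x: "x \<in> ?E" for x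
  proof -
    have "continuous_map euclideanreal T (\<lambda>r. r *\<^sub>R x)"
    proof -
      have "continuous_map (prod_topology euclideanreal T) T (\<lambda>(r, x). r *\<^sub>R x)"
        using T by (auto simp: locally_convex_space_def)
      moreover have "continuous_map euclideanreal (prod_topology euclideanreal T) (\<lambda>r. (r, x))"
        using x by (auto intro!: continuous_map_pairedI)
      ultimately show ?thesis
        using continuous_map_compose[of euclideanreal _ "\<lambda>r. (r, x)" T "\<lambda>(r, x). r *\<^sub>R x"] by (simp add: o_def)
    qed
    then have "open {r. r *\<^sub>R x \<in> W}"
      using W_open by (auto simp: continuous_map_def)
    moreover have "0 \<in> {r. r *\<^sub>R x \<in> W}" using W0 by simp
    ultimately obtain e where e: "e > 0" "ball 0 e \<subseteq> {r. r *\<^sub>R x \<in> W}"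
      by (meson open_contains_ball)
    have "e / 2 \<in> ball 0 e" using e by simp
    then have "(e / 2) *\<^sub>R x \<in> W" using e(2) by blast
    then have "2 / e \<in> S x" using e(1) by (simp add: S_def)
    then show ?thesis by blast
  qed
  have S_bdd: "bdd_below (S x)" for x by (rule bdd_belowI[of _ 0]) (auto simp: S_def)
  have p_lt: "t \<in> S x" if "x \<in> ?E" "p x < t" for x t
    using cInf_lessD[OF S_ne[OF that(1)], of t] that S_up[of _ x t] unfolding p_def by (meson less_imp_le)
  have p_le: "p x \<le> t" if "t \<in> S x" for x t
    using that S_bdd unfolding p_def by (rule cInf_lower)
  have p_nonneg: "0 \<le> p x" if "x \<in> ?E" for x
    using S_ne[OF that] unfolding p_def by (intro cInf_greatest) (auto simp: S_def)
  have p_add: "p (x + y) \<le> p x + p y" if xy: "x \<in> ?E" "y \<in> ?E" for x y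
  proof (rule field_le_epsilon)
    fix e :: real assume e: "e > 0"
    let ?s = "p x + e / 2" and ?t = "p y + e / 2"
    have st: "?s \<in> S x" "?t \<in> S y" using p_lt[OF xy(1), of ?s] p_lt[OF xy(2), of ?t] e by auto
    then have pos: "?s > 0" "?t > 0" by (auto simp: S_def)
    have "(?s / (?s + ?t)) *\<^sub>R ((1 / ?s) *\<^sub>R x) + (?t / (?s + ?t)) *\<^sub>R ((1 / ?t) *\<^sub>R y) \<in> W"
      using st pos by (intro convexD[OF W_conv]) (auto simp: S_def add_divide_distrib[symmetric])
    also have "(?s / (?s + ?t)) *\<^sub>R ((1 / ?s) *\<^sub>R x) + (?t / (?s + ?t)) *\<^sub>R ((1 / ?t) *\<^sub>R y) = (1 / (?s + ?t)) *\<^sub>R (x + y)"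
      using pos by (simp add: scaleR_add_right)
    finally have "?s + ?t \<in> S (x + y)" using pos by (simp add: S_def)
    then show "p (x + y) \<le> p x + p y + e" using p_le by fastforce
  qed
  have p_scale_le: "p (r *\<^sub>R x) \<le> \<bar>r\<bar> * p x" if x: "x \<in> ?E" and r: "r \<noteq> 0" for r x
  proof (rule field_le_epsilon)
    fix e :: real assume e: "e > 0"
    let ?t = "p x + e / \<bar>r\<bar>"
    have t: "?t \<in> S x" using p_lt[OF x, of ?t] e r by simp
    have "(1 / (\<bar>r\<bar> * t)) * r = sgn r * (1 / t)" for t
      using r by (simp add: sgn_if)
    then have "(1 / (\<bar>r\<bar> * ?t)) *\<^sub>R (r *\<^sub>R x) = sgn r *\<^sub>R ((1 / ?t) *\<^sub>R x)"
      unfolding scaleR_scaleR by (simp only:)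
    moreover have "sgn r *\<^sub>R ((1 / ?t) *\<^sub>R x) \<in> W"
      using t r W_sym by (auto simp: S_def sgn_if)
    ultimately have "(1 / (\<bar>r\<bar> * ?t)) *\<^sub>R (r *\<^sub>R x) \<in> W" by (simp only:)
    then have "\<bar>r\<bar> * ?t \<in> S (r *\<^sub>R x)" using t r unfolding S_def by simp
    then show "p (r *\<^sub>R x) \<le> \<bar>r\<bar> * p x + e" using p_le r by (fastforce simp: algebra_simps)
  qed
  have p0: "p 0 = 0"
  proof -
    have "p 0 \<le> t" if "t > 0" for t using that W0 by (intro p_le) (simp add: S_def)
    then have "p 0 \<le> 0" using field_le_epsilon[of "p 0" 0] by simp
    then show ?thesis using p_nonneg subspace_0[OF E] by (simp add: antisym)
  qed
  have p_scale: "p (r *\<^sub>R x) = \<bar>r\<bar> * p x" if x: "x \<in> ?E" for r x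
  proof (cases "r = 0")
    case False
    have "p ((1 / r) *\<^sub>R (r *\<^sub>R x)) \<le> \<bar>1 / r\<bar> * p (r *\<^sub>R x)"
      using False x E by (intro p_scale_le) (auto simp: subspace_scale)
    then have "\<bar>r\<bar> * p x \<le> p (r *\<^sub>R x)" using False by (simp add: field_simps)
    then show ?thesis using p_scale_le[OF x False] by simp
  qed (simp add: p0)
  show ?thesis
  proof (rule that)
    show "seminorm_on ?E p" using p_add p_scale by (auto simp: seminorm_on_def)
    show "x \<in> U" if "x \<in> ?E" "p x < 1" for x
      using p_lt[OF that] V(4) by (auto simp: S_def W_def)
    show "p x \<le> 1" if "x \<in> W" for x
      using that by (intro p_le) (simp add: S_def)
  qed (use W_open W0 in auto)
qed

lemma continuous_dualI:
  assumes T: "locally_convex_space T" and l: "linear_form_on (topspace T) l"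
    and W: "openin T W" "0 \<in> W" "\<And>x. x \<in> W \<Longrightarrow> \<bar>l x\<bar> \<le> C"
  shows "l \<in> continuous_dual T"
proof -
  let ?E = "topspace T"
  have E: "subspace ?E" using T by (rule lcs_subspace)
  have diff: "l (x - y) = l x - l y" if "x \<in> ?E" "y \<in> ?E" for x y
  proof -
    have "l (x + (-1) *\<^sub>R y) = l x + (-1) * l y"
      using l that E unfolding linear_form_on_def by (metis subspace_scale)
    then show ?thesis by simp
  qed
  have "openin T {x \<in> ?E. l x \<in> S}" if S: "open S" for S
  proof (subst openin_subopen, intro ballI)
    fix x assume "x \<in> {x \<in> ?E. l x \<in> S}"
    then have x: "x \<in> ?E" "l x \<in> S" by auto
    obtain e where e: "e > 0" "ball (l x) e \<subseteq> S" using S x(2) by (meson open_contains_ball)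
    define r where "r = e / (\<bar>C\<bar> + 1)"
    have r: "r > 0" using e by (simp add: r_def add_nonneg_pos)
    let ?N = "{y \<in> ?E. (1 / r) *\<^sub>R y + (- (1 / r) *\<^sub>R x) \<in> W}"
    have "openin T ?N"
      using x(1) E by (intro lcs_open_preimage_affine[OF T _ W(1)]) (simp add: subspace_scale subspace_neg)
    moreover have "x \<in> ?N" using x W(2) by simp
    moreover have "?N \<subseteq> {x \<in> ?E. l x \<in> S}"
    proof safe
      fix y assume y: "y \<in> ?E" "(1 / r) *\<^sub>R y + (- (1 / r) *\<^sub>R x) \<in> W"
      have eq: "(1 / r) *\<^sub>R y + (- (1 / r) *\<^sub>R x) = (1 / r) *\<^sub>R (y - x)"
        by (simp add: scaleR_diff_right)
      have "\<bar>l ((1 / r) *\<^sub>R (y - x))\<bar> \<le> C"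
        using W(3) y(2) unfolding eq by blast
      moreover have "l ((1 / r) *\<^sub>R (y - x)) = (1 / r) * (l y - l x)"
        using l x(1) y(1) E diff unfolding linear_form_on_def by (metis subspace_diff)
      moreover have "\<bar>(1 / r) * (l y - l x)\<bar> = \<bar>l y - l x\<bar> / r"
        using r by (simp add: abs_mult)
      ultimately have "\<bar>l y - l x\<bar> / r \<le> C"
        by (simp only:)
      then have "\<bar>l y - l x\<bar> \<le> r * C"
        using r by (simp add: pos_divide_le_eq mult.commute)
      also have "r * C < r * (\<bar>C\<bar> + 1)"
        using r by (intro mult_strict_left_mono) auto
      also have "\<dots> = e" using e by (simp add: r_def)
      finally show "l y \<in> S" using e(2) by (auto simp: dist_real_def abs_minus_commute)
    qed
    ultimately show "\<exists>N. openin T N \<and> x \<in> N \<and> N \<subseteq> {x \<in> ?E. l x \<in> S}" by blast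
  qed
  then have "continuous_map T euclideanreal l"
    by (auto simp: continuous_map_def)
  then show ?thesis
    using l by (auto simp: continuous_dual_def linear_form_on_def)
qed

lemma dualD:
  assumes "l \<in> continuous_dual T"
  shows dual_add: "x \<in> topspace T \<Longrightarrow> y \<in> topspace T \<Longrightarrow> l (x + y) = l x + l y"
    and dual_scale: "x \<in> topspace T \<Longrightarrow> l (r *\<^sub>R x) = r * l x"
    and dual_continuous: "continuous_map T euclideanreal l"
  using assms by (auto simp: continuous_dual_def)

lemma dual_diff:
  assumes T: "locally_convex_space T" and "l \<in> continuous_dual T" "x \<in> topspace T" "y \<in> topspace T"
  shows "l (x - y) = l x - l y"
proof -
  have "l (x + (-1) *\<^sub>R y) = l x + l ((-1) *\<^sub>R y)"
    using assms lcs_subspace[OF T] by (intro dual_add) (auto simp: subspace_scale subspace_neg)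
  also have "l ((-1) *\<^sub>R y) = (-1) * l y"
    using assms by (intro dual_scale) auto
  finally show ?thesis by simp
qed

text \<open>The gauge of a neighbourhood of \<open>0\<close> that misses \<open>x\<close> is nonzero at \<open>x\<close>, and by Hahn--Banach some functional
  takes the same value there.\<close>

lemma dual_separates:
  assumes T: "locally_convex_space T" "Hausdorff_space T" and x: "x \<in> topspace T"
    and zero: "\<And>l. l \<in> continuous_dual T \<Longrightarrow> l x = 0"
  shows "x = 0"
proof (rule ccontr)
  assume "x \<noteq> 0"
  have E: "subspace (topspace T)" using T(1) by (rule lcs_subspace)
  obtain U where U: "openin T U" "0 \<in> U" "x \<notin> U"
    using T(2) x subspace_0[OF E] \<open>x \<noteq> 0\<close> unfolding Hausdorff_space_def
    by (metis disjnt_iff)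
  obtain p W where p: "seminorm_on (topspace T) p" "\<And>x. x \<in> topspace T \<Longrightarrow> p x < 1 \<Longrightarrow> x \<in> U"
    and W: "openin T W" "0 \<in> W" "\<And>x. x \<in> W \<Longrightarrow> p x \<le> 1"
    using lcs_gauge[OF T(1) U(1,2)] by blast
  obtain l where l: "linear_form_on (topspace T) l" "\<And>x. x \<in> topspace T \<Longrightarrow> \<bar>l x\<bar> \<le> p x" "l x = p x"
    using Hahn_Banach_seminorm[OF E p(1) x] by blast
  have "\<bar>l y\<bar> \<le> 1" if "y \<in> W" for y
    using l(2)[of y] W(3)[OF that] openin_subset[OF W(1)] that by force
  then have "l \<in> continuous_dual T"
    by (rule continuous_dualI[OF T(1) l(1) W(1,2)])
  from zero[OF this] have "p x = 0" using l(3) by simp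
  then show False using p(2)[OF x] U(3) by simp
qed

text \<open>If a continuous seminorm \<open>p\<close> were unbounded on \<open>A\<close>, pick points
  \<open>x n\<close> of \<open>A\<close> with \<open>p (x n) \<ge> 4 ^ n\<close> and norming functionals \<open>m n\<close>.  With suitable signs, the functional
  \<open>\<Sum>n. \<plusminus> 3 ^ (- n) * m n\<close> has size at least \<open>(4 / 3) ^ n / 2\<close> at \<open>x n\<close>: the sign of the \<open>n\<close>-th term is chosen to
  prevent cancellation with the earlier terms, and the later terms are too small to matter.\<close>

lemma weakly_bounded_imp_seminorm_bounded:
  assumes T: "locally_convex_space T" and A: "A \<subseteq> topspace T"
    and weak: "\<And>l. l \<in> continuous_dual T \<Longrightarrow> \<exists>M. \<forall>a\<in>A. \<bar>l a\<bar> \<le> M"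
    and p: "seminorm_on (topspace T) p" and W: "openin T W" "0 \<in> W" "\<And>x. x \<in> W \<Longrightarrow> p x \<le> 1"
  shows "\<exists>M. \<forall>a\<in>A. p a \<le> M"
proof (rule ccontr)
  assume "\<not> ?thesis"
  then have "\<forall>n::nat. \<exists>a\<in>A. 4 ^ n < p a"
    by (meson not_le)
  then obtain x where x: "\<And>n::nat. x n \<in> A" "\<And>n. 4 ^ n < p (x n)"
    by metis
  let ?E = "topspace T"
  have E: "subspace ?E" using T by (rule lcs_subspace)
  have "\<exists>l. linear_form_on ?E l \<and> (\<forall>x\<in>?E. \<bar>l x\<bar> \<le> p x) \<and> l (x n) = p (x n)" for n
    using Hahn_Banach_seminorm[OF E p, of "x n"] x(1) A by (metis subsetD)
  then obtain m where m: "\<And>n. linear_form_on ?E (m n)" "\<And>n y. y \<in> ?E \<Longrightarrow> \<bar>m n y\<bar> \<le> p y"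
    "\<And>n. m n (x n) = p (x n)"
    by metis
  define L where "L = rec_nat (\<lambda>_. 0) (\<lambda>n f y. f y + (if f (x n) \<ge> 0 then 1 else -1) * (1/3) ^ n * m n y)"
  define c where "c = (\<lambda>n. (if L n (x n) \<ge> 0 then 1 else -1) * (1/3::real) ^ n)"
  have L_simps: "L 0 y = 0" "L (Suc n) y = L n y + c n * m n y" for n y
    by (simp_all add: L_def c_def)
  have L_sum: "L n y = (\<Sum>k<n. c k * m k y)" for n y
    by (induction n) (simp_all add: L_simps)
  have c_abs: "\<bar>c n\<bar> = (1/3) ^ n" for n by (simp add: c_def abs_mult)
  have term_le: "norm (c n * m n y) \<le> (1/3) ^ n * p y" if "y \<in> ?E" for n y
    using m(2)[OF that, of n] by (simp add: abs_mult c_abs)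
  have geo: "summable (\<lambda>n. (1/3::real) ^ n * b)" for b
    by (intro summable_mult2 summable_geometric) simp
  have summ: "summable (\<lambda>n. c n * m n y)" if "y \<in> ?E" for y
    by (rule summable_comparison_test'[OF geo]) (rule term_le[OF that])
  define l where "l = (\<lambda>y. \<Sum>n. c n * m n y)"
  have tail: "\<bar>l y - L n y\<bar> \<le> (1/3) ^ n * (3/2) * p y" if y: "y \<in> ?E" for n y
  proof -
    have "l y - L n y = (\<Sum>k. c (k + n) * m (k + n) y)"
      unfolding l_def L_sum using suminf_split_initial_segment[OF summ[OF y], of n] by simp
    also have "norm (\<Sum>k. c (k + n) * m (k + n) y) \<le> (\<Sum>k. (1/3) ^ k * ((1/3) ^ n * p y))"
    proof (rule norm_suminf_le)
      show "norm (c (k + n) * m (k + n) y) \<le> (1/3) ^ k * ((1/3) ^ n * p y)" for k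
        using term_le[OF y, of "k + n"] by (simp add: power_add)
    qed (rule geo)
    also have "\<dots> = (3/2) * ((1/3) ^ n * p y)"
      using suminf_geometric[of "1/3::real"] by (subst suminf_mult2[symmetric]) (auto intro: summable_geometric)
    finally show ?thesis by simp
  qed
  have lin: "linear_form_on ?E l"
    unfolding linear_form_on_def
  proof (intro conjI ballI allI)
    fix y z assume yz: "y \<in> ?E" "z \<in> ?E"
    have "m n (y + z) = m n y + m n z" for n using m(1)[of n] yz by (auto simp: linear_form_on_def)
    then show "l (y + z) = l y + l z"
      unfolding l_def using suminf_add[OF summ[OF yz(1)] summ[OF yz(2)]] by (simp add: distrib_left)
  next
    fix r y assume y: "y \<in> ?E"
    have "m n (r *\<^sub>R y) = r * m n y" for n using m(1)[of n] y by (auto simp: linear_form_on_def)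
    then show "l (r *\<^sub>R y) = r * l y"
      unfolding l_def using suminf_mult[OF summ[OF y], of r] by (simp add: mult_ac)
  qed
  have "\<bar>l y\<bar> \<le> 3/2" if "y \<in> W" for y
    using tail[of y 0] W(3)[OF that] openin_subset[OF W(1)] that by (force simp: L_simps)
  then have "l \<in> continuous_dual T"
    by (rule continuous_dualI[OF T lin W(1,2)])
  then obtain M where M: "\<And>a. a \<in> A \<Longrightarrow> \<bar>l a\<bar> \<le> M" using weak by blast
  have big: "(4/3) ^ n / 2 \<le> M" for n
  proof -
    have xn: "x n \<in> ?E" using x(1) A by blast
    have "(1/3) ^ n * p (x n) \<le> \<bar>L (Suc n) (x n)\<bar>"
      using x(2)[of n] by (auto simp: L_simps c_def m(3) abs_if algebra_simps)
    moreover have "\<bar>l (x n) - L (Suc n) (x n)\<bar> \<le> (1/3) ^ n * p (x n) / 2"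
      using tail[OF xn, of "Suc n"] by simp
    ultimately have "(1/3) ^ n * p (x n) / 2 \<le> \<bar>l (x n)\<bar>" by linarith
    moreover have "(1/3) ^ n * 4 ^ n \<le> (1/3) ^ n * p (x n)"
      using x(2)[of n] by (intro mult_left_mono) auto
    moreover have "(1/3) ^ n * 4 ^ n = (4/3 :: real) ^ n"
      by (simp add: power_mult_distrib[symmetric])
    ultimately show ?thesis using M[OF x(1), of n] by linarith
  qed
  obtain n where "2 * M < (4/3) ^ n"
    using real_arch_pow[of "4/3" "2 * M"] by auto
  then show False using big[of n] by linarith
qed

definition weakly_bounded :: "'e::real_vector topology \<Rightarrow> 'e set \<Rightarrow> bool" where
  "weakly_bounded T A \<longleftrightarrow> A \<subseteq> topspace T \<and> (\<forall>l\<in>continuous_dual T. \<exists>M. \<forall>a\<in>A. \<bar>l a\<bar> \<le> M)"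

lemma weakly_bounded_absorbed:
  assumes T: "locally_convex_space T" and A: "weakly_bounded T A" and U: "openin T U" "0 \<in> U"
  obtains \<delta> where "\<delta> > 0" "\<And>s a. a \<in> A \<Longrightarrow> \<bar>s\<bar> < \<delta> \<Longrightarrow> s *\<^sub>R a \<in> U"
proof -
  obtain p W where p: "seminorm_on (topspace T) p" "\<And>x. x \<in> topspace T \<Longrightarrow> p x < 1 \<Longrightarrow> x \<in> U"
    and W: "openin T W" "0 \<in> W" "\<And>x. x \<in> W \<Longrightarrow> p x \<le> 1"
    using lcs_gauge[OF T U] by blast
  have "\<exists>M. \<forall>a\<in>A. p a \<le> M"
    using A unfolding weakly_bounded_def
    by (intro weakly_bounded_imp_seminorm_bounded[OF T _ _ p(1) W]) auto
  then obtain M where M: "\<And>a. a \<in> A \<Longrightarrow> p a \<le> M" by blast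
  show ?thesis
  proof (rule that[of "1 / (\<bar>M\<bar> + 1)"])
    fix s a assume a: "a \<in> A" and s: "\<bar>s\<bar> < 1 / (\<bar>M\<bar> + 1)"
    have aE: "a \<in> topspace T" using a A by (auto simp: weakly_bounded_def)
    have "p (s *\<^sub>R a) = \<bar>s\<bar> * p a" using p(1) aE by (auto simp: seminorm_on_def)
    also have "\<dots> \<le> \<bar>s\<bar> * (\<bar>M\<bar> + 1)" using M[OF a] by (intro mult_left_mono) auto
    also have "\<dots> < 1" using s by (simp add: field_simps)
    finally show "s *\<^sub>R a \<in> U"
      using p(2) subspace_scale[OF lcs_subspace[OF T] aE] by blast
  qed (simp add: add_nonneg_pos)
qed

theorem weakly_bounded_imp_bounded:
  assumes T: "locally_convex_space T" and A: "weakly_bounded T A"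
  shows "bounded_in T A"
  unfolding bounded_in_def
proof (intro conjI allI impI)
  show "A \<subseteq> topspace T" using A by (simp add: weakly_bounded_def)
  fix U assume U: "openin T U \<and> 0 \<in> U"
  obtain \<delta> where \<delta>: "\<delta> > 0" "\<And>s a. a \<in> A \<Longrightarrow> \<bar>s\<bar> < \<delta> \<Longrightarrow> s *\<^sub>R a \<in> U"
    using weakly_bounded_absorbed[OF T A] U by blast
  have "A \<subseteq> (\<lambda>x. (2 / \<delta>) *\<^sub>R x) ` U"
  proof
    fix a assume "a \<in> A"
    then have "(\<delta> / 2) *\<^sub>R a \<in> U" using \<delta> by simp
    then show "a \<in> (\<lambda>x. (2 / \<delta>) *\<^sub>R x) ` U"
      by (rule rev_image_eqI) (use \<delta> in simp)
  qed
  then show "\<exists>r>0. A \<subseteq> (\<lambda>x. r *\<^sub>R x) ` U"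
    using \<delta>(1) by (intro exI[of _ "2 / \<delta>"]) auto
qed

section \<open>Smooth curves in convenient vector spaces\<close>

definition scalarwise_smooth :: "'e::real_vector topology \<Rightarrow> (real \<Rightarrow> 'e) \<Rightarrow> bool" where
  "scalarwise_smooth T c \<longleftrightarrow> range c \<subseteq> topspace T \<and>
     (\<forall>l\<in>continuous_dual T. derivs_on UNIV (\<lambda>k. (deriv ^^ k) (l \<circ> c)))"

lemma convenientD:
  assumes "convenient T"
  shows convenient_lcs: "locally_convex_space T"
    and convenient_Hausdorff: "Hausdorff_space T"
    and convenient_complete: "Mackey_complete T"
    and convenient_subspace: "subspace (topspace T)"
  using assms lcs_subspace by (auto simp: convenient_def)

lemma derivative_bounded_near:
  assumes d: "derivs_on UNIV d"
  obtains M where "M > 0" "\<And>s. \<bar>s - c\<bar> \<le> R \<Longrightarrow> \<bar>d k s\<bar> \<le> M"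
proof -
  have "continuous_on (cball c R) (d k)"
    using derivs_on_continuous[OF d] continuous_on_subset by blast
  then have "bounded (d k ` cball c R)"
    using compact_continuous_image compact_imp_bounded compact_cball by blast
  then obtain M where "M > 0" "\<forall>x\<in>d k ` cball c R. norm x \<le> M"
    using bounded_pos by blast
  then show ?thesis
    using that[of M] by (auto simp: dist_real_def abs_minus_commute)
qed

lemma abs_quotient_le: "\<bar>a\<bar> \<le> M * \<bar>h\<bar> \<Longrightarrow> M > 0 \<Longrightarrow> \<bar>a / h\<bar> \<le> (M::real)"
  by (cases "h = 0") (simp_all add: pos_divide_le_eq)

lemma quotient_minus_derivative:
  assumes d: "derivs_on UNIV d" and M: "\<And>s. \<bar>s - c\<bar> \<le> R \<Longrightarrow> \<bar>d 2 s\<bar> \<le> M"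
    and t: "\<bar>t - c\<bar> \<le> R" "\<bar>t + h - c\<bar> \<le> R" and h: "h \<noteq> 0"
  shows "\<bar>(d 0 (t + h) - d 0 t) / h - d 1 t\<bar> \<le> M * \<bar>h\<bar>"
proof -
  have D: "(d k has_real_derivative d (Suc k) s) (at s within A)" for k s A
    using derivs_onD[OF d, of s k] has_field_derivative_at_within by blast
  let ?S = "cball c R"
  have S: "t \<in> ?S" "t + h \<in> ?S"
    using t by (auto simp: dist_real_def abs_minus_commute)
  have d1: "norm (d 1 x - d 1 y) \<le> M * norm (x - y)" if "x \<in> ?S" "y \<in> ?S" for x y
  proof (rule field_differentiable_bound[of ?S "d 1" "d 2"])
    show "(d 1 has_field_derivative d 2 z) (at z within ?S)" for z
      using D[of 1 z] by (simp add: numeral_2_eq_2)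
    show "norm (d 2 z) \<le> M" if "z \<in> ?S" for z
      using that M by (auto simp: dist_real_def abs_minus_commute)
  qed (use that in auto)
  let ?J = "closed_segment t (t + h)"
  let ?f = "\<lambda>s. d 0 s - s * d 1 t"
  have J: "?J \<subseteq> ?S"
    using S by (intro closed_segment_subset) auto
  have "norm (?f (t + h) - ?f t) \<le> (M * \<bar>h\<bar>) * norm ((t + h) - t)"
  proof (rule field_differentiable_bound[of ?J])
    show "(?f has_field_derivative (d 1 z - d 1 t)) (at z within ?J)" for z
      using D[of 0 z] by (auto intro!: derivative_eq_intros)
    show "norm (d 1 z - d 1 t) \<le> M * \<bar>h\<bar>" if z: "z \<in> ?J" for z
    proof -
      have "norm (d 1 z - d 1 t) \<le> M * norm (z - t)"
        using d1[of z t] z J S by blast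
      also have "\<dots> \<le> M * \<bar>h\<bar>"
        using z M[OF t(1)] by (intro mult_left_mono) (auto simp: closed_segment_eq_real_ivl split: if_splits)
      finally show ?thesis .
    qed
  qed auto
  then have "\<bar>d 0 (t + h) - d 0 t - h * d 1 t\<bar> \<le> M * \<bar>h\<bar> * \<bar>h\<bar>"
    by (simp add: algebra_simps)
  moreover have "((d 0 (t + h) - d 0 t) / h - d 1 t) * h = d 0 (t + h) - d 0 t - h * d 1 t"
    using h by (simp add: field_simps)
  then have "\<bar>(d 0 (t + h) - d 0 t) / h - d 1 t\<bar> * \<bar>h\<bar> = \<bar>d 0 (t + h) - d 0 t - h * d 1 t\<bar>"
    by (metis abs_mult)
  ultimately show ?thesis
    using h by (metis mult_le_cancel_right_pos zero_less_abs_iff)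
qed

text \<open>The derivative of the difference quotient \<open>q\<close> at \<open>h\<close> is \<open>(d 1 (t + h) - q h) / h\<close>.  Its bound is the preceding
  estimate at the base point \<open>t + h\<close> with the step \<open>- h\<close>.\<close>

lemma quotient_Lipschitz:
  assumes d: "derivs_on UNIV d" and M: "\<And>s. \<bar>s - t\<bar> \<le> 1 \<Longrightarrow> \<bar>d 2 s\<bar> \<le> M"
    and h: "h \<in> {0<..1}" "h' \<in> {0<..1}"
  shows "\<bar>(d 0 (t + h) - d 0 t) / h - (d 0 (t + h') - d 0 t) / h'\<bar> \<le> M * \<bar>h - h'\<bar>"
proof -
  let ?q = "\<lambda>h. (d 0 (t + h) - d 0 t) / h"
  have D: "(d 0 has_real_derivative d 1 s) (at s)" for s
    using derivs_onD[OF d, of s 0] by simp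
  have "norm (?q h - ?q h') \<le> M * norm (h - h')"
  proof (rule field_differentiable_bound[of "{0<..1}"])
    fix z :: real assume z: "z \<in> {0<..1}"
    have "((\<lambda>h. d 0 (t + h)) has_real_derivative d 1 (t + z) * 1) (at z)"
      by (rule DERIV_chain2[OF D]) (auto intro!: derivative_eq_intros)
    from DERIV_diff[OF this DERIV_const[of "d 0 t"]]
    have "((\<lambda>h. d 0 (t + h) - d 0 t) has_real_derivative d 1 (t + z) * 1 - 0) (at z)" .
    from DERIV_divide[OF this DERIV_ident]
    have "(?q has_field_derivative ((d 1 (t + z) * 1 - 0) * z - (d 0 (t + z) - d 0 t) * 1) / (z * z)) (at z)"
      using z by simp
    from has_field_derivative_at_within[OF this, of "{0<..1}"]
    show "(?q has_field_derivative (d 1 (t + z) * z - (d 0 (t + z) - d 0 t)) / (z * z)) (at z within {0<..1})"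
      by simp
    have "\<bar>(d 0 (t + z + - z) - d 0 (t + z)) / (- z) - d 1 (t + z)\<bar> \<le> M * \<bar>- z\<bar>"
      using z by (intro quotient_minus_derivative[OF d M]) auto
    then have "\<bar>?q z - d 1 (t + z)\<bar> \<le> M * z"
      using z by (simp add: minus_divide_left[symmetric] diff_divide_distrib)
    moreover have "(d 1 (t + z) * z - (d 0 (t + z) - d 0 t)) / (z * z) = (d 1 (t + z) - ?q z) / z"
      using z by (simp add: field_simps)
    ultimately show "norm ((d 1 (t + z) * z - (d 0 (t + z) - d 0 t)) / (z * z)) \<le> M"
      using z by (simp add: abs_minus_commute field_simps)
  qed (use h in auto)
  then show ?thesis by simp
qed

lemma limitin_of_linear_rate:
  assumes T: "locally_convex_space T" and B: "weakly_bounded T B" and x: "x \<in> topspace T"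
    and f: "\<And>h. h \<noteq> 0 \<Longrightarrow> \<bar>h\<bar> \<le> 1 \<Longrightarrow> \<exists>b\<in>B. f h = h *\<^sub>R b + x"
  shows "limitin T f x (at (0::real))"
  unfolding limitin_def
proof (intro conjI allI impI)
  fix U assume U: "openin T U \<and> x \<in> U"
  let ?U = "{y \<in> topspace T. 1 *\<^sub>R y + x \<in> U}"
  have "openin T ?U"
    using U by (intro lcs_open_preimage_affine[OF T x]) simp
  moreover have "0 \<in> ?U"
    using U subspace_0[OF lcs_subspace[OF T]] by simp
  ultimately obtain \<delta> where \<delta>: "\<delta> > 0" "\<And>s a. a \<in> B \<Longrightarrow> \<bar>s\<bar> < \<delta> \<Longrightarrow> s *\<^sub>R a \<in> ?U"
    by (rule weakly_bounded_absorbed[OF T B]) (rule that)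
  have "f h \<in> U" if h: "h \<noteq> 0" "\<bar>h\<bar> < min \<delta> 1" for h
  proof -
    obtain b where b: "b \<in> B" "f h = h *\<^sub>R b + x" using f[of h] h by auto
    then show ?thesis using \<delta>(2)[OF b(1), of h] h by auto
  qed
  then show "\<forall>\<^sub>F h in at 0. f h \<in> U"
    unfolding eventually_at using \<delta>(1) by (intro exI[of _ "min \<delta> 1"]) auto
qed (rule x)

text \<open>The difference quotients of a scalarwise smooth curve, for steps \<open>1 / (n + 1)\<close>, form a Mackey--Cauchy sequence:
  their second-order quotients are weakly bounded by the scalar estimate, hence bounded.\<close>

lemma ex_vector_derivative:
  assumes T: "convenient T" and c: "scalarwise_smooth T c"
  shows "\<exists>x\<in>topspace T. \<forall>l\<in>continuous_dual T. l x = deriv (l \<circ> c) t"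
proof -
  let ?E = "topspace T"
  have lcs: "locally_convex_space T" and E: "subspace ?E"
    using T by (auto simp: convenient_lcs convenient_subspace)
  have cE: "c s \<in> ?E" for s using c by (auto simp: scalarwise_smooth_def)
  define q where "q = (\<lambda>h. (1 / h) *\<^sub>R (c (t + h) - c t))"
  have qE: "q h \<in> ?E" for h
    unfolding q_def using cE E by (intro subspace_scale subspace_diff)
  have lq: "l (q h) = ((l \<circ> c) (t + h) - (l \<circ> c) t) / h" if "l \<in> continuous_dual T" for l h
    unfolding q_def using that cE E dual_diff[OF lcs that] by (simp add: dual_scale subspace_diff)
  have D: "derivs_on UNIV (\<lambda>k. (deriv ^^ k) (l \<circ> c))" if "l \<in> continuous_dual T" for l
    using c that by (simp add: scalarwise_smooth_def)
  define B where "B = {(1 / (h - h')) *\<^sub>R (q h - q h') | h h'. h \<in> {0<..1} \<and> h' \<in> {0<..1}}"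
  have "weakly_bounded T B"
    unfolding weakly_bounded_def
  proof (intro conjI ballI)
    show "B \<subseteq> ?E"
      unfolding B_def using qE E by (auto intro!: subspace_scale subspace_diff)
    fix l assume l: "l \<in> continuous_dual T"
    obtain M where M: "M > 0" "\<And>s. \<bar>s - t\<bar> \<le> 1 \<Longrightarrow> \<bar>(deriv ^^ 2) (l \<circ> c) s\<bar> \<le> M"
      using derivative_bounded_near[OF D[OF l], of t 1 2] by blast
    have "\<bar>l ((1 / (h - h')) *\<^sub>R (q h - q h'))\<bar> \<le> M" if h: "h \<in> {0<..1}" "h' \<in> {0<..1}" for h h'
    proof -
      have "\<bar>l (q h) - l (q h')\<bar> \<le> M * \<bar>h - h'\<bar>"
        unfolding lq[OF l] using quotient_Lipschitz[OF D[OF l] M(2) h] by simp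
      moreover have "l ((1 / (h - h')) *\<^sub>R (q h - q h')) = (l (q h) - l (q h')) / (h - h')"
        using dual_scale[OF l subspace_diff[OF E qE qE]] dual_diff[OF lcs l qE qE] by simp
      ultimately show ?thesis
        using M(1) abs_quotient_le by metis
    qed
    then show "\<exists>M. \<forall>a\<in>B. \<bar>l a\<bar> \<le> M" unfolding B_def by blast
  qed
  then have B: "bounded_in T B" by (rule weakly_bounded_imp_bounded[OF lcs])
  let ?h = "\<lambda>n. inverse (real (Suc n))"
  have h: "?h n \<in> {0<..1}" for n by (auto simp: inverse_le_1_iff)
  have "Mackey_Cauchy T (\<lambda>n. q (?h n))"
    unfolding Mackey_Cauchy_def
  proof (intro conjI exI[of _ B] exI[of _ "\<lambda>m n. ?h m - ?h n"] allI)
    show "range (\<lambda>n. q (?h n)) \<subseteq> ?E" using qE by auto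
    have "((\<lambda>x. ?h (fst x) - ?h (snd x)) \<longlongrightarrow> 0 - 0) (sequentially \<times>\<^sub>F sequentially)"
      by (intro tendsto_diff filterlim_compose[OF LIMSEQ_inverse_real_of_nat] filterlim_fst filterlim_snd)
    then show "((\<lambda>(m, n). ?h m - ?h n) \<longlongrightarrow> 0) (sequentially \<times>\<^sub>F sequentially)"
      by (simp add: case_prod_unfold)
    fix m n
    show "q (?h m) - q (?h n) \<in> (\<lambda>b. (?h m - ?h n) *\<^sub>R b) ` B"
    proof (rule image_eqI)
      show "(1 / (?h m - ?h n)) *\<^sub>R (q (?h m) - q (?h n)) \<in> B"
        unfolding B_def using h by blast
      show "q (?h m) - q (?h n) = (?h m - ?h n) *\<^sub>R ((1 / (?h m - ?h n)) *\<^sub>R (q (?h m) - q (?h n)))"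
        by (cases "m = n") simp_all
    qed
  qed (rule B)
  then obtain x where x: "limitin T (\<lambda>n. q (?h n)) x sequentially"
    using convenient_complete[OF T] unfolding Mackey_complete_def by blast
  have "l x = deriv (l \<circ> c) t" if l: "l \<in> continuous_dual T" for l
  proof (rule LIMSEQ_unique)
    show "(\<lambda>n. l (q (?h n))) \<longlonglongrightarrow> l x"
      using continuous_map_limit[OF dual_continuous[OF l] x] by (simp add: o_def)
    have "((l \<circ> c) has_real_derivative deriv (l \<circ> c) t) (at t)"
      using derivs_onD[OF D[OF l], of t 0] by simp
    then have lim: "((\<lambda>h. l (q h)) \<longlongrightarrow> deriv (l \<circ> c) t) (at 0)"
      unfolding lq[OF l] DERIV_def .
    have "filterlim ?h (at 0) sequentially"
    proof (rule filterlim_atI[OF LIMSEQ_inverse_real_of_nat], intro always_eventually allI)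
      show "?h n \<noteq> 0" for n
        by (rule nonzero_imp_inverse_nonzero) (rule of_nat_neq_0)
    qed
    from filterlim_compose[OF lim this]
    show "(\<lambda>n. l (q (?h n))) \<longlonglongrightarrow> deriv (l \<circ> c) t" .
  qed
  then show ?thesis
    using limitin_topspace[OF x] by (intro bexI ballI)
qed

definition vector_derivative_in :: "'e::real_vector topology \<Rightarrow> (real \<Rightarrow> 'e) \<Rightarrow> real \<Rightarrow> 'e" where
  "vector_derivative_in T c t =
     (SOME x. x \<in> topspace T \<and> (\<forall>l\<in>continuous_dual T. l x = deriv (l \<circ> c) t))"

lemma vector_derivative_in_props:
  assumes T: "convenient T" and c: "scalarwise_smooth T c"
  shows "vector_derivative_in T c t \<in> topspace T"
    and "l \<in> continuous_dual T \<Longrightarrow> l (vector_derivative_in T c t) = deriv (l \<circ> c) t"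
  using someI_ex[OF ex_vector_derivative[OF assms, of t, unfolded Bex_def]]
  unfolding vector_derivative_in_def by blast+

lemma scalarwise_smooth_derivative:
  assumes T: "convenient T" and c: "scalarwise_smooth T c"
  shows "scalarwise_smooth T (vector_derivative_in T c)"
  unfolding scalarwise_smooth_def
proof (intro conjI ballI)
  show "range (vector_derivative_in T c) \<subseteq> topspace T"
    using vector_derivative_in_props(1)[OF assms] by auto
  fix l assume l: "l \<in> continuous_dual T"
  have eq: "l \<circ> vector_derivative_in T c = deriv (l \<circ> c)"
    using vector_derivative_in_props(2)[OF assms l] by (auto simp: fun_eq_iff)
  have shift: "(deriv ^^ k) (deriv (l \<circ> c)) = (deriv ^^ Suc k) (l \<circ> c)" for k
    by (simp add: funpow_swap1)
  show "derivs_on UNIV (\<lambda>k. (deriv ^^ k) (l \<circ> vector_derivative_in T c))"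
    using c l unfolding eq shift derivs_on_def scalarwise_smooth_def by blast
qed

lemma limitin_vector_derivative:
  assumes T: "convenient T" and c: "scalarwise_smooth T c"
  shows "limitin T (\<lambda>h. (1 / h) *\<^sub>R (c (t + h) - c t)) (vector_derivative_in T c t) (at 0)"
proof -
  let ?E = "topspace T" and ?x = "vector_derivative_in T c t"
  let ?q = "\<lambda>h. (1 / h) *\<^sub>R (c (t + h) - c t)"
  have lcs: "locally_convex_space T" and E: "subspace ?E"
    using T by (auto simp: convenient_lcs convenient_subspace)
  have cE: "c s \<in> ?E" for s using c by (auto simp: scalarwise_smooth_def)
  have x: "?x \<in> ?E" by (rule vector_derivative_in_props(1)[OF assms])
  have qE: "?q h \<in> ?E" for h using cE E by (intro subspace_scale subspace_diff)
  define B where "B = {(1 / h) *\<^sub>R (?q h - ?x) | h. h \<noteq> 0 \<and> \<bar>h\<bar> \<le> 1}"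
  have "weakly_bounded T B"
    unfolding weakly_bounded_def
  proof (intro conjI ballI)
    show "B \<subseteq> ?E"
      unfolding B_def using subspace_scale[OF E subspace_diff[OF E qE x]] by blast
    fix l assume l: "l \<in> continuous_dual T"
    have D: "derivs_on UNIV (\<lambda>k. (deriv ^^ k) (l \<circ> c))"
      using c l by (simp add: scalarwise_smooth_def)
    obtain M where M: "M > 0" "\<And>s. \<bar>s - t\<bar> \<le> 1 \<Longrightarrow> \<bar>(deriv ^^ 2) (l \<circ> c) s\<bar> \<le> M"
      using derivative_bounded_near[OF D, of t 1 2] by blast
    have "\<bar>l ((1 / h) *\<^sub>R (?q h - ?x))\<bar> \<le> M" if h: "h \<noteq> 0" "\<bar>h\<bar> \<le> 1" for h
    proof -
      have "l (?q h) = ((l \<circ> c) (t + h) - (l \<circ> c) t) / h"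
        using dual_scale[OF l subspace_diff[OF E cE cE]] dual_diff[OF lcs l cE cE] by simp
      moreover have "l ?x = deriv (l \<circ> c) t" by (rule vector_derivative_in_props(2)[OF assms l])
      moreover have "\<bar>((deriv ^^ 0) (l \<circ> c) (t + h) - (deriv ^^ 0) (l \<circ> c) t) / h - (deriv ^^ 1) (l \<circ> c) t\<bar> \<le> M * \<bar>h\<bar>"
        by (rule quotient_minus_derivative[OF D, where c = t and R = 1]) (use M(2) h in auto)
      then have "\<bar>((l \<circ> c) (t + h) - (l \<circ> c) t) / h - deriv (l \<circ> c) t\<bar> \<le> M * \<bar>h\<bar>"
        by (simp only: funpow_0 One_nat_def funpow_Suc_right o_apply)
      ultimately have "\<bar>l (?q h) - l ?x\<bar> \<le> M * \<bar>h\<bar>" by simp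
      moreover have "l ((1 / h) *\<^sub>R (?q h - ?x)) = (1 / h) * (l (?q h) - l ?x)"
        using dual_scale[OF l subspace_diff[OF E qE x]] dual_diff[OF lcs l qE x] by metis
      then have "l ((1 / h) *\<^sub>R (?q h - ?x)) = (l (?q h) - l ?x) / h"
        by simp
      ultimately show ?thesis
        using M(1) abs_quotient_le by metis
    qed
    then show "\<exists>M. \<forall>a\<in>B. \<bar>l a\<bar> \<le> M" unfolding B_def by blast
  qed
  then show ?thesis
  proof (rule limitin_of_linear_rate[OF lcs _ x])
    fix h :: real assume h: "h \<noteq> 0" "\<bar>h\<bar> \<le> 1"
    have "?q h = h *\<^sub>R ((1 / h) *\<^sub>R (?q h - ?x)) + ?x" using h by simp
    then show "\<exists>b\<in>B. ?q h = h *\<^sub>R b + ?x" unfolding B_def using h by blast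
  qed
qed

lemma smooth_curve_scalar_derivs:
  assumes "d 0 = c" and d: "\<And>k t. d k t \<in> topspace T"
    "\<And>k t. limitin T (\<lambda>h. (1 / h) *\<^sub>R (d k (t + h) - d k t)) (d (Suc k) t) (at (0::real))"
    and T: "locally_convex_space T" and l: "l \<in> continuous_dual T"
  shows "derivs_on UNIV (\<lambda>k t. l (d k t))"
  unfolding derivs_on_def DERIV_def
proof (intro allI ballI)
  fix k t
  have "l ((1 / h) *\<^sub>R (d k (t + h) - d k t)) = (l (d k (t + h)) - l (d k t)) / h" for h
    using dual_scale[OF l subspace_diff[OF lcs_subspace[OF T] d(1) d(1)]] dual_diff[OF T l d(1) d(1)] by simp
  then show "((\<lambda>h. (l (d k (t + h)) - l (d k t)) / h) \<longlongrightarrow> l (d (Suc k) t)) (at 0)"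
    using continuous_map_limit[OF dual_continuous[OF l] d(2)[of k t]] by (simp add: o_def)
qed

text \<open>The vector derivative of a scalarwise smooth curve is again scalarwise smooth, so all higher derivatives exist.\<close>

theorem smooth_curve_iff_scalarwise:
  assumes T: "convenient T"
  shows "smooth_curve T c \<longleftrightarrow> scalarwise_smooth T c"
proof
  assume "smooth_curve T c"
  then obtain d where d: "d 0 = c" "\<And>k t. d k t \<in> topspace T"
    "\<And>k t. limitin T (\<lambda>h. (1 / h) *\<^sub>R (d k (t + h) - d k t)) (d (Suc k) t) (at (0::real))"
    unfolding smooth_curve_def by blast
  show "scalarwise_smooth T c"
    unfolding scalarwise_smooth_def
  proof (intro conjI ballI)
    show "range c \<subseteq> topspace T" using d by auto
    fix l assume l: "l \<in> continuous_dual T"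
    have D: "derivs_on UNIV (\<lambda>k t. l (d k t))"
      by (rule smooth_curve_scalar_derivs[OF d convenient_lcs[OF T] l])
    have "(\<lambda>t. l (d k t)) = (deriv ^^ k) (l \<circ> c)" for k
      using derivs_on_eq_deriv[OF D, of "l \<circ> c"] d(1) by (auto simp: fun_eq_iff)
    then show "derivs_on UNIV (\<lambda>k. (deriv ^^ k) (l \<circ> c))" using D by simp
  qed
next
  assume c: "scalarwise_smooth T c"
  let ?d = "\<lambda>k. (vector_derivative_in T ^^ k) c"
  have d: "scalarwise_smooth T (?d k)" for k
    by (induction k) (auto simp: c scalarwise_smooth_derivative[OF T])
  show "smooth_curve T c"
    unfolding smooth_curve_def
  proof (intro exI[of _ ?d] conjI allI)
    show "?d k t \<in> topspace T" for k t using d[of k] by (auto simp: scalarwise_smooth_def)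
    show "limitin T (\<lambda>h. (1 / h) *\<^sub>R (?d k (t + h) - ?d k t)) (?d (Suc k) t) (at 0)" for k t
      using limitin_vector_derivative[OF T d[of k], of t] by simp
  qed simp
qed

lemma scalarwise_smooth_derivatives:
  assumes T: "convenient T" and c: "scalarwise_smooth T c"
  obtains d where "d 0 = c" "\<And>k t. d k t \<in> topspace T"
    "\<And>l k t. l \<in> continuous_dual T \<Longrightarrow> l (d k t) = (deriv ^^ k) (l \<circ> c) t"
proof -
  let ?d = "\<lambda>k. (vector_derivative_in T ^^ k) c"
  have d: "scalarwise_smooth T (?d k)" for k
    by (induction k) (auto simp: c scalarwise_smooth_derivative[OF T])
  have "l (?d k t) = (deriv ^^ k) (l \<circ> c) t" if l: "l \<in> continuous_dual T" for l k t
  proof (induction k arbitrary: t)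
    case (Suc k)
    have "l (?d (Suc k) t) = deriv (l \<circ> ?d k) t"
      using vector_derivative_in_props(2)[OF T d l] by simp
    moreover have "l \<circ> ?d k = (deriv ^^ k) (l \<circ> c)" by (rule ext, subst o_apply, rule Suc.IH)
    moreover have "(deriv ^^ Suc k) g t = deriv ((deriv ^^ k) g) t" for g :: "real \<Rightarrow> real"
      by simp
    ultimately show ?case by (simp only:)
  qed simp
  moreover have "?d k t \<in> topspace T" for k t using d[of k] by (auto simp: scalarwise_smooth_def)
  ultimately show ?thesis by (intro that[of ?d]) auto
qed

lemma weakly_bounded_quotients:
  assumes T: "convenient T" and c: "scalarwise_smooth T c"
  shows "weakly_bounded T {(1 / (t - s)) *\<^sub>R (c t - c s) | t. \<bar>t - s\<bar> \<le> 1}"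
  unfolding weakly_bounded_def
proof (intro conjI ballI)
  have lcs: "locally_convex_space T" and E: "subspace (topspace T)"
    using T by (auto simp: convenient_lcs convenient_subspace)
  have cE: "c s \<in> topspace T" for s using c by (auto simp: scalarwise_smooth_def)
  show "{(1 / (t - s)) *\<^sub>R (c t - c s) | t. \<bar>t - s\<bar> \<le> 1} \<subseteq> topspace T"
    using cE E by (auto intro!: subspace_scale subspace_diff)
  fix l assume l: "l \<in> continuous_dual T"
  have D: "derivs_on UNIV (\<lambda>k. (deriv ^^ k) (l \<circ> c))"
    using c l by (simp add: scalarwise_smooth_def)
  obtain M where M: "M > 0" "\<And>u. \<bar>u - s\<bar> \<le> 1 \<Longrightarrow> \<bar>(deriv ^^ 1) (l \<circ> c) u\<bar> \<le> M"
    using derivative_bounded_near[OF D, of s 1 1] by blast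
  have "\<bar>l ((1 / (t - s)) *\<^sub>R (c t - c s))\<bar> \<le> M" if t: "\<bar>t - s\<bar> \<le> 1" for t
  proof -
    have "norm ((l \<circ> c) t - (l \<circ> c) s) \<le> M * norm (t - s)"
    proof (rule field_differentiable_bound[of "cball s 1"])
      show "((l \<circ> c) has_field_derivative (deriv ^^ 1) (l \<circ> c) z) (at z within cball s 1)" for z
        using derivs_onD[OF D, of z 0] has_field_derivative_at_within by auto
      show "norm ((deriv ^^ 1) (l \<circ> c) z) \<le> M" if "z \<in> cball s 1" for z
        using that M(2)[of z] by (auto simp: dist_real_def abs_minus_commute)
    qed (use t in \<open>auto simp: dist_real_def abs_minus_commute\<close>)
    moreover have "l ((1 / (t - s)) *\<^sub>R (c t - c s)) = (l (c t) - l (c s)) / (t - s)"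
      using dual_scale[OF l subspace_diff[OF E cE cE]] dual_diff[OF lcs l cE cE] by simp
    ultimately show ?thesis
      using M(1) abs_quotient_le[of "l (c t) - l (c s)" M "t - s"] by simp
  qed
  then show "\<exists>M. \<forall>a\<in>{(1 / (t - s)) *\<^sub>R (c t - c s) | t. \<bar>t - s\<bar> \<le> 1}. \<bar>l a\<bar> \<le> M" by blast
qed

lemma openin_cinf_topology:
  "openin (cinf_topology T) W \<longleftrightarrow> W \<subseteq> topspace T \<and> (\<forall>c. smooth_curve T c \<longrightarrow> open {t. c t \<in> W})"
  unfolding cinf_topology_def openin_final_topology by fastforce

section \<open>Curves through fast convergent sequences\<close>

text \<open>The bumps \<open>\<phi> (4 * (2 ^ n * t - 1))\<close>, supported near \<open>2 ^ (- n)\<close>, with coefficients decaying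
  like \<open>2 ^ (- n\<^sup>2)\<close>: the factor \<open>2 ^ (n * k)\<close> produced by \<open>k\<close> differentiations is harmless.\<close>

lemma bump_series_derivs:
  assumes \<phi>: "derivs_on UNIV \<phi>" and C: "\<And>k t. \<bar>\<phi> k t\<bar> \<le> C k"
    and a: "\<And>n. \<bar>a n\<bar> \<le> M * (1/2) ^ (n * n)"
  shows "derivs_on UNIV (\<lambda>k t. \<Sum>n. (4 * 2 ^ n) ^ k * \<phi> k (4 * (2 ^ n * t - 1)) * a n)"
    and "summable (\<lambda>n. (4 * 2 ^ n) ^ k * \<phi> k (4 * (2 ^ n * t - 1)) * a n)"
proof -
  let ?f = "\<lambda>k n t. (4 * 2 ^ n) ^ k * \<phi> k (4 * (2 ^ n * t - 1)) * a n"
  let ?b = "\<lambda>k n. (4 * 2 ^ n) ^ k * (C k * (M * (1/2) ^ (n * n)))"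
  have C0: "0 \<le> C k" for k using C[of k 0] by linarith
  have M0: "0 \<le> M" using a[of 0] by simp
  have bound: "norm (?f k n t) \<le> ?b k n" for k n t
  proof -
    have "norm (?f k n t) = (4 * 2 ^ n) ^ k * (\<bar>\<phi> k (4 * (2 ^ n * t - 1))\<bar> * \<bar>a n\<bar>)"
      by (simp add: abs_mult)
    also have "\<dots> \<le> ?b k n"
      using C a C0 by (intro mult_left_mono mult_mono) auto
    finally show ?thesis .
  qed
  have summ_b: "summable (?b k)" for k
  proof (rule summable_comparison_test')
    show "summable (\<lambda>n. (4 ^ k * C k * M) * (1/2) ^ n)"
      by (intro summable_mult summable_geometric) simp
    fix n assume n: "n \<ge> k + 1"
    have "(4 * 2 ^ n :: real) ^ k = 4 ^ k * 2 ^ (n * k)"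
      by (simp add: power_mult_distrib power_mult)
    moreover have "(2::real) ^ (n * k) * (1/2) ^ (n * n) \<le> (1/2) ^ n"
    proof -
      have "n * k + n \<le> n * n" using mult_le_mono2[OF n, of n] by (simp add: algebra_simps)
      then have "(2::real) ^ (n * k + n) \<le> 2 ^ (n * n)" by (intro power_increasing) auto
      then show ?thesis by (simp add: power_add power_one_over field_simps)
    qed
    ultimately show "norm (?b k n) \<le> (4 ^ k * C k * M) * (1/2) ^ n"
      using C0[of k] M0 mult_left_mono[of "(2::real) ^ (n * k) * (1/2) ^ (n * n)" "(1/2) ^ n" "4 ^ k * C k * M"]
      by (simp add: algebra_simps)
  qed
  show summ: "summable (\<lambda>n. ?f k n t)" for k t
    by (rule summable_comparison_test'[OF summ_b]) (rule bound)
  show "derivs_on UNIV (\<lambda>k t. \<Sum>n. ?f k n t)"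
    unfolding derivs_on_def
  proof (intro allI ballI)
    fix k t
    have "((\<lambda>x. \<Sum>n. ?f k n x) has_field_derivative (\<Sum>n. ?f (Suc k) n t)) (at t)"
    proof (rule has_field_derivative_series'(2)[of UNIV])
      fix n x
      have "(\<phi> k has_real_derivative \<phi> (Suc k) (4 * (2 ^ n * x - 1))) (at (4 * (2 ^ n * x - 1)))"
        using derivs_onD[OF \<phi>] by simp
      then show "(?f k n has_field_derivative ?f (Suc k) n x) (at x within UNIV)"
        by (auto intro!: derivative_eq_intros DERIV_chain2[where f = "\<phi> k"])
    next
      show "uniformly_convergent_on UNIV (\<lambda>n x. \<Sum>i<n. ?f (Suc k) i x)"
        by (rule Weierstrass_m_test'[OF _ summ_b]) (rule bound)
    qed (use summ in auto)
    then show "((\<lambda>x. \<Sum>n. ?f k n x) has_real_derivative (\<Sum>n. ?f (Suc k) n t)) (at t)" .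
  qed
qed

text \<open>Otherwise a smooth curve would run through points outside of \<open>W\<close> that converge too fast to \<open>x\<close>.  The bumps
  from which this curve is built come from any non-quasianalytic class.\<close>

theorem cinf_open_absorbs_bounded:
  assumes T: "convenient T" and L: "\<forall>k. L k > 0" "log_convex L" "\<not> quasianalytic L"
    and B: "weakly_bounded T B" and W: "openin (cinf_topology T) W" and x: "x \<in> W"
  obtains \<delta> where "\<delta> > 0" "\<And>b s. b \<in> B \<Longrightarrow> \<bar>s\<bar> < \<delta> \<Longrightarrow> x + s *\<^sub>R b \<in> W"
proof (rule ccontr)
  assume contra: "\<not> thesis"
  note obt = that
  have "\<exists>b\<in>B. \<exists>s. \<bar>s\<bar> < e \<and> x + s *\<^sub>R b \<notin> W" if e: "e > 0" for e
    using obt[OF e] contra by blast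
  then have "\<forall>n. \<exists>b\<in>B. \<exists>s. \<bar>s\<bar> < (1/2) ^ (n * n) \<and> x + s *\<^sub>R b \<notin> W"
    by simp
  then obtain b s where b: "\<And>n. b n \<in> B" and s: "\<And>n. \<bar>s n\<bar> < (1/2) ^ (n * n)"
    and out: "\<And>n. x + s n *\<^sub>R b n \<notin> W"
    by metis
  have lcs: "locally_convex_space T" and E: "subspace (topspace T)"
    using T by (auto simp: convenient_lcs convenient_subspace)
  have xE: "x \<in> topspace T" and bE: "b n \<in> topspace T" for n
    using W x b B by (auto simp: openin_cinf_topology weakly_bounded_def)
  obtain \<phi> where \<phi>: "CL_derivs L UNIV \<phi>" "\<And>t. \<bar>t - 0\<bar> \<le> 1 / 2 \<Longrightarrow> \<phi> 0 t = 1"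
    "\<And>k t. \<bar>t - 0\<bar> \<ge> 1 \<Longrightarrow> \<phi> k t = 0"
    by (rule ex_CL_cutoff[OF L zero_less_one, of 0]) (rule that)
  obtain C0 \<rho> where C0: "\<And>k t. \<bar>\<phi> k t\<bar> \<le> C0 * \<rho> ^ k * fact k * L k"
    using \<phi>(1) by (rule CL_derivsE) blast
  \<comment> \<open>The intervals on which the bumps live are disjoint, so at most one term of the series is nonzero
    and its sum is an element of the space.\<close>
  define near where "near = (\<lambda>t n. \<bar>2 ^ n * t - 1\<bar> < (1 / 4 :: real))"
  have unique: "m = n" if "near t m" "near t n" for m n t
  proof -
    have False if mn: "m < n" and tm: "near t m" and tn: "near t n" for m n
    proof -
      have *: "2 ^ m * t > 3 / 4" "2 ^ n * t < 5 / 4"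
        using tm tn unfolding near_def abs_less_iff by linarith+
      have "(2::real) ^ Suc m \<le> 2 ^ n" using mn by (intro power_increasing) auto
      moreover have "t > 0"
      proof (rule ccontr)
        assume "\<not> t > 0"
        then have "2 ^ m * t \<le> 0"
          by (intro mult_nonneg_nonpos) auto
        then show False
          using *(1) by linarith
      qed
      ultimately have "2 ^ Suc m * t \<le> 2 ^ n * t" by (intro mult_right_mono) auto
      then show False using * by simp
    qed
    then show ?thesis using that by (metis nat_neq_iff)
  qed
  have far: "\<phi> k (4 * (2 ^ n * t - 1)) = 0" if "\<not> near t n" for k t n
  proof (rule \<phi>(3))
    have "\<bar>4 * y - 0\<bar> = 4 * \<bar>y\<bar>" for y :: real
      by simp
    moreover have "1 \<le> 4 * \<bar>2 ^ n * t - 1\<bar>"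
      using that by (simp add: near_def)
    ultimately show "\<bar>4 * (2 ^ n * t - 1) - 0\<bar> \<ge> 1"
      by (simp only:)
  qed
  define c where "c = (\<lambda>t. if \<exists>n. near t n then x + (\<phi> 0 (4 * (2 ^ (THE n. near t n) * t - 1)) * s (THE n. near t n)) *\<^sub>R b (THE n. near t n) else x)"
  have c_near: "c t = x + (\<phi> 0 (4 * (2 ^ n * t - 1)) * s n) *\<^sub>R b n" if "near t n" for t n
  proof -
    have "(THE n. near t n) = n" using that unique by blast
    then show ?thesis using that by (auto simp: c_def)
  qed
  have c_far: "c t = x" if "\<not> (\<exists>n. near t n)" for t
    unfolding c_def using that by (simp only: if_False)
  have "scalarwise_smooth T c"
    unfolding scalarwise_smooth_def
  proof (intro conjI ballI)
    show "range c \<subseteq> topspace T"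
      using xE bE E by (auto simp: c_def intro!: subspace_add subspace_scale)
    fix l assume l: "l \<in> continuous_dual T"
    obtain M where M: "\<And>a. a \<in> B \<Longrightarrow> \<bar>l a\<bar> \<le> M" using B l unfolding weakly_bounded_def by blast
    define a where "a = (\<lambda>n. s n * l (b n))"
    have a: "\<bar>a n\<bar> \<le> M * (1/2) ^ (n * n)" for n
    proof -
      have "\<bar>a n\<bar> \<le> (1/2) ^ (n * n) * M"
        unfolding a_def abs_mult using s[of n] M[OF b, of n] by (intro mult_mono) auto
      then show ?thesis by (simp add: mult.commute)
    qed
    let ?f = "\<lambda>k n t. (4 * 2 ^ n) ^ k * \<phi> k (4 * (2 ^ n * t - 1)) * a n"
    note series = bump_series_derivs[OF CL_derivs_derivs_on[OF \<phi>(1)] C0 a]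
    have lc: "(l \<circ> c) t = l x + (\<Sum>n. ?f 0 n t)" for t
    proof (cases "\<exists>n. near t n")
      case True
      then obtain n where n: "near t n" by blast
      have "(\<Sum>n. ?f 0 n t) = (\<Sum>n\<in>{n}. ?f 0 n t)"
      proof (rule suminf_finite)
        fix m assume "m \<notin> {n}"
        then have "\<not> near t m" using unique[OF n] by blast
        then show "?f 0 m t = 0" using far by simp
      qed simp
      moreover have "l (c t) = l x + \<phi> 0 (4 * (2 ^ n * t - 1)) * s n * l (b n)"
        unfolding c_near[OF n] using dual_add[OF l xE subspace_scale[OF E bE]] dual_scale[OF l bE] by simp
      ultimately show ?thesis by (simp add: a_def)
    next
      case False
      then have "?f 0 n t = 0" for n using far by simp
      then have "(\<Sum>n. ?f 0 n t) = 0" by (simp only: suminf_zero)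
      then show ?thesis using c_far[OF False] by simp
    qed
    define d where "d = (\<lambda>k t. (if k = 0 then l x else 0) + (\<Sum>n. ?f k n t))"
    have D: "derivs_on UNIV d"
      unfolding derivs_on_def
    proof (intro allI ballI)
      fix k t
      from DERIV_add[OF DERIV_const[of "if k = 0 then l x else 0"] derivs_onD[OF series(1) UNIV_I, of k t]]
      have "(d k has_real_derivative 0 + (\<Sum>n. ?f (Suc k) n t)) (at t)"
        unfolding d_def .
      then show "(d k has_real_derivative d (Suc k) t) (at t)"
        by (simp only: d_def nat.distinct if_False)
    qed
    have "d 0 t = (l \<circ> c) t" for t unfolding lc by (simp add: d_def)
    then have "d k = (deriv ^^ k) (l \<circ> c)" for k
      using derivs_on_eq_deriv[OF D, of "l \<circ> c"] by (auto simp: fun_eq_iff)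
    then have "d = (\<lambda>k. (deriv ^^ k) (l \<circ> c))" by (rule ext)
    with D show "derivs_on UNIV (\<lambda>k. (deriv ^^ k) (l \<circ> c))" by (simp only:)
  qed
  then have "smooth_curve T c" by (simp add: smooth_curve_iff_scalarwise[OF T])
  then have op: "open {t. c t \<in> W}" using W by (simp add: openin_cinf_topology)
  have "c 0 = x" by (rule c_far) (simp add: near_def)
  then have "0 \<in> {t. c t \<in> W}" using x by simp
  then obtain e where e: "e > 0" "ball 0 e \<subseteq> {t. c t \<in> W}" using op by (meson open_contains_ball)
  obtain n where n: "(1/2) ^ n < e" using real_arch_pow_inv[OF e(1), of "1/2"] by auto
  have "c ((1/2) ^ n) = x + s n *\<^sub>R b n"
    using c_near[of "(1/2) ^ n" n] \<phi>(2)[of 0] by (simp add: near_def power_one_over)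
  moreover have "(1/2 :: real) ^ n \<in> ball 0 e" using n by simp
  then have "c ((1/2) ^ n) \<in> W" using e(2) by blast
  ultimately show False using out[of n] by simp
qed

section \<open>Banach spaces as convenient vector spaces\<close>

abbreviation norm_topology :: "'b::real_vector set \<Rightarrow> ('b \<Rightarrow> real) \<Rightarrow> 'b topology" where
  "norm_topology V N \<equiv> Metric_space.mtopology V (norm_dist N)"

lemma normed_onD:
  assumes "normed_on V N"
  shows normed_subspace: "subspace V"
    and normed_nonneg: "0 \<le> N x"
    and normed_zero: "x \<in> V \<Longrightarrow> N x = 0 \<longleftrightarrow> x = 0"
    and normed_triangle: "x \<in> V \<Longrightarrow> y \<in> V \<Longrightarrow> N (x + y) \<le> N x + N y"
    and normed_scale: "x \<in> V \<Longrightarrow> N (r *\<^sub>R x) = \<bar>r\<bar> * N x"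
proof -
  show "subspace V"
    using assms by (simp add: normed_on_def)
  show "0 \<le> N x"
    using assms unfolding normed_on_def by (cases "x \<in> V") auto
  show "x \<in> V \<Longrightarrow> N x = 0 \<longleftrightarrow> x = 0" "x \<in> V \<Longrightarrow> y \<in> V \<Longrightarrow> N (x + y) \<le> N x + N y"
    "x \<in> V \<Longrightarrow> N (r *\<^sub>R x) = \<bar>r\<bar> * N x"
    using assms unfolding normed_on_def by blast+
qed

lemma topspace_norm_topology:
  assumes "normed_on V N"
  shows "topspace (norm_topology V N) = V"
  using Metric_space.topspace_mtopology[OF Metric_space_norm_dist[OF assms]] .

lemma openin_norm_topology:
  assumes "normed_on V N"
  shows "openin (norm_topology V N) U \<longleftrightarrow>
    U \<subseteq> V \<and> (\<forall>x\<in>U. \<exists>r>0. \<forall>y\<in>V. N (y - x) < r \<longrightarrow> y \<in> U)"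
proof -
  interpret M: Metric_space V "norm_dist N" using assms by (rule Metric_space_norm_dist)
  have ball: "M.mball x r \<subseteq> U \<longleftrightarrow> (\<forall>y\<in>V. N (y - x) < r \<longrightarrow> y \<in> U)" if "x \<in> V" for x r
  proof -
    have "M.mball x r = {y \<in> V. N (y - x) < r}"
      unfolding M.mball_def using that by (auto simp: M.commute[of x]) (auto simp: norm_dist_def)
    then show ?thesis
      by auto
  qed
  show ?thesis
  proof (cases "U \<subseteq> V")
    case True
    then have "(\<exists>r>0. M.mball x r \<subseteq> U) \<longleftrightarrow> (\<exists>r>0. \<forall>y\<in>V. N (y - x) < r \<longrightarrow> y \<in> U)" if "x \<in> U" for x
      using ball that by (simp add: subsetD)
    then show ?thesis
      unfolding M.openin_mtopology using True by (simp add: Ball_def)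
  qed (simp add: M.openin_mtopology)
qed

lemma openin_norm_ball:
  assumes N: "normed_on V N" and x: "x \<in> V"
  shows "openin (norm_topology V N) {y \<in> V. N (y - x) < r}"
  unfolding openin_norm_topology[OF N]
proof (intro conjI ballI)
  fix y assume "y \<in> {y \<in> V. N (y - x) < r}"
  then have y: "y \<in> V" "N (y - x) < r" by auto
  have "N (z - x) < r" if "z \<in> V" "N (z - y) < r - N (y - x)" for z
  proof -
    have "N ((z - y) + (y - x)) \<le> N (z - y) + N (y - x)"
      using that y x normed_subspace[OF N] by (intro normed_triangle[OF N]) (auto simp: subspace_diff)
    then show ?thesis using that by simp
  qed
  then show "\<exists>e>0. \<forall>z\<in>V. N (z - y) < e \<longrightarrow> z \<in> {y \<in> V. N (y - x) < r}"
    using y by (intro exI[of _ "r - N (y - x)"]) auto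
qed auto

lemma locally_convex_norm_topology:
  assumes N: "normed_on V N"
  shows "locally_convex_space (norm_topology V N)"
proof -
  let ?T = "norm_topology V N"
  have V: "subspace V" using N by (rule normed_subspace)
  have top: "topspace ?T = V" using N by (rule topspace_norm_topology)
  have ball_nhd: "x \<in> {y \<in> V. N (y - x) < r}" if "x \<in> V" "r > 0" for x r
    using that normed_zero[OF N, of 0] subspace_0[OF V] by auto
  have add: "continuous_map (prod_topology ?T ?T) ?T (\<lambda>(x, y). x + y)"
    unfolding continuous_map_def top topspace_prod_topology
  proof (intro conjI allI impI)
    show "(\<lambda>(x, y). x + y) \<in> V \<times> V \<rightarrow> V" using V by (auto simp: subspace_add)
    fix U assume U: "openin ?T U"
    show "openin (prod_topology ?T ?T) {z \<in> V \<times> V. (case z of (x, y) \<Rightarrow> x + y) \<in> U}"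
    proof (subst openin_subopen, intro ballI)
      fix z assume "z \<in> {z \<in> V \<times> V. (case z of (x, y) \<Rightarrow> x + y) \<in> U}"
      then obtain x y where z: "z = (x, y)" "x \<in> V" "y \<in> V" "x + y \<in> U" by auto
      obtain r where r: "r > 0" "\<And>w. w \<in> V \<Longrightarrow> N (w - (x + y)) < r \<Longrightarrow> w \<in> U"
        using U z(4) unfolding openin_norm_topology[OF N] by blast
      let ?A = "{x' \<in> V. N (x' - x) < r / 2}" and ?B = "{y' \<in> V. N (y' - y) < r / 2}"
      have "x' + y' \<in> U" if "x' \<in> ?A" "y' \<in> ?B" for x' y'
      proof (rule r(2))
        show "x' + y' \<in> V" using that V by (auto simp: subspace_add)
        have "N ((x' - x) + (y' - y)) \<le> N (x' - x) + N (y' - y)"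
          using that z V by (intro normed_triangle[OF N]) (auto simp: subspace_diff)
        moreover have "(x' - x) + (y' - y) = x' + y' - (x + y)" by simp
        ultimately show "N (x' + y' - (x + y)) < r" using that by auto
      qed
      then have "?A \<times> ?B \<subseteq> {z \<in> V \<times> V. (case z of (x, y) \<Rightarrow> x + y) \<in> U}" by auto
      moreover have "openin (prod_topology ?T ?T) (?A \<times> ?B)"
        unfolding openin_prod_Times_iff using openin_norm_ball[OF N z(2)] openin_norm_ball[OF N z(3)] by blast
      moreover have "z \<in> ?A \<times> ?B" using ball_nhd[of x "r/2"] ball_nhd[of y "r/2"] z r by auto
      ultimately show "\<exists>W. openin (prod_topology ?T ?T) W \<and> z \<in> W \<and> W \<subseteq> {z \<in> V \<times> V. (case z of (x, y) \<Rightarrow> x + y) \<in> U}"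
        by meson
    qed
  qed
  have scale: "continuous_map (prod_topology euclideanreal ?T) ?T (\<lambda>(r, x). r *\<^sub>R x)"
    unfolding continuous_map_def top topspace_prod_topology topspace_euclidean
  proof (intro conjI allI impI)
    show "(\<lambda>(r, x). r *\<^sub>R x) \<in> UNIV \<times> V \<rightarrow> V" using V by (auto simp: subspace_scale)
    fix U assume U: "openin ?T U"
    show "openin (prod_topology euclideanreal ?T) {z \<in> UNIV \<times> V. (case z of (r, x) \<Rightarrow> r *\<^sub>R x) \<in> U}"
    proof (subst openin_subopen, intro ballI)
      fix z assume "z \<in> {z \<in> UNIV \<times> V. (case z of (r, x) \<Rightarrow> r *\<^sub>R x) \<in> U}"
      then obtain a x where z: "z = (a, x)" "x \<in> V" "a *\<^sub>R x \<in> U" by auto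
      obtain r where r: "r > 0" "\<And>w. w \<in> V \<Longrightarrow> N (w - a *\<^sub>R x) < r \<Longrightarrow> w \<in> U"
        using U z(3) unfolding openin_norm_topology[OF N] by blast
      define e where "e = min 1 (r / (2 * (N x + \<bar>a\<bar> + 1)))"
      have den: "N x + \<bar>a\<bar> + 1 > 0" using normed_nonneg[OF N, of x] by simp
      have e: "e > 0" "e \<le> 1" "e * (N x + \<bar>a\<bar> + 1) \<le> r / 2"
      proof -
        show "e > 0" "e \<le> 1" using r den by (auto simp: e_def)
        have "e \<le> r / (2 * (N x + \<bar>a\<bar> + 1))" by (simp add: e_def)
        then show "e * (N x + \<bar>a\<bar> + 1) \<le> r / 2" using den by (simp add: field_simps)
      qed
      let ?A = "ball a e" and ?B = "{y \<in> V. N (y - x) < e}"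
      have "b *\<^sub>R y \<in> U" if "b \<in> ?A" "y \<in> ?B" for b y
      proof (rule r(2))
        have b: "\<bar>b - a\<bar> < e" using that by (simp add: dist_real_def abs_minus_commute)
        have y: "y \<in> V" "N (y - x) < e" using that by auto
        show "b *\<^sub>R y \<in> V" using y V by (simp add: subspace_scale)
        have "N (b *\<^sub>R (y - x) + (b - a) *\<^sub>R x) \<le> N (b *\<^sub>R (y - x)) + N ((b - a) *\<^sub>R x)"
          using y z V by (intro normed_triangle[OF N]) (auto simp: subspace_scale subspace_diff)
        also have "\<dots> = \<bar>b\<bar> * N (y - x) + \<bar>b - a\<bar> * N x"
          using normed_scale[OF N] y z V by (simp add: subspace_diff)
        also have "\<dots> \<le> (\<bar>a\<bar> + 1) * e + e * N x"
          using b y e normed_nonneg[OF N] by (intro add_mono mult_mono) auto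
        also have "\<dots> = e * (N x + \<bar>a\<bar> + 1)" by (simp add: algebra_simps)
        also have "\<dots> < r" using e r by simp
        finally show "N (b *\<^sub>R y - a *\<^sub>R x) < r" by (simp add: algebra_simps)
      qed
      then have "?A \<times> ?B \<subseteq> {z \<in> UNIV \<times> V. (case z of (r, x) \<Rightarrow> r *\<^sub>R x) \<in> U}" by auto
      moreover have "openin (prod_topology euclideanreal ?T) (?A \<times> ?B)"
        using openin_norm_ball[OF N z(2)] by (simp add: openin_prod_Times_iff)
      moreover have "z \<in> ?A \<times> ?B" using ball_nhd[of x e] z e by auto
      ultimately show "\<exists>W. openin (prod_topology euclideanreal ?T) W \<and> z \<in> W \<and> W \<subseteq> {z \<in> UNIV \<times> V. (case z of (r, x) \<Rightarrow> r *\<^sub>R x) \<in> U}"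
        by meson
    qed
  qed
  have conv: "\<exists>W. openin ?T W \<and> 0 \<in> W \<and> convex W \<and> W \<subseteq> U" if U: "openin ?T U \<and> 0 \<in> U" for U
  proof -
    obtain r where r: "r > 0" "\<And>w. w \<in> V \<Longrightarrow> N (w - 0) < r \<Longrightarrow> w \<in> U"
      using U unfolding openin_norm_topology[OF N] by blast
    let ?B = "{y \<in> V. N (y - 0) < r}"
    have "convex ?B"
    proof (rule convexI)
      fix x y and u v :: real assume *: "x \<in> ?B" "y \<in> ?B" "0 \<le> u" "0 \<le> v" "u + v = 1"
      then have xy: "x \<in> V" "y \<in> V" "N x < r" "N y < r" by auto
      have "N (u *\<^sub>R x + v *\<^sub>R y) \<le> N (u *\<^sub>R x) + N (v *\<^sub>R y)"
        using xy V by (intro normed_triangle[OF N]) (auto simp: subspace_scale)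
      also have "\<dots> = u * N x + v * N y"
        using normed_scale[OF N] xy * by simp
      also have "\<dots> < r"
        using * xy by (intro convex_bound_lt) auto
      finally show "u *\<^sub>R x + v *\<^sub>R y \<in> ?B"
        using xy V by (simp add: subspace_add subspace_scale)
    qed
    then show ?thesis
      using openin_norm_ball[OF N subspace_0[OF V]] ball_nhd[OF subspace_0[OF V] r(1)] r(2)
      by (intro exI[of _ ?B]) blast
  qed
  show ?thesis
    unfolding locally_convex_space_def top using V add scale conv by blast
qed

lemma convenient_norm_topology:
  assumes "banach_on V N"
  shows "convenient (norm_topology V N)"
proof -
  have N: "normed_on V N" and complete: "Metric_space.mcomplete V (norm_dist N)"
    using assms by (auto simp: banach_on_def)
  interpret M: Metric_space V "norm_dist N" using N by (rule Metric_space_norm_dist)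
  have V: "subspace V" using N by (rule normed_subspace)
  have "\<exists>l. limitin M.mtopology x l sequentially" if x: "Mackey_Cauchy M.mtopology x" for x
  proof -
    obtain B \<mu> where B: "bounded_in M.mtopology B"
      and \<mu>: "((\<lambda>(m, n). \<mu> m n) \<longlongrightarrow> (0::real)) (sequentially \<times>\<^sub>F sequentially)"
      and diff: "\<And>m n. x m - x n \<in> (\<lambda>b. \<mu> m n *\<^sub>R b) ` B"
      and xV: "range x \<subseteq> V"
      using x unfolding Mackey_Cauchy_def M.topspace_mtopology by blast
    have "openin M.mtopology {y \<in> V. N (y - 0) < 1}" "0 \<in> {y \<in> V. N (y - 0) < 1}"
      using openin_norm_ball[OF N subspace_0[OF V]] subspace_0[OF V] normed_zero[OF N, of 0] by auto
    then obtain r where r: "r > 0" "B \<subseteq> (\<lambda>y. r *\<^sub>R y) ` {y \<in> V. N (y - 0) < 1}"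
      using B unfolding bounded_in_def by blast
    have NB: "N b \<le> r" if b: "b \<in> B" for b
    proof -
      obtain y where "b = r *\<^sub>R y" "y \<in> V" "N y < 1" using subsetD[OF r(2) b] by auto
      then show ?thesis using normed_scale[OF N, of y r] r(1) by simp
    qed
    have BV: "B \<subseteq> V" using B by (simp add: bounded_in_def)
    have "M.MCauchy x"
      unfolding M.MCauchy_def
    proof (intro conjI allI impI)
      fix \<epsilon> :: real assume \<epsilon>: "\<epsilon> > 0"
      have "\<forall>\<^sub>F z in sequentially \<times>\<^sub>F sequentially. dist (case z of (m, n) \<Rightarrow> \<mu> m n) 0 < \<epsilon> / r"
        using \<mu> \<epsilon> r(1) by (intro tendstoD) auto
      then obtain P Q where PQ: "eventually P sequentially" "eventually Q sequentially"
        "\<And>m n. P m \<Longrightarrow> Q n \<Longrightarrow> \<bar>\<mu> m n\<bar> < \<epsilon> / r"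
        unfolding eventually_prod_filter by auto
      have "eventually (\<lambda>n. P n \<and> Q n) sequentially"
        using PQ(1,2) by (rule eventually_conj)
      then obtain K where K: "\<And>n. n \<ge> K \<Longrightarrow> P n" "\<And>n. n \<ge> K \<Longrightarrow> Q n"
        unfolding eventually_sequentially by blast
      have "norm_dist N (x m) (x n) < \<epsilon>" if mn: "K \<le> m" "K \<le> n" for m n
      proof -
        obtain b where b: "b \<in> B" "x m - x n = \<mu> m n *\<^sub>R b" using diff[of m n] by blast
        then have "N (x m - x n) = \<bar>\<mu> m n\<bar> * N b" using normed_scale[OF N] BV by auto
        also have "\<dots> \<le> \<bar>\<mu> m n\<bar> * r" using NB[OF b(1)] by (intro mult_left_mono) auto
        also have "\<dots> < \<epsilon>" using PQ(3)[OF K(1)[OF mn(1)] K(2)[OF mn(2)]] r(1) by (simp add: field_simps)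
        finally show ?thesis by (simp add: norm_dist_def)
      qed
      then show "\<exists>K. \<forall>n n'. K \<le> n \<longrightarrow> K \<le> n' \<longrightarrow> norm_dist N (x n) (x n') < \<epsilon>" by blast
    qed (rule xV)
    then show ?thesis
      using complete unfolding M.mcomplete_def by blast
  qed
  then show ?thesis
    using locally_convex_norm_topology[OF N] M.Hausdorff_space_mtopology
    by (simp add: convenient_def Mackey_complete_def)
qed

lemma dual_norm_bound:
  assumes N: "normed_on V N" and l: "l \<in> continuous_dual (norm_topology V N)"
  obtains C where "C > 0" "\<And>x. x \<in> V \<Longrightarrow> \<bar>l x\<bar> \<le> C * N x"
proof -
  let ?T = "norm_topology V N"
  have V: "subspace V" and top: "topspace ?T = V"
    using N by (auto simp: normed_subspace topspace_norm_topology)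
  have l0: "l 0 = 0" using dual_scale[OF l, of 0 0] subspace_0[OF V] top by simp
  have "openin ?T {x \<in> V. l x \<in> ball 0 1}"
    using openin_continuous_map_preimage[OF dual_continuous[OF l], of "ball 0 1"] by (simp add: top)
  then obtain r where r: "r > 0" "\<And>y. y \<in> V \<Longrightarrow> N (y - 0) < r \<Longrightarrow> \<bar>l y\<bar> < 1"
  proof -
    assume op: "openin ?T {x \<in> V. l x \<in> ball 0 1}"
    have "0 \<in> {x \<in> V. l x \<in> ball 0 1}"
      using l0 subspace_0[OF V] by simp
    then obtain r where "r > 0" "\<forall>y\<in>V. N (y - 0) < r \<longrightarrow> y \<in> {x \<in> V. l x \<in> ball 0 1}"
      using op unfolding openin_norm_topology[OF N] by blast
    then show thesis
      by (intro that[of r]) auto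
  qed
  have "\<bar>l x\<bar> \<le> (2 / r) * N x" if x: "x \<in> V" for x
  proof (cases "x = 0")
    case True
    then show ?thesis using l0 normed_nonneg[OF N, of x] r(1) by simp
  next
    case False
    then have pos: "N x > 0" using normed_zero[OF N x] normed_nonneg[OF N, of x] by linarith
    let ?s = "r / (2 * N x)"
    have s: "?s > 0" using pos r(1) by simp
    have "N (?s *\<^sub>R x) < r" using normed_scale[OF N x, of ?s] pos r(1) by simp
    then have "\<bar>l (?s *\<^sub>R x)\<bar> < 1" using r(2) x V by (simp add: subspace_scale)
    moreover have "l (?s *\<^sub>R x) = ?s * l x" using dual_scale[OF l] x top by blast
    ultimately have "?s * \<bar>l x\<bar> < 1" by (simp only: abs_mult abs_of_pos[OF s])
    then show ?thesis using pos r(1) by (simp add: field_simps)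
  qed
  then show ?thesis using that[of "2 / r"] r(1) by simp
qed

lemma dual_normI:
  assumes N: "normed_on V N" and l: "linear_form_on V l" and C: "\<And>x. x \<in> V \<Longrightarrow> \<bar>l x\<bar> \<le> C * N x"
  shows "l \<in> continuous_dual (norm_topology V N)"
proof (rule continuous_dualI[OF locally_convex_norm_topology[OF N]])
  have V: "subspace V" using N by (rule normed_subspace)
  show "linear_form_on (topspace (norm_topology V N)) l" using l N by (simp add: topspace_norm_topology)
  show "openin (norm_topology V N) {y \<in> V. N (y - 0) < 1}"
    by (rule openin_norm_ball[OF N subspace_0[OF V]])
  show "0 \<in> {y \<in> V. N (y - 0) < 1}"
    using subspace_0[OF V] normed_zero[OF N, of 0] by simp
  fix x assume x: "x \<in> {y \<in> V. N (y - 0) < 1}"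
  have "\<bar>l x\<bar> \<le> C * N x" using C x by simp
  also have "\<dots> \<le> \<bar>C\<bar> * 1" using x normed_nonneg[OF N, of x] by (intro mult_mono) auto
  finally show "\<bar>l x\<bar> \<le> \<bar>C\<bar>" by simp
qed

lemma weakly_bounded_unit_ball:
  assumes N: "normed_on V N"
  shows "weakly_bounded (norm_topology V N) {x \<in> V. N x \<le> 1}"
  unfolding weakly_bounded_def
proof (intro conjI ballI)
  show "{x \<in> V. N x \<le> 1} \<subseteq> topspace (norm_topology V N)" using N by (auto simp: topspace_norm_topology)
  fix l assume "l \<in> continuous_dual (norm_topology V N)"
  then obtain C where C: "C > 0" "\<And>x. x \<in> V \<Longrightarrow> \<bar>l x\<bar> \<le> C * N x" using dual_norm_bound[OF N] by blast
  have "\<bar>l x\<bar> \<le> C" if x: "x \<in> {x \<in> V. N x \<le> 1}" for x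
  proof -
    have "\<bar>l x\<bar> \<le> C * N x"
      using x by (intro C(2)) simp
    also have "\<dots> \<le> C * 1"
      using x C(1) by (intro mult_left_mono) auto
    finally show ?thesis by simp
  qed
  then show "\<exists>M. \<forall>x\<in>{x \<in> V. N x \<le> 1}. \<bar>l x\<bar> \<le> M" by blast
qed

text \<open>This is the nontrivial half of the fact that the \<open>c\<^sup>\<infinity>\<close>-topology of a Banach space is its norm topology.
  The bounded set to be absorbed is the unit ball.\<close>

lemma cinf_open_contains_norm_ball:
  assumes V: "banach_on V N" and L: "\<forall>k. L k > 0" "log_convex L" "\<not> quasianalytic L"
    and W: "openin (cinf_topology (norm_topology V N)) W" "x \<in> W"
  obtains \<delta> where "\<delta> > 0" "\<And>y. y \<in> V \<Longrightarrow> N (y - x) < \<delta> \<Longrightarrow> y \<in> W"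
proof -
  have N: "normed_on V N" using V by (simp add: banach_on_def)
  have sub: "subspace V" using N by (rule normed_subspace)
  have x: "x \<in> V" using W unfolding openin_cinf_topology topspace_norm_topology[OF N] by blast
  obtain \<delta> where \<delta>: "\<delta> > 0" "\<And>b s. b \<in> {x \<in> V. N x \<le> 1} \<Longrightarrow> \<bar>s\<bar> < \<delta> \<Longrightarrow> x + s *\<^sub>R b \<in> W"
    by (rule cinf_open_absorbs_bounded[OF convenient_norm_topology[OF V] L weakly_bounded_unit_ball[OF N] W]) (rule that)
  show ?thesis
  proof (rule that[OF \<delta>(1)])
    fix y assume y: "y \<in> V" "N (y - x) < \<delta>"
    have yx: "y - x \<in> V" using y x sub by (simp add: subspace_diff)
    show "y \<in> W"
    proof (cases "y = x")
      case False
      let ?n = "N (y - x)"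
      have n: "?n > 0" using normed_zero[OF N yx] normed_nonneg[OF N, of "y - x"] False by auto
      have "N ((1 / ?n) *\<^sub>R (y - x)) = \<bar>1 / ?n\<bar> * ?n" by (rule normed_scale[OF N yx])
      then have "(1 / ?n) *\<^sub>R (y - x) \<in> {x \<in> V. N x \<le> 1}"
        using n subspace_scale[OF sub yx] by simp
      then have "x + ?n *\<^sub>R ((1 / ?n) *\<^sub>R (y - x)) \<in> W"
        by (rule \<delta>(2)) (use y(2) n in simp)
      then show ?thesis using n by simp
    qed (use W in simp)
  qed
qed

section \<open>The Banach space generated by a bounded set\<close>

text \<open>\<open>disk_space T A\<close> with \<open>disk_norm T A\<close> is the span of the bipolar of the bounded set \<open>A\<close>, normed by the
  Minkowski functional of the bipolar.  Working with the bipolar reduces every estimate of the norm to a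
  scalar estimate for each continuous functional.\<close>

definition support_fun :: "'e set \<Rightarrow> ('e \<Rightarrow> real) \<Rightarrow> real" where
  "support_fun A l = (SUP r\<in>insert 0 ((\<lambda>a. \<bar>l a\<bar>) ` A). r)"

definition disk_bound :: "'e::real_vector topology \<Rightarrow> 'e set \<Rightarrow> 'e \<Rightarrow> real \<Rightarrow> bool" where
  "disk_bound T A x r \<longleftrightarrow> 0 \<le> r \<and> (\<forall>l\<in>continuous_dual T. \<bar>l x\<bar> \<le> r * support_fun A l)"

definition disk_space :: "'e::real_vector topology \<Rightarrow> 'e set \<Rightarrow> 'e set" where
  "disk_space T A = {x \<in> topspace T. \<exists>r. disk_bound T A x r}"

definition disk_norm :: "'e::real_vector topology \<Rightarrow> 'e set \<Rightarrow> 'e \<Rightarrow> real" where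
  "disk_norm T A x = Inf {r. disk_bound T A x r}"

lemma support_fun_props:
  assumes A: "weakly_bounded T A" and l: "l \<in> continuous_dual T"
  shows support_fun_nonneg: "0 \<le> support_fun A l"
    and support_fun_upper: "a \<in> A \<Longrightarrow> \<bar>l a\<bar> \<le> support_fun A l"
proof -
  obtain M where M: "\<And>a. a \<in> A \<Longrightarrow> \<bar>l a\<bar> \<le> M" using assms unfolding weakly_bounded_def by blast
  have bdd: "bdd_above ((\<lambda>r. r) ` insert 0 ((\<lambda>a. \<bar>l a\<bar>) ` A))"
    using M by (intro bdd_aboveI[of _ "max 0 M"]) (auto simp: le_max_iff_disj)
  show "0 \<le> support_fun A l" "a \<in> A \<Longrightarrow> \<bar>l a\<bar> \<le> support_fun A l"
    unfolding support_fun_def by (rule cSUP_upper[OF _ bdd], simp)+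
qed

lemma disk_norm_le: "disk_bound T A x r \<Longrightarrow> disk_norm T A x \<le> r"
  unfolding disk_norm_def by (rule cInf_lower) (auto simp: disk_bound_def intro!: bdd_belowI[of _ 0])

lemma disk_bound_norm:
  assumes A: "weakly_bounded T A" and x: "x \<in> disk_space T A"
  shows "disk_bound T A x (disk_norm T A x)"
  unfolding disk_bound_def
proof (intro conjI ballI)
  have ne: "{r. disk_bound T A x r} \<noteq> {}" using x by (auto simp: disk_space_def)
  show "0 \<le> disk_norm T A x"
    unfolding disk_norm_def by (rule cInf_greatest[OF ne]) (auto simp: disk_bound_def)
  fix l assume l: "l \<in> continuous_dual T"
  show "\<bar>l x\<bar> \<le> disk_norm T A x * support_fun A l"
  proof (cases "support_fun A l = 0")
    case True
    then show ?thesis using ne l by (force simp: disk_bound_def)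
  next
    case False
    then have pos: "support_fun A l > 0" using support_fun_nonneg[OF A l] by simp
    have "\<bar>l x\<bar> / support_fun A l \<le> disk_norm T A x"
      unfolding disk_norm_def
      by (rule cInf_greatest[OF ne]) (use l pos in \<open>auto simp: disk_bound_def pos_divide_le_eq\<close>)
    then show ?thesis using pos by (simp add: pos_divide_le_eq)
  qed
qed

lemma disk_spaceD:
  assumes A: "weakly_bounded T A" and x: "x \<in> disk_space T A"
  shows disk_space_topspace: "x \<in> topspace T"
    and disk_norm_nonneg: "0 \<le> disk_norm T A x"
    and disk_norm_dual: "l \<in> continuous_dual T \<Longrightarrow> \<bar>l x\<bar> \<le> disk_norm T A x * support_fun A l"
  using disk_bound_norm[OF assms] x by (auto simp: disk_bound_def disk_space_def)

lemma disk_spaceI: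
  assumes "x \<in> topspace T" "0 \<le> r" "\<And>l. l \<in> continuous_dual T \<Longrightarrow> \<bar>l x\<bar> \<le> r * support_fun A l"
  shows "x \<in> disk_space T A" "disk_norm T A x \<le> r"
  using assms disk_norm_le[of T A x r] by (auto simp: disk_space_def disk_bound_def)

lemma disk_normed:
  assumes T: "locally_convex_space T" "Hausdorff_space T" and A: "weakly_bounded T A"
  shows "subspace (disk_space T A)"
    and "x \<in> disk_space T A \<Longrightarrow> disk_norm T A x = 0 \<longleftrightarrow> x = 0"
    and "x \<in> disk_space T A \<Longrightarrow> y \<in> disk_space T A \<Longrightarrow> disk_norm T A (x + y) \<le> disk_norm T A x + disk_norm T A y"
    and "x \<in> disk_space T A \<Longrightarrow> disk_norm T A (r *\<^sub>R x) = \<bar>r\<bar> * disk_norm T A x"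
proof -
  let ?V = "disk_space T A" and ?N = "disk_norm T A"
  have E: "subspace (topspace T)" using T(1) by (rule lcs_subspace)
  note D = disk_spaceD[OF A]
  have zero: "0 \<in> ?V" "?N 0 \<le> 0"
  proof -
    have "\<bar>l 0\<bar> \<le> 0 * support_fun A l" if "l \<in> continuous_dual T" for l
      using dual_scale[OF that, of 0 0] subspace_0[OF E] by simp
    then show "0 \<in> ?V" "?N 0 \<le> 0" using disk_spaceI[of 0 T 0 A] subspace_0[OF E] by auto
  qed
  have add: "x + y \<in> ?V" "?N (x + y) \<le> ?N x + ?N y" if xy: "x \<in> ?V" "y \<in> ?V" for x y
  proof -
    have "\<bar>l (x + y)\<bar> \<le> (?N x + ?N y) * support_fun A l" if l: "l \<in> continuous_dual T" for l
      using dual_add[OF l D(1)[OF xy(1)] D(1)[OF xy(2)]] D(3)[OF xy(1) l] D(3)[OF xy(2) l]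
      by (simp add: distrib_right)
    then show "x + y \<in> ?V" "?N (x + y) \<le> ?N x + ?N y"
      using disk_spaceI[of "x + y" T "?N x + ?N y" A] D(1,2)[OF xy(1)] D(1,2)[OF xy(2)] E
      by (auto simp: subspace_add)
  qed
  have scale: "r *\<^sub>R x \<in> ?V" "?N (r *\<^sub>R x) \<le> \<bar>r\<bar> * ?N x" if x: "x \<in> ?V" for r x
  proof -
    have "\<bar>l (r *\<^sub>R x)\<bar> \<le> (\<bar>r\<bar> * ?N x) * support_fun A l" if l: "l \<in> continuous_dual T" for l
      using dual_scale[OF l D(1)[OF x]] mult_left_mono[OF D(3)[OF x l], of "\<bar>r\<bar>"] by (simp add: abs_mult mult.assoc)
    then show "r *\<^sub>R x \<in> ?V" "?N (r *\<^sub>R x) \<le> \<bar>r\<bar> * ?N x"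
      using disk_spaceI[of "r *\<^sub>R x" T "\<bar>r\<bar> * ?N x" A] D(1,2)[OF x] E
      by (auto simp: subspace_scale)
  qed
  show "subspace ?V" using zero add scale by (simp add: subspace_def)
  show "?N x = 0 \<longleftrightarrow> x = 0" if x: "x \<in> ?V" for x
  proof
    assume "?N x = 0"
    then have "l x = 0" if "l \<in> continuous_dual T" for l using D(3)[OF x that] by simp
    then show "x = 0" using dual_separates[OF T D(1)[OF x]] by blast
  next
    assume "x = 0"
    then show "?N x = 0" using zero D(2)[OF zero(1)] by simp
  qed
  show "?N (x + y) \<le> ?N x + ?N y" if "x \<in> ?V" "y \<in> ?V" using add that by blast
  show "?N (r *\<^sub>R x) = \<bar>r\<bar> * ?N x" if x: "x \<in> ?V" for x
  proof (cases "r = 0")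
    case True
    then show ?thesis using zero D(2)[OF zero(1)] by simp
  next
    case False
    have "?N ((1 / r) *\<^sub>R (r *\<^sub>R x)) \<le> \<bar>1 / r\<bar> * ?N (r *\<^sub>R x)" using scale x by blast
    then have "\<bar>r\<bar> * ?N x \<le> ?N (r *\<^sub>R x)" using False by (simp add: field_simps)
    then show ?thesis using scale(2)[OF x, of r] by simp
  qed
qed

lemma weakly_bounded_disk:
  assumes A: "weakly_bounded T A"
  shows "weakly_bounded T {x \<in> disk_space T A. disk_norm T A x \<le> 1}"
  unfolding weakly_bounded_def
proof (intro conjI ballI)
  let ?B = "{x \<in> disk_space T A. disk_norm T A x \<le> 1}"
  show "?B \<subseteq> topspace T" using disk_space_topspace[OF A] by blast
  fix l assume l: "l \<in> continuous_dual T"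
  have "\<bar>l x\<bar> \<le> support_fun A l" if "x \<in> ?B" for x
    using disk_norm_dual[OF A _ l, of x] that mult_right_mono[of "disk_norm T A x" 1 "support_fun A l"]
      support_fun_nonneg[OF A l] by auto
  then show "\<exists>M. \<forall>x\<in>?B. \<bar>l x\<bar> \<le> M" by blast
qed

text \<open>A copy of this Banach space in the ambient space of the plots.\<close>

definition disk_prod :: "'e::real_vector topology \<Rightarrow> 'e set \<Rightarrow> ('e \<times> 'b::real_vector) set" where
  "disk_prod T A = disk_space T A \<times> {0}"

definition disk_prod_norm :: "'e::real_vector topology \<Rightarrow> 'e set \<Rightarrow> 'e \<times> 'b::real_vector \<Rightarrow> real" where
  "disk_prod_norm T A z = (if z \<in> disk_prod T A then disk_norm T A (fst z) else 0)"

lemma disk_prod_norm_eq: "x \<in> disk_space T A \<Longrightarrow> disk_prod_norm T A (x, 0) = disk_norm T A x"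
  by (simp add: disk_prod_norm_def disk_prod_def)

lemma normed_disk_prod:
  assumes T: "locally_convex_space T" "Hausdorff_space T" and A: "weakly_bounded T A"
  shows "normed_on (disk_prod T A) (disk_prod_norm T A)"
proof -
  note n = disk_normed[OF T A]
  show ?thesis
    unfolding normed_on_def
  proof (intro conjI ballI allI impI)
    show "subspace (disk_prod T A)"
      using n(1) by (auto simp: disk_prod_def subspace_def zero_prod_def)
    fix z z' :: "'a \<times> 'b" and r assume z: "z \<in> disk_prod T A"
    then obtain x where x: "z = (x, 0)" "x \<in> disk_space T A" by (auto simp: disk_prod_def)
    show "0 \<le> disk_prod_norm T A z"
      using x disk_norm_nonneg[OF A x(2)] by (simp add: disk_prod_norm_eq)
    show "disk_prod_norm T A z = 0 \<longleftrightarrow> z = 0"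
      using x n(2)[OF x(2)] by (simp add: disk_prod_norm_eq zero_prod_def)
    show "disk_prod_norm T A (r *\<^sub>R z) = \<bar>r\<bar> * disk_prod_norm T A z"
      using x n(4)[OF x(2)] subspace_scale[OF n(1) x(2)] by (simp add: disk_prod_norm_eq)
    assume "z' \<in> disk_prod T A"
    then obtain y where y: "z' = (y, 0)" "y \<in> disk_space T A" by (auto simp: disk_prod_def)
    show "disk_prod_norm T A (z + z') \<le> disk_prod_norm T A z + disk_prod_norm T A z'"
      using x y n(3)[OF x(2) y(2)] subspace_add[OF n(1) x(2) y(2)] by (simp add: disk_prod_norm_eq)
  qed (simp add: disk_prod_norm_def)
qed

text \<open>A Cauchy sequence for the disk norm is Mackey--Cauchy, because the unit ball is bounded; the norm
  estimates pass to the limit functional by functional.\<close>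

theorem banach_disk:
  assumes T: "convenient T" and A: "weakly_bounded T A"
  shows "banach_on (disk_prod T A :: ('e::real_vector \<times> 'b::real_vector) set) (disk_prod_norm T A)"
proof -
  let ?V = "disk_prod T A :: ('e \<times> 'b) set" and ?N = "disk_prod_norm T A :: 'e \<times> 'b \<Rightarrow> real"
  have lcs: "locally_convex_space T" and H: "Hausdorff_space T"
    using T by (auto simp: convenient_def)
  have normed: "normed_on ?V ?N" by (rule normed_disk_prod[OF lcs H A])
  interpret M: Metric_space ?V "norm_dist ?N" using normed by (rule Metric_space_norm_dist)
  note n = disk_normed[OF lcs H A]
  let ?B = "{x \<in> disk_space T A. disk_norm T A x \<le> 1}"
  have B: "bounded_in T ?B"
    using weakly_bounded_imp_bounded[OF lcs weakly_bounded_disk[OF A]] .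
  have "\<exists>z. limitin M.mtopology \<sigma> z sequentially" if \<sigma>: "M.MCauchy \<sigma>" for \<sigma>
  proof -
    define x where "x = (\<lambda>k. fst (\<sigma> k))"
    have \<sigma>V: "\<sigma> k \<in> ?V" for k using \<sigma> unfolding M.MCauchy_def by auto
    then have x: "\<sigma> k = (x k, 0)" "x k \<in> disk_space T A" for k
      unfolding x_def disk_prod_def by (auto simp: mem_Times_iff prod_eq_iff)
    have d: "norm_dist ?N (\<sigma> k) (\<sigma> j) = disk_norm T A (x k - x j)" for k j
      unfolding norm_dist_def x(1) using subspace_diff[OF n(1) x(2) x(2)] by (simp add: disk_prod_norm_eq)
    have cauchy: "\<exists>K. \<forall>k\<ge>K. \<forall>j\<ge>K. disk_norm T A (x k - x j) < \<epsilon>" if "\<epsilon> > 0" for \<epsilon>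
      using \<sigma> that unfolding M.MCauchy_def d by metis
    let ?\<mu> = "\<lambda>k j. disk_norm T A (x k - x j)"
    have \<mu>0: "0 \<le> ?\<mu> k j" for k j
      using disk_norm_nonneg[OF A subspace_diff[OF n(1) x(2) x(2)]] .
    have "Mackey_Cauchy T x"
      unfolding Mackey_Cauchy_def
    proof (intro conjI exI[of _ ?B] exI[of _ ?\<mu>] allI)
      show "range x \<subseteq> topspace T" using x(2) disk_space_topspace[OF A] by blast
      show "((\<lambda>(k, j). ?\<mu> k j) \<longlongrightarrow> 0) (sequentially \<times>\<^sub>F sequentially)"
      proof (rule tendstoI)
        fix \<epsilon> :: real assume "\<epsilon> > 0"
        then obtain K where K: "\<forall>k\<ge>K. \<forall>j\<ge>K. ?\<mu> k j < \<epsilon>" using cauchy by blast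
        show "\<forall>\<^sub>F z in sequentially \<times>\<^sub>F sequentially. dist (case z of (k, j) \<Rightarrow> ?\<mu> k j) 0 < \<epsilon>"
          unfolding eventually_prod_filter
        proof (intro exI[of _ "\<lambda>k. k \<ge> K"] conjI allI impI)
          fix k j assume "K \<le> k" "K \<le> j"
          then show "dist (case (k, j) of (k, j) \<Rightarrow> ?\<mu> k j) 0 < \<epsilon>" using K \<mu>0[of k j] by simp
        qed (auto intro: eventually_ge_at_top)
      qed
      fix k j
      have kj: "x k - x j \<in> disk_space T A" by (rule subspace_diff[OF n(1) x(2) x(2)])
      show "x k - x j \<in> (\<lambda>b. ?\<mu> k j *\<^sub>R b) ` ?B"
      proof (cases "x k - x j = 0")
        case True
        have "0 \<in> ?B" using n(2)[of 0] subspace_0[OF n(1)] by simp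
        then show ?thesis using True by (intro image_eqI[of _ _ 0]) auto
      next
        case False
        then have pos: "?\<mu> k j > 0" using n(2)[OF kj] \<mu>0[of k j] by linarith
        have "disk_norm T A ((1 / ?\<mu> k j) *\<^sub>R (x k - x j)) = \<bar>1 / ?\<mu> k j\<bar> * ?\<mu> k j" by (rule n(4)[OF kj])
        then have "(1 / ?\<mu> k j) *\<^sub>R (x k - x j) \<in> ?B" using pos subspace_scale[OF n(1) kj] by simp
        then show ?thesis by (rule rev_image_eqI) (use pos in simp)
      qed
    qed (rule B)
    then obtain y where y: "limitin T x y sequentially"
      using convenient_complete[OF T] unfolding Mackey_complete_def by blast
    have yE: "y \<in> topspace T" using y limitin_topspace by metis
    have close: "x k - y \<in> disk_space T A" "disk_norm T A (x k - y) \<le> \<epsilon>"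
      if \<epsilon>: "\<epsilon> \<ge> 0" and K: "\<forall>k\<ge>K. \<forall>j\<ge>K. ?\<mu> k j < \<epsilon>" and k: "k \<ge> K" for k K \<epsilon>
    proof -
      have xE: "x j \<in> topspace T" for j using x(2) disk_space_topspace[OF A] by blast
      have "\<bar>l (x k - y)\<bar> \<le> \<epsilon> * support_fun A l" if l: "l \<in> continuous_dual T" for l
      proof -
        have "(\<lambda>j. l (x j)) \<longlonglongrightarrow> l y"
          using continuous_map_limit[OF dual_continuous[OF l] y] by (simp add: o_def)
        then have lim: "(\<lambda>j. \<bar>l (x k) - l (x j)\<bar>) \<longlonglongrightarrow> \<bar>l (x k) - l y\<bar>"
          by (intro tendsto_intros)
        have "\<bar>l (x k) - l (x j)\<bar> \<le> \<epsilon> * support_fun A l" if "j \<ge> K" for j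
        proof -
          have "\<bar>l (x k - x j)\<bar> \<le> ?\<mu> k j * support_fun A l"
            by (rule disk_norm_dual[OF A subspace_diff[OF n(1) x(2) x(2)] l])
          also have "\<dots> \<le> \<epsilon> * support_fun A l"
            using K k that support_fun_nonneg[OF A l] by (intro mult_right_mono) (auto intro: less_imp_le)
          finally show ?thesis using dual_diff[OF lcs l xE xE] by simp
        qed
        then have "\<bar>l (x k) - l y\<bar> \<le> \<epsilon> * support_fun A l"
          by (intro LIMSEQ_le_const2[OF lim]) blast
        then show ?thesis using dual_diff[OF lcs l xE yE] by simp
      qed
      then show "x k - y \<in> disk_space T A" "disk_norm T A (x k - y) \<le> \<epsilon>"
        using disk_spaceI[of "x k - y" T \<epsilon> A] subspace_diff[OF lcs_subspace[OF lcs] xE yE] \<epsilon> by blast+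
    qed
    obtain K1 where K1: "\<forall>k\<ge>K1. \<forall>j\<ge>K1. ?\<mu> k j < 1" using cauchy[of 1] by auto
    have "x K1 - y \<in> disk_space T A"
      using close(1)[OF _ K1, of K1] by simp
    from subspace_diff[OF n(1) x(2) this]
    have "x K1 - (x K1 - y) \<in> disk_space T A" .
    moreover have "x K1 - (x K1 - y) = y" by (simp add: algebra_simps)
    ultimately have yV: "y \<in> disk_space T A" by simp
    have "limitin M.mtopology \<sigma> (y, 0) sequentially"
      unfolding M.limitin_metric
    proof (intro conjI allI impI)
      show "(y, 0) \<in> ?V" using yV unfolding disk_prod_def by blast
      fix \<epsilon> :: real assume "\<epsilon> > 0"
      then obtain K where K: "\<forall>k\<ge>K. \<forall>j\<ge>K. ?\<mu> k j < \<epsilon> / 2" using cauchy[of "\<epsilon> / 2"] by auto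
      have "\<sigma> k \<in> ?V \<and> norm_dist ?N (\<sigma> k) (y, 0) < \<epsilon>" if "k \<ge> K" for k
        using close[OF _ K that] \<sigma>V[of k] \<open>\<epsilon> > 0\<close> unfolding norm_dist_def x(1)
        by (simp add: disk_prod_norm_eq)
      then show "\<forall>\<^sub>F k in sequentially. \<sigma> k \<in> ?V \<and> norm_dist ?N (\<sigma> k) (y, 0) < \<epsilon>"
        unfolding eventually_sequentially by blast
    qed
    then show ?thesis by blast
  qed
  then show ?thesis
    using normed unfolding banach_on_def M.mcomplete_def by blast
qed

lemma dual_comp_fst:
  assumes T: "convenient T" and A: "weakly_bounded T A" and l: "l \<in> continuous_dual T"
  shows "l \<circ> fst \<in> continuous_dual (norm_topology (disk_prod T A :: ('e::real_vector \<times> 'b::real_vector) set) (disk_prod_norm T A))"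
proof (rule dual_normI)
  show "normed_on (disk_prod T A :: ('e \<times> 'b) set) (disk_prod_norm T A)"
    using banach_disk[OF T A, where 'b = 'b] by (simp add: banach_on_def)
  show "linear_form_on (disk_prod T A :: ('e \<times> 'b) set) (l \<circ> fst)"
    using dual_add[OF l] dual_scale[OF l] disk_space_topspace[OF A]
    by (auto simp: linear_form_on_def disk_prod_def)
  show "\<bar>(l \<circ> fst) z\<bar> \<le> support_fun A l * disk_prod_norm T A z" if "z \<in> (disk_prod T A :: ('e \<times> 'b) set)" for z
    using that disk_norm_dual[OF A _ l, of "fst z"]
    by (auto simp: disk_prod_def disk_prod_norm_eq mult.commute)
qed

section \<open>Recovering a class from larger ones\<close>

definition superexponential :: "(nat \<Rightarrow> real) \<Rightarrow> bool" where
  "superexponential R \<longleftrightarrow> log_convex R \<and> (\<forall>k. 1 \<le> R k) \<and> (\<forall>\<rho>>0. \<exists>C>0. \<forall>k. \<rho> ^ k \<le> C * R k)"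

lemma superexponential_prod:
  assumes mono: "mono \<mu>" and one: "\<And>i. 1 \<le> \<mu> i" and unb: "\<And>b. \<exists>i. b \<le> \<mu> i"
  shows "superexponential (\<lambda>k. \<Prod>i<k. \<mu> i)"
  unfolding superexponential_def
proof (intro conjI allI impI)
  let ?R = "\<lambda>k. \<Prod>i<k. \<mu> i"
  show R1: "1 \<le> ?R k" for k
    using one by (intro prod_ge_1) auto
  show "log_convex ?R"
    unfolding log_convex_def
  proof (intro allI impI)
    fix k :: nat assume "1 \<le> k"
    then obtain j where k: "k = Suc j" by (cases k) auto
    have "?R j \<ge> 0" using R1[of j] by linarith
    have "\<mu> j \<le> \<mu> (Suc j)" using mono by (simp add: mono_def)
    then have "(?R j * ?R j * \<mu> j) * \<mu> j \<le> (?R j * ?R j * \<mu> j) * \<mu> (Suc j)"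
      using one[of j] by (intro mult_left_mono) (auto intro!: mult_nonneg_nonneg)
    then show "(?R k)\<^sup>2 \<le> ?R (k - 1) * ?R (k + 1)"
      by (simp add: k power2_eq_square mult_ac)
  qed
  fix \<rho> :: real assume \<rho>: "\<rho> > 0"
  define b where "b = max 1 \<rho>"
  obtain i where i: "b \<le> \<mu> i" using unb by blast
  have "b ^ k \<le> b ^ i * ?R k" for k
  proof (induction k)
    case 0
    then show ?case by (simp add: b_def)
  next
    case (Suc k)
    show ?case
    proof (cases "k < i")
      case True
      then have "b ^ Suc k * 1 \<le> b ^ i * ?R (Suc k)"
        using R1[of "Suc k"]
        by (intro mult_mono power_increasing) (auto simp: b_def simp del: prod.lessThan_Suc)
      then show ?thesis by simp
    next
      case False
      then have "b \<le> \<mu> k" using i mono by (meson monoD not_less order_trans)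
      moreover have "0 \<le> b ^ i * ?R k"
        using R1[of k] by (intro mult_nonneg_nonneg) (auto simp: b_def)
      ultimately have "b ^ k * b \<le> (b ^ i * ?R k) * \<mu> k"
        using Suc.IH by (intro mult_mono) (auto simp: b_def)
      then show ?thesis by (simp add: mult_ac)
    qed
  qed
  moreover have "\<rho> ^ k \<le> b ^ k" for k using \<rho> by (intro power_mono) (auto simp: b_def)
  ultimately have "\<rho> ^ k \<le> b ^ i * ?R k" for k using order_trans by blast
  moreover have "b ^ i > 0" by (simp add: b_def)
  ultimately show "\<exists>C>0. \<forall>k. \<rho> ^ k \<le> C * ?R k" by blast
qed

text \<open>If the bounds of \<open>C\<^sup>L\<close> fail for \<open>h\<close>, they fail at a rapidly growing sequence of orders \<open>\<kappa> j\<close>, by a factor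
  \<open>(j + 1) ^ (2 * \<kappa> j)\<close>.  A product \<open>R\<close> of slowly growing factors still satisfies \<open>R (\<kappa> j) \<le> (j + 1) ^ \<kappa> j\<close>,
  hence \<open>h\<close> violates the bounds of \<open>L * R\<close> too.\<close>

theorem CL_real_of_multiples:
  assumes L: "\<forall>k. L k > 0"
    and h: "\<And>R. superexponential R \<Longrightarrow> h \<in> CL_real (\<lambda>k. L k * R k)"
  shows "h \<in> CL_real L"
proof (rule ccontr)
  let ?h = "\<lambda>k. (deriv ^^ k) h"
  assume not: "h \<notin> CL_real L"
  have "superexponential (\<lambda>k. \<Prod>i<k. real (Suc i))"
  proof (rule superexponential_prod)
    show "\<exists>i. b \<le> real (Suc i)" for b
      using real_arch_simple[of b] by (metis le_SucI of_nat_le_iff order_trans order_refl)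
  qed (auto simp: mono_def)
  from h[OF this] have D: "derivs_on UNIV ?h"
    unfolding CL_real_global_iff by blast
  then obtain A where A: "\<And>C \<rho>. C > 0 \<Longrightarrow> \<rho> > 0 \<Longrightarrow> \<exists>k t. \<bar>t\<bar> \<le> A \<and> \<bar>?h k t\<bar> > C * \<rho> ^ k * fact k * L k"
    using not unfolding CL_real_global_iff by (meson not_le)
  have large: "\<exists>k\<ge>K. \<exists>t. \<bar>t\<bar> \<le> A \<and> \<bar>?h k t\<bar> > \<rho> ^ k * fact k * L k" if \<rho>: "\<rho> > 0" for \<rho> K
  proof (rule ccontr)
    assume "\<not> ?thesis"
    then have hi: "\<And>k t. k \<ge> K \<Longrightarrow> \<bar>t\<bar> \<le> A \<Longrightarrow> \<bar>?h k t\<bar> \<le> \<rho> ^ k * fact k * L k"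
      by (meson not_le)
    have "\<exists>M>0. \<forall>t. \<bar>t\<bar> \<le> A \<longrightarrow> \<bar>?h k t\<bar> \<le> M" for k
      using derivative_bounded_near[OF D, of 0 A k] by (metis diff_0_right)
    then obtain M where M: "\<And>k. M k > 0" "\<And>k t. \<bar>t\<bar> \<le> A \<Longrightarrow> \<bar>?h k t\<bar> \<le> M k" by metis
    let ?w = "\<lambda>k. \<rho> ^ k * fact k * L k"
    have w: "?w k > 0" for k using \<rho> L by simp
    define C where "C = 1 + (\<Sum>k<K. M k / ?w k)"
    have terms: "0 \<le> M k / ?w k" for k using M(1)[of k] w[of k] by (simp add: less_imp_le)
    have C1: "C \<ge> 1" unfolding C_def using terms by (simp add: sum_nonneg)
    have "\<bar>?h k t\<bar> \<le> C * ?w k" if t: "\<bar>t\<bar> \<le> A" for k t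
    proof (cases "k < K")
      case True
      then have "M k / ?w k \<le> (\<Sum>k<K. M k / ?w k)"
        using terms by (intro member_le_sum) auto
      then have "M k / ?w k \<le> C" by (simp add: C_def)
      then have "M k \<le> C * ?w k" using w[of k] by (simp only: pos_divide_le_eq)
      then show ?thesis using M(2)[OF t, of k] by linarith
    next
      case False
      then have "\<bar>?h k t\<bar> \<le> 1 * ?w k" using hi t by simp
      also have "\<dots> \<le> C * ?w k" using C1 w[of k] by (intro mult_right_mono) auto
      finally show ?thesis .
    qed
    moreover obtain k t where "\<bar>t\<bar> \<le> A" "\<bar>?h k t\<bar> > C * \<rho> ^ k * fact k * L k"
      using A[of C \<rho>] C1 \<rho> by auto
    ultimately show False
      by (metis mult.assoc not_less)
  qed
  then obtain \<kappa>0 where \<kappa>0: "\<And>\<rho> K. \<rho> > 0 \<Longrightarrow> \<kappa>0 \<rho> K \<ge> K \<and> (\<exists>t. \<bar>t\<bar> \<le> A \<and> \<bar>?h (\<kappa>0 \<rho> K) t\<bar> > \<rho> ^ \<kappa>0 \<rho> K * fact (\<kappa>0 \<rho> K) * L (\<kappa>0 \<rho> K))"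
    by metis
  \<comment> \<open>The rate demanded at \<open>\<kappa> j\<close> is \<open>(j + 1)\<^sup>2\<close>, hence \<open>(j + 2)\<^sup>2\<close> at the successor of \<open>j\<close>.\<close>
  define \<kappa> where "\<kappa> = rec_nat (\<kappa>0 1 0) (\<lambda>j k. \<kappa>0 ((real (Suc (Suc j)))\<^sup>2) (Suc k))"
  have \<kappa>_Suc: "\<kappa> (Suc j) = \<kappa>0 ((real (Suc (Suc j)))\<^sup>2) (Suc (\<kappa> j))" for j
    by (simp add: \<kappa>_def)
  have "\<kappa> j < \<kappa> (Suc j)" for j
    using \<kappa>0[of "(real (Suc (Suc j)))\<^sup>2" "Suc (\<kappa> j)"] unfolding \<kappa>_Suc by simp
  then have strict: "strict_mono \<kappa>"
    by (simp add: strict_mono_Suc_iff)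
  have viol: "\<exists>t. \<bar>t\<bar> \<le> A \<and> \<bar>?h (\<kappa> j) t\<bar> > ((real (Suc j))\<^sup>2) ^ \<kappa> j * fact (\<kappa> j) * L (\<kappa> j)" for j
  proof (cases j)
    case 0
    have "\<kappa> 0 = \<kappa>0 1 0" by (simp add: \<kappa>_def)
    then show ?thesis using \<kappa>0[of 1 0] 0 by simp
  next
    case (Suc i)
    then show ?thesis using \<kappa>0[of "(real (Suc (Suc i)))\<^sup>2" "Suc (\<kappa> i)"] \<kappa>_Suc[of i] by simp
  qed
  \<comment> \<open>For \<open>i < \<kappa> j\<close> at most \<open>j\<close> of the orders are counted, whence \<open>\<mu> i \<le> j + 1\<close>.\<close>
  define \<mu> where "\<mu> = (\<lambda>i. 1 + real (card {j. \<kappa> j \<le> i}))"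
  have fin: "finite {j. \<kappa> j \<le> i}" for i
  proof (rule finite_subset)
    show "{j. \<kappa> j \<le> i} \<subseteq> {..i}" using strict_mono_imp_increasing[OF strict] order_trans by auto
  qed simp
  define R where "R = (\<lambda>k. \<Prod>i<k. \<mu> i)"
  have "superexponential R"
    unfolding R_def
  proof (rule superexponential_prod)
    show "mono \<mu>"
      unfolding mono_def \<mu>_def using fin by (auto intro!: card_mono)
    show "1 \<le> \<mu> i" for i by (simp add: \<mu>_def)
    show "\<exists>i. b \<le> \<mu> i" for b
    proof -
      obtain n :: nat where n: "b \<le> real n" using real_arch_simple by blast
      have "{..n} \<subseteq> {j. \<kappa> j \<le> \<kappa> n}" using strict by (auto simp: strict_mono_less_eq)
      then have "card {..n} \<le> card {j. \<kappa> j \<le> \<kappa> n}" using fin by (intro card_mono)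
      then have "b \<le> \<mu> (\<kappa> n)" using n by (simp add: \<mu>_def)
      then show ?thesis by blast
    qed
  qed
  from h[OF this] obtain C \<rho> where C: "C > 0" "\<rho> > 0"
    "\<And>k t. \<bar>t\<bar> \<le> A \<Longrightarrow> \<bar>?h k t\<bar> \<le> C * \<rho> ^ k * fact k * (L k * R k)"
    unfolding CL_real_global_iff by meson
  have R_le: "R (\<kappa> j) \<le> real (Suc j) ^ \<kappa> j" for j
  proof -
    have "\<mu> i \<le> real (Suc j)" if "i < \<kappa> j" for i
    proof -
      have "{j'. \<kappa> j' \<le> i} \<subseteq> {..<j}"
      proof
        fix j' assume "j' \<in> {j'. \<kappa> j' \<le> i}"
        then have "\<kappa> j' < \<kappa> j" using that by simp
        then show "j' \<in> {..<j}" using strict by (simp add: strict_mono_less)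
      qed
      then have "card {j'. \<kappa> j' \<le> i} \<le> card {..<j}" by (intro card_mono) auto
      then show ?thesis by (simp add: \<mu>_def)
    qed
    then have "R (\<kappa> j) \<le> (\<Prod>i<\<kappa> j. real (Suc j))"
      unfolding R_def by (intro prod_mono) (auto simp: \<mu>_def)
    then show ?thesis by simp
  qed
  have bound: "2 ^ j \<le> C" if j: "2 * \<rho> \<le> real (Suc j)" for j
  proof -
    let ?k = "\<kappa> j" and ?n = "real (Suc j)"
    obtain t where t: "\<bar>t\<bar> \<le> A" "\<bar>?h ?k t\<bar> > (?n\<^sup>2) ^ ?k * fact ?k * L ?k" using viol by blast
    have "(?n\<^sup>2) ^ ?k * fact ?k * L ?k \<le> C * \<rho> ^ ?k * fact ?k * (L ?k * R ?k)"
      using t C(3)[OF t(1), of ?k] by linarith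
    also have "\<dots> \<le> C * \<rho> ^ ?k * fact ?k * (L ?k * ?n ^ ?k)"
      using R_le C L by (intro mult_left_mono) (auto intro: less_imp_le)
    finally have "(?n ^ ?k) * (?n ^ ?k * (fact ?k * L ?k)) \<le> (C * \<rho> ^ ?k) * (?n ^ ?k * (fact ?k * L ?k))"
      by (simp only: power2_eq_square power_mult_distrib mult_ac)
    moreover have "?n ^ ?k * (fact ?k * L ?k) > 0" using L by simp
    ultimately have "?n ^ ?k \<le> C * \<rho> ^ ?k" by (simp only: mult_le_cancel_right_pos)
    moreover have "(2 * \<rho>) ^ ?k \<le> ?n ^ ?k" using j C by (intro power_mono) auto
    ultimately have "2 ^ ?k * \<rho> ^ ?k \<le> C * \<rho> ^ ?k" by (simp only: power_mult_distrib)
    then have "2 ^ ?k \<le> C" using C(2) by simp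
    moreover have "(2::real) ^ j \<le> 2 ^ ?k"
      using strict_mono_imp_increasing[OF strict, of j] by (intro power_increasing) auto
    ultimately show ?thesis by linarith
  qed
  obtain n where n: "C < 2 ^ n" using real_arch_pow[of 2 C] by auto
  obtain i :: nat where i: "2 * \<rho> \<le> real i" using real_arch_simple by blast
  have "(2::real) ^ n \<le> 2 ^ max n i" by (intro power_increasing) auto
  moreover have "2 ^ max n i \<le> C" using i by (intro bound) auto
  ultimately show False using n by linarith
qed

section \<open>Localisation of curves\<close>

lemma CL_derivs_const:
  assumes L: "\<forall>k. L k > 0"
  shows "CL_derivs L I (\<lambda>k t. if k = 0 then a else 0)"
proof (rule CL_derivsI[of _ _ "\<bar>a\<bar> / L 0 + 1" 1])
  have L0: "L 0 > 0" using L by blast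
  show "derivs_on I (\<lambda>k t. if k = 0 then a else 0)"
    by (auto simp: derivs_on_def)
  show "\<bar>a\<bar> / L 0 + 1 > 0" using L0 by (simp add: add_nonneg_pos)
  have "\<bar>a\<bar> \<le> (\<bar>a\<bar> / L 0 + 1) * L 0" using L0 by (simp add: field_simps)
  moreover have "0 \<le> \<bar>a\<bar> / L 0 + 1"
    using L0 by simp
  then have "0 \<le> (\<bar>a\<bar> / L 0 + 1) * fact k * L k" for k
    using L by (intro mult_nonneg_nonneg) (auto intro: less_imp_le)
  ultimately show "\<bar>if k = 0 then a else 0\<bar> \<le> (\<bar>a\<bar> / L 0 + 1) * 1 ^ k * fact k * L k" for k
    by auto
qed simp

lemma CL_derivs_scale:
  assumes L: "\<forall>k. L k > 0" and d: "CL_derivs L I d"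
  shows "CL_derivs L I (\<lambda>k t. a * d k t)"
proof -
  obtain C \<rho> where C: "C > 0" "\<rho> > 0" "\<And>k t. t \<in> I \<Longrightarrow> \<bar>d k t\<bar> \<le> C * \<rho> ^ k * fact k * L k"
    using d by (rule CL_derivsE) blast
  show ?thesis
  proof (rule CL_derivsI[of _ _ "(\<bar>a\<bar> + 1) * C" \<rho>])
    show "derivs_on I (\<lambda>k t. a * d k t)"
      using CL_derivs_derivs_on[OF d] by (auto simp: derivs_on_def intro!: DERIV_cmult)
    show "(\<bar>a\<bar> + 1) * C > 0" using C by (simp add: add_nonneg_pos)
    fix k t assume t: "t \<in> I"
    have "\<bar>a\<bar> * \<bar>d k t\<bar> \<le> (\<bar>a\<bar> + 1) * (C * \<rho> ^ k * fact k * L k)"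
      using C(3)[OF t] by (intro mult_mono) auto
    then show "\<bar>a * d k t\<bar> \<le> (\<bar>a\<bar> + 1) * C * \<rho> ^ k * fact k * L k"
      by (simp add: abs_mult mult.assoc)
  qed (rule C)
qed

lemma CL_real_derivs_on_interval:
  assumes "g \<in> CL_real L"
  shows "CL_derivs L {s - r<..<s + r} (\<lambda>k. (deriv ^^ k) g)"
proof -
  have D: "derivs_on UNIV (\<lambda>k. (deriv ^^ k) g)"
    using assms unfolding CL_real_global_iff by blast
  obtain C \<rho> where C: "C > 0" "\<rho> > 0"
    "\<And>k t. \<bar>t\<bar> \<le> \<bar>s\<bar> + \<bar>r\<bar> \<Longrightarrow> \<bar>(deriv ^^ k) g t\<bar> \<le> C * \<rho> ^ k * fact k * L k"
    using assms unfolding CL_real_global_iff by meson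
  show ?thesis
  proof (rule CL_derivsI[OF _ C(1,2)])
    show "derivs_on {s - r<..<s + r} (\<lambda>k. (deriv ^^ k) g)"
      using D by (rule derivs_on_subset) simp
    show "\<bar>(deriv ^^ k) g t\<bar> \<le> C * \<rho> ^ k * fact k * L k" if "t \<in> {s - r<..<s + r}" for k t
      using that by (intro C(3)) auto
  qed
qed

lemma CL_realI:
  assumes L: "\<forall>k. L k > 0" and d: "CL_derivs L UNIV d" and eq: "\<And>t. d 0 t = g t"
  shows "g \<in> CL_real L"
  unfolding CL_real_local_iff[OF L] using CL_nearI[OF open_UNIV UNIV_I eq d] by blast

lemma CL_real_affine:
  assumes L: "\<forall>k. L k > 0" and g: "g \<in> CL_real L"
  shows "(\<lambda>t. a + r * g t) \<in> CL_real L"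
  unfolding CL_real_local_iff[OF L]
proof
  fix s
  let ?I = "{s - 1<..<s + 1 :: real}"
  have "CL_derivs L ?I (\<lambda>k t. (if k = 0 then a else 0) + r * (deriv ^^ k) g t)"
    by (intro CL_derivs_add CL_derivs_const CL_derivs_scale CL_real_derivs_on_interval L g)
  then show "CL_near L (\<lambda>t. a + r * g t) s"
    by (rule CL_nearI[rotated 3]) auto
qed

lemma CL_real_cutoff:
  assumes L: "\<forall>k. L k > 0" "log_convex L" and \<phi>: "CL_derivs L UNIV \<phi>"
    and supp: "\<And>k t. \<bar>t - s\<bar> \<ge> \<eta> \<Longrightarrow> \<phi> k t = 0" and \<eta>: "\<eta> < r"
    and d: "CL_derivs L {s - r<..<s + r} d" and eq: "\<And>t. \<bar>t - s\<bar> < r \<Longrightarrow> d 0 t = g t"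
  shows "(\<lambda>t. a + \<phi> 0 t * g t) \<in> CL_real L"
proof -
  let ?I = "{s - r<..<s + r}"
  let ?e = "\<lambda>k t. if t \<in> ?I then leibniz \<phi> d k t else 0"
  have "CL_derivs L ?I (leibniz \<phi> d)"
    using CL_derivs_subset[OF \<phi>] d by (intro CL_derivs_leibniz[OF L]) auto
  then have "CL_derivs L UNIV ?e"
  proof (rule CL_derivs_zero_extension[OF L(1)])
    show "closed {s - \<eta>..s + \<eta>}" "{s - \<eta>..s + \<eta>} \<subseteq> ?I" using \<eta> by auto
    fix k t assume "t \<notin> {s - \<eta>..s + \<eta>}"
    then have "\<phi> j t = 0" for j by (intro supp) auto
    then show "leibniz \<phi> d k t = 0" by (simp add: leibniz_def)
  qed simp
  then have "CL_derivs L UNIV (\<lambda>k t. (if k = 0 then a else 0) + ?e k t)"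
    by (intro CL_derivs_add CL_derivs_const L)
  then show ?thesis
  proof (rule CL_realI[OF L(1)])
    fix t
    have "?e 0 t = \<phi> 0 t * g t"
    proof (cases "t \<in> ?I")
      case True
      then have "d 0 t = g t" by (intro eq) auto
      then show ?thesis using True by simp
    next
      case False
      then have "\<phi> 0 t = 0" using \<eta> by (intro supp) auto
      then show ?thesis using False by simp
    qed
    then show "(if (0::nat) = 0 then a else 0) + ?e 0 t = a + \<phi> 0 t * g t" by simp
  qed
qed

lemma smooth_curve_eventually_in_open:
  assumes T: "convenient T" and c: "scalarwise_smooth T c" and W: "openin T W" "c s \<in> W"
  obtains \<delta> where "\<delta> > 0" "\<And>t. \<bar>t - s\<bar> < \<delta> \<Longrightarrow> c t \<in> W"
proof -
  have lcs: "locally_convex_space T" and E: "subspace (topspace T)"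
    using T by (auto simp: convenient_lcs convenient_subspace)
  have cE: "c t \<in> topspace T" for t using c by (auto simp: scalarwise_smooth_def)
  let ?U = "{y \<in> topspace T. 1 *\<^sub>R y + c s \<in> W}"
  have U: "openin T ?U" "0 \<in> ?U"
    using lcs_open_preimage_affine[OF lcs cE W(1)] W(2) subspace_0[OF E] by (blast, simp)
  obtain \<delta> where \<delta>: "\<delta> > 0" "\<And>r a. a \<in> {(1 / (t - s)) *\<^sub>R (c t - c s) | t. \<bar>t - s\<bar> \<le> 1} \<Longrightarrow> \<bar>r\<bar> < \<delta> \<Longrightarrow> r *\<^sub>R a \<in> ?U"
    by (rule weakly_bounded_absorbed[OF lcs weakly_bounded_quotients[OF T c] U]) (rule that)
  show ?thesis
  proof (rule that[of "min \<delta> 1"])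
    fix t assume t: "\<bar>t - s\<bar> < min \<delta> 1"
    have "(t - s) *\<^sub>R ((1 / (t - s)) *\<^sub>R (c t - c s)) \<in> ?U"
      by (rule \<delta>(2)) (use t in auto)
    then show "c t \<in> W" using W(2) by (cases "t = s") auto
  qed (use \<delta>(1) in simp)
qed

lemma openin_imp_cinf_open:
  assumes T: "convenient T" and W: "openin T W"
  shows "openin (cinf_topology T) W"
  unfolding openin_cinf_topology
proof (intro conjI allI impI)
  show "W \<subseteq> topspace T" using W by (rule openin_subset)
  fix c assume "smooth_curve T c"
  then have c: "scalarwise_smooth T c" by (simp add: smooth_curve_iff_scalarwise[OF T])
  show "open {t. c t \<in> W}"
    unfolding open_dist
  proof (intro ballI)
    fix s assume "s \<in> {t. c t \<in> W}"
    then have "c s \<in> W" by simp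
    then obtain \<delta> where "\<delta> > 0" "\<And>t. \<bar>t - s\<bar> < \<delta> \<Longrightarrow> c t \<in> W"
      by (rule smooth_curve_eventually_in_open[OF T c W]) (rule that)
    then show "\<exists>e>0. \<forall>t. dist t s < e \<longrightarrow> t \<in> {t. c t \<in> W}"
      by (intro exI[of _ \<delta>]) (simp add: dist_real_def)
  qed
qed

lemma CL_curve_scalarwise_smooth:
  assumes "CL_curve L T U c" "U \<subseteq> topspace T"
  shows "scalarwise_smooth T c"
  using assms unfolding CL_curve_def scalarwise_smooth_def CL_real_global_iff by blast

text \<open>Because Banach spaces have convex neighbourhoods in their \<open>c\<^sup>\<infinity>\<close>-topology, a curve can be localised by
  contracting it to the point \<open>\<gamma> s\<close> away from \<open>s\<close>.\<close>

lemma localize_CL_curve: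
  assumes V: "banach_on V N" and L: "\<forall>k. L k > 0" "log_convex L" "\<not> quasianalytic L"
    and \<gamma>: "CL_curve L (norm_topology V N) V \<gamma>"
    and W: "openin (cinf_topology (norm_topology V N)) W" "\<gamma> s \<in> W"
  obtains \<delta> where "CL_curve L (norm_topology V N) W \<delta>" "eventually (\<lambda>t. \<delta> t = \<gamma> t) (nhds s)"
proof -
  let ?T = "norm_topology V N"
  have N: "normed_on V N" using V by (simp add: banach_on_def)
  have sub: "subspace V" and top: "topspace ?T = V"
    using N by (auto simp: normed_subspace topspace_norm_topology)
  have T: "convenient ?T" using V by (rule convenient_norm_topology)
  have \<gamma>V: "\<gamma> t \<in> V" for t using \<gamma> by (auto simp: CL_curve_def)
  obtain \<epsilon> where \<epsilon>: "\<epsilon> > 0" "\<And>y. y \<in> V \<Longrightarrow> N (y - \<gamma> s) < \<epsilon> \<Longrightarrow> y \<in> W"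
    by (rule cinf_open_contains_norm_ball[OF V L W]) (rule that)
  have "scalarwise_smooth ?T \<gamma>"
    using \<gamma> by (rule CL_curve_scalarwise_smooth) (simp add: top)
  moreover have "\<gamma> s \<in> {y \<in> V. N (y - \<gamma> s) < \<epsilon>}"
    using \<gamma>V \<epsilon>(1) normed_zero[OF N, of 0] subspace_0[OF sub] by simp
  ultimately obtain \<eta>0 where \<eta>0: "\<eta>0 > 0" "\<And>t. \<bar>t - s\<bar> < \<eta>0 \<Longrightarrow> \<gamma> t \<in> {y \<in> V. N (y - \<gamma> s) < \<epsilon>}"
    by (rule smooth_curve_eventually_in_open[OF T _ openin_norm_ball[OF N \<gamma>V]]) (rule that)
  define \<eta> where "\<eta> = min \<eta>0 1 / 2"
  have \<eta>: "\<eta> > 0" "\<eta> < \<eta>0" "\<eta> < 1" using \<eta>0(1) by (auto simp: \<eta>_def)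
  obtain \<phi> where \<phi>: "CL_derivs L UNIV \<phi>" "\<And>t. 0 \<le> \<phi> 0 t" "\<And>t. \<phi> 0 t \<le> 1"
    "\<And>t. \<bar>t - s\<bar> \<le> \<eta> / 2 \<Longrightarrow> \<phi> 0 t = 1" "\<And>k t. \<bar>t - s\<bar> \<ge> \<eta> \<Longrightarrow> \<phi> k t = 0"
    by (rule ex_CL_cutoff[OF L \<eta>(1), of s]) (rule that)
  define \<delta> where "\<delta> = (\<lambda>t. \<gamma> s + \<phi> 0 t *\<^sub>R (\<gamma> t - \<gamma> s))"
  have diffV: "\<gamma> t - \<gamma> s \<in> V" for t using \<gamma>V sub by (simp add: subspace_diff)
  have \<delta>V: "\<delta> t \<in> V" for t
    unfolding \<delta>_def using \<gamma>V diffV sub by (intro subspace_add subspace_scale)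
  have "\<delta> t \<in> W" for t
  proof (rule \<epsilon>(2)[OF \<delta>V])
    have eq: "N (\<delta> t - \<gamma> s) = \<phi> 0 t * N (\<gamma> t - \<gamma> s)"
      using normed_scale[OF N diffV, of "\<phi> 0 t"] \<phi>(2)[of t] by (simp add: \<delta>_def)
    show "N (\<delta> t - \<gamma> s) < \<epsilon>"
    proof (cases "\<bar>t - s\<bar> < \<eta>")
      case True
      then have "N (\<gamma> t - \<gamma> s) < \<epsilon>" using \<eta>0(2)[of t] \<eta> by simp
      moreover have "\<phi> 0 t * N (\<gamma> t - \<gamma> s) \<le> 1 * N (\<gamma> t - \<gamma> s)"
        using \<phi>(3) normed_nonneg[OF N] by (intro mult_right_mono) auto
      ultimately show ?thesis using eq by simp
    next
      case False
      then show ?thesis using eq \<phi>(5)[of t 0] \<epsilon>(1) by simp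
    qed
  qed
  moreover have "m \<circ> \<delta> \<in> CL_real L" if m: "m \<in> continuous_dual ?T" for m
  proof -
    have "m (\<delta> t) = m (\<gamma> s) + \<phi> 0 t * (- m (\<gamma> s) + 1 * m (\<gamma> t))" for t
      unfolding \<delta>_def
      using dual_add[OF m, of "\<gamma> s" "\<phi> 0 t *\<^sub>R (\<gamma> t - \<gamma> s)"] dual_scale[OF m, of "\<gamma> t - \<gamma> s" "\<phi> 0 t"]
        dual_diff[OF convenient_lcs[OF T] m, of "\<gamma> t" "\<gamma> s"] \<gamma>V diffV subspace_scale[OF sub diffV]
      by (simp add: top)
    then have "m \<circ> \<delta> = (\<lambda>t. m (\<gamma> s) + \<phi> 0 t * (- m (\<gamma> s) + 1 * (m \<circ> \<gamma>) t))"
      by (auto simp: fun_eq_iff)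
    moreover have "m \<circ> \<gamma> \<in> CL_real L" using \<gamma> m by (simp add: CL_curve_def)
    then have "(\<lambda>t. - m (\<gamma> s) + 1 * (m \<circ> \<gamma>) t) \<in> CL_real L" by (rule CL_real_affine[OF L(1)])
    then have "(\<lambda>t. m (\<gamma> s) + \<phi> 0 t * (- m (\<gamma> s) + 1 * (m \<circ> \<gamma>) t)) \<in> CL_real L"
      by (intro CL_real_cutoff[OF L(1,2) \<phi>(1,5) \<eta>(3) CL_real_derivs_on_interval]) auto
    ultimately show ?thesis by simp
  qed
  ultimately have "CL_curve L ?T W \<delta>" by (auto simp: CL_curve_def)
  moreover have "\<delta> t = \<gamma> t" if "dist t s < \<eta> / 2" for t
    using that \<phi>(4)[of t] by (simp add: \<delta>_def dist_real_def)
  then have "eventually (\<lambda>t. \<delta> t = \<gamma> t) (nhds s)"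
    unfolding eventually_nhds_metric using \<eta>(1) by (intro exI[of _ "\<eta> / 2"]) auto
  ultimately show ?thesis by (rule that)
qed

lemma nq_majorantsD:
  assumes "weight_sequence Q" "L \<in> nq_majorants Q"
  shows "\<forall>k. L k > 0" "log_convex L" "\<not> quasianalytic L"
proof -
  have "Q k > 0" "Q k \<le> L k" for k
    using assms by (auto simp: weight_sequence_def nq_majorants_def)
  then show "\<forall>k. L k > 0" by (meson less_le_trans)
qed (use assms in \<open>auto simp: nq_majorants_def\<close>)

text \<open>An empty intersection would make \<open>\<F>\<^sup>Q\<close> the space of all sequences, but it does not contain \<open>k! k! Q\<^sub>k\<close>.\<close>

lemma nq_majorants_nonempty:
  assumes Q: "weight_sequence Q" and I: "L_intersectable Q"
  obtains L where "L \<in> nq_majorants Q"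
proof (rule ccontr)
  assume "\<not> thesis"
  then have "nq_majorants Q = {}" using that by blast
  then have univ: "formal_class Q = UNIV" using I by (simp add: L_intersectable_def)
  have Qpos: "Q k > 0" for k using Q by (simp add: weight_sequence_def)
  have "(\<lambda>k. fact k * (fact k * Q k)) \<in> formal_class Q" using univ by simp
  then obtain C \<rho> where C: "C > 0" "\<rho> > 0" "\<And>k. \<bar>fact k * (fact k * Q k)\<bar> \<le> C * \<rho> ^ k * fact k * Q k"
    unfolding formal_class_def by blast
  have "fact k \<le> C * \<rho> ^ k" for k
  proof -
    have pos: "fact k * Q k > 0" using Qpos by simp
    have "fact k * (fact k * Q k) \<le> (C * \<rho> ^ k) * (fact k * Q k)"
      using C(3)[of k] Qpos[of k] by (simp add: mult.assoc)
    then show ?thesis using pos by (simp only: mult_le_cancel_right_pos)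
  qed
  then have "1 / C \<le> \<rho> ^ k / fact k" for k using C(1) by (simp add: field_simps)
  moreover have "(\<lambda>k. \<rho> ^ k / fact k) \<longlonglongrightarrow> 0"
    using summable_LIMSEQ_zero[OF summable_exp[of \<rho>]] by (simp add: field_simps)
  ultimately have "1 / C \<le> 0" by (intro LIMSEQ_le_const) auto
  then show False using C(1) by simp
qed

lemma nq_majorants_superexponential:
  assumes Q: "weight_sequence Q" and L: "L \<in> nq_majorants Q" and R: "superexponential R"
  shows "(\<lambda>k. L k * R k) \<in> nq_majorants Q"
proof -
  note L' = nq_majorantsD[OF Q L]
  have R1: "1 \<le> R k" for k using R by (simp add: superexponential_def)
  have le: "L k \<le> L k * R k" for k
    using mult_left_mono[OF R1, of "L k" k] L'(1) by (simp add: less_imp_le)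
  have "log_convex (\<lambda>k. L k * R k)"
    unfolding log_convex_def
  proof (intro allI impI)
    fix k :: nat assume k: "1 \<le> k"
    have "(L k)\<^sup>2 \<le> L (k - 1) * L (k + 1)" "(R k)\<^sup>2 \<le> R (k - 1) * R (k + 1)"
      using L'(2) R k by (auto simp: superexponential_def log_convex_def)
    then have "(L k)\<^sup>2 * (R k)\<^sup>2 \<le> (L (k - 1) * L (k + 1)) * (R (k - 1) * R (k + 1))"
      using L'(1) by (intro mult_mono) (auto intro: less_imp_le mult_nonneg_nonneg)
    then show "(L k * R k)\<^sup>2 \<le> L (k - 1) * R (k - 1) * (L (k + 1) * R (k + 1))"
      by (simp add: power_mult_distrib mult_ac)
  qed
  moreover have "\<not> quasianalytic (\<lambda>k. L k * R k)"
  proof -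
    have "CM L n U \<subseteq> CM (\<lambda>k. L k * R k) n U" for n U
    proof
      fix g assume g: "g \<in> CM L n U"
      have "\<exists>C>0. \<exists>\<rho>>0. \<forall>\<alpha>. \<forall>x\<in>K. \<bar>mi_deriv n \<alpha> g x\<bar> \<le> C * \<rho> ^ mi_abs n \<alpha> * fact (mi_abs n \<alpha>) * (L (mi_abs n \<alpha>) * R (mi_abs n \<alpha>))"
        if K: "compactin (Euclidean_space n) K \<and> K \<subseteq> U" for K
      proof -
        obtain C \<rho> where C: "C > 0" "\<rho> > 0"
          "\<And>\<alpha> x. x \<in> K \<Longrightarrow> \<bar>mi_deriv n \<alpha> g x\<bar> \<le> C * \<rho> ^ mi_abs n \<alpha> * fact (mi_abs n \<alpha>) * L (mi_abs n \<alpha>)"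
          using g K unfolding CM_def by blast
        have "C * \<rho> ^ k * fact k * L k \<le> C * \<rho> ^ k * fact k * (L k * R k)" for k
          using C le by (intro mult_left_mono) auto
        then have "\<forall>\<alpha>. \<forall>x\<in>K. \<bar>mi_deriv n \<alpha> g x\<bar> \<le> C * \<rho> ^ mi_abs n \<alpha> * fact (mi_abs n \<alpha>) * (L (mi_abs n \<alpha>) * R (mi_abs n \<alpha>))"
          using C(3) order_trans by blast
        then show ?thesis using C(1,2) by blast
      qed
      then show "g \<in> CM (\<lambda>k. L k * R k) n U" using g by (simp add: CM_def)
    qed
    then show ?thesis using L'(3) unfolding quasianalytic_def by (meson subsetD)
  qed
  moreover have "Q k \<le> L k * R k" for k
    using L le[of k] by (auto simp: nq_majorants_def intro: order_trans)
  ultimately show ?thesis by (simp add: nq_majorants_def)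
qed

section \<open>Manifolds and plots\<close>

lemma CQ_map_cong:
  assumes "\<And>x. x \<in> U \<Longrightarrow> f x = g x"
  shows "CQ_map Q T U S f \<longleftrightarrow> CQ_map Q T U S g"
proof -
  have "f ` U = g ` U" using assms by auto
  moreover have "f \<circ> c = g \<circ> c" if "CL_curve L T U c" for L c
    using that assms by (auto simp: CL_curve_def fun_eq_iff)
  ultimately show ?thesis
    unfolding CQ_map_def CL_map_def by metis
qed

lemma CQ_mapD:
  assumes "CQ_map Q T U S f" "L \<in> nq_majorants Q" "CL_curve L T U c"
  shows "CL_curve L S (topspace S) (f \<circ> c)"
  using assms by (auto simp: CQ_map_def CL_map_def)

lemma CQ_mapI:
  assumes "f ` U \<subseteq> topspace S"
    and "\<And>L c l. L \<in> nq_majorants Q \<Longrightarrow> CL_curve L T U c \<Longrightarrow> l \<in> continuous_dual S \<Longrightarrow> l \<circ> (f \<circ> c) \<in> CL_real L"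
  shows "CQ_map Q T U S f"
  using assms unfolding CQ_map_def CL_map_def CL_curve_def by fastforce

lemma manifold_chart:
  assumes X: "CQ_manifold Q X" and u: "u \<in> atlas X"
  shows chart_dom_points: "chart_dom u \<subseteq> points X"
    and chart_convenient: "convenient (chart_model u)"
    and chart_inj: "inj_on (chart_fun u) (chart_dom u)"
    and chart_range_open: "openin (cinf_topology (chart_model u)) (chart_range u)"
    and chart_range_topspace: "chart_range u \<subseteq> topspace (chart_model u)"
  using X u by (auto simp: CQ_manifold_def is_chart_on_def openin_cinf_topology)

lemma chart_inv_chart_fun:
  assumes "CQ_manifold Q X" "u \<in> atlas X" "x \<in> chart_dom u"
  shows "chart_inv u (chart_fun u x) = x"
  using chart_inj[OF assms(1,2)] assms(3) by (simp add: chart_inv_def inv_into_f_f)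

lemma chart_fun_chart_inv:
  assumes "y \<in> chart_range u"
  shows "chart_inv u y \<in> chart_dom u" "chart_fun u (chart_inv u y) = y"
  using assms unfolding chart_inv_def chart_range_def by (simp_all add: inv_into_into f_inv_into_f)

lemma chart_image_iff:
  assumes X: "CQ_manifold Q X" "u \<in> atlas X"
  shows "y \<in> chart_fun u ` (A \<inter> chart_dom u) \<longleftrightarrow> y \<in> chart_range u \<and> chart_inv u y \<in> A"
proof
  assume "y \<in> chart_fun u ` (A \<inter> chart_dom u)"
  then obtain x where "y = chart_fun u x" "x \<in> A" "x \<in> chart_dom u" by blast
  then show "y \<in> chart_range u \<and> chart_inv u y \<in> A"
    using chart_inv_chart_fun[OF X] by (auto simp: chart_range_def)
next
  assume "y \<in> chart_range u \<and> chart_inv u y \<in> A"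
  then show "y \<in> chart_fun u ` (A \<inter> chart_dom u)"
    using chart_fun_chart_inv[of y u] by (metis IntI image_eqI)
qed

lemma chart_change:
  assumes X: "CQ_manifold Q X" and u: "u \<in> atlas X" and v: "v \<in> atlas X"
  shows "openin (cinf_topology (chart_model u)) (chart_fun u ` (chart_dom u \<inter> chart_dom v))"
    and "CQ_map Q (chart_model u) (chart_fun u ` (chart_dom u \<inter> chart_dom v)) (chart_model v) (chart_fun v \<circ> chart_inv u)"
  using X u v unfolding CQ_manifold_def Let_def by blast+

lemma openin_manifold_topology:
  assumes X: "CQ_manifold Q X"
  shows "openin (manifold_topology X) W \<longleftrightarrow>
    W \<subseteq> points X \<and> (\<forall>u\<in>atlas X. openin (cinf_topology (chart_model u)) (chart_fun u ` (W \<inter> chart_dom u)))"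
proof -
  have "openin (subtopology (cinf_topology (chart_model u)) (chart_range u))
      {s \<in> topspace (subtopology (cinf_topology (chart_model u)) (chart_range u)). chart_inv u s \<in> W} \<longleftrightarrow>
    openin (cinf_topology (chart_model u)) (chart_fun u ` (W \<inter> chart_dom u))" if u: "u \<in> atlas X" for u
  proof -
    have ran: "openin (cinf_topology (chart_model u)) (chart_range u)"
      by (rule chart_range_open[OF X u])
    then have "topspace (subtopology (cinf_topology (chart_model u)) (chart_range u)) = chart_range u"
      by (rule topspace_subtopology_subset[OF openin_subset])
    then have "{s \<in> topspace (subtopology (cinf_topology (chart_model u)) (chart_range u)). chart_inv u s \<in> W} =
        chart_fun u ` (W \<inter> chart_dom u)"
      using chart_image_iff[OF X u] by blast
    moreover have "chart_fun u ` (W \<inter> chart_dom u) \<subseteq> chart_range u"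
      by (auto simp: chart_range_def)
    ultimately show ?thesis
      by (simp add: openin_open_subtopology[OF ran])
  qed
  then show ?thesis
    unfolding manifold_topology_def openin_final_topology by blast
qed

lemma topspace_manifold_topology:
  assumes X: "CQ_manifold Q X"
  shows "topspace (manifold_topology X) = points X"
proof
  have "openin (manifold_topology X) (points X)"
    unfolding openin_manifold_topology[OF X]
  proof (intro conjI ballI)
    fix u assume u: "u \<in> atlas X"
    have "chart_fun u ` (points X \<inter> chart_dom u) = chart_range u"
      using chart_dom_points[OF X u] by (auto simp: chart_range_def)
    then show "openin (cinf_topology (chart_model u)) (chart_fun u ` (points X \<inter> chart_dom u))"
      using chart_range_open[OF X u] by simp
  qed simp
  then show "points X \<subseteq> topspace (manifold_topology X)" by (rule openin_subset)
  show "topspace (manifold_topology X) \<subseteq> points X"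
    using openin_topspace[of "manifold_topology X"] unfolding openin_manifold_topology[OF X] by blast
qed

lemma openin_chart_dom:
  assumes X: "CQ_manifold Q X" and v: "v \<in> atlas X"
  shows "openin (manifold_topology X) (chart_dom v)"
  unfolding openin_manifold_topology[OF X]
  using chart_dom_points[OF X v] chart_change(1)[OF X _ v] by (auto simp: Int_commute)

lemma manifold_covered:
  assumes "CQ_manifold Q X" "x \<in> points X"
  obtains u where "u \<in> atlas X" "x \<in> chart_dom u"
  using assms unfolding CQ_manifold_def by blast

subsection \<open>The unit ball of a Banach space\<close>

definition unit_ball :: "'b::real_vector set \<Rightarrow> ('b \<Rightarrow> real) \<Rightarrow> 'b set" where
  "unit_ball V N = {x \<in> V. N x < 1}"

lemma openin_unit_ball_manifold:
  assumes N: "normed_on V N"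
  shows "openin (manifold_topology (unit_ball_manifold V N)) W \<longleftrightarrow>
    W \<subseteq> unit_ball V N \<and> (\<exists>P. openin (cinf_topology (norm_topology V N)) P \<and> W = unit_ball V N \<inter> P)"
proof -
  let ?D = "unit_ball V N" and ?c = "cinf_topology (norm_topology V N)"
  let ?u = "\<lparr>chart_model = norm_topology V N, chart_dom = ?D, chart_fun = (\<lambda>x. x)\<rparr>"
  have man: "unit_ball_manifold V N = \<lparr>points = ?D, atlas = {?u}\<rparr>"
    by (simp add: unit_ball_manifold_def unit_ball_def Let_def)
  have inv: "chart_inv ?u s = s" if "s \<in> ?D" for s
    using f_inv_into_f[of s "\<lambda>x. x" ?D] that by (simp add: chart_inv_def)
  have ran: "chart_range ?u = ?D" by (simp add: chart_range_def)
  have "?D \<subseteq> topspace (norm_topology V N)"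
    using topspace_norm_topology[OF N] by (auto simp: unit_ball_def)
  moreover have "openin ?c (topspace (norm_topology V N))"
  proof -
    have "c t \<in> topspace (norm_topology V N)" if "smooth_curve (norm_topology V N) c" for c t
      using that unfolding smooth_curve_def by metis
    then show ?thesis by (simp add: openin_cinf_topology)
  qed
  ultimately have "?D \<subseteq> topspace ?c" using openin_subset by blast
  then have top: "topspace (subtopology ?c ?D) = ?D" by (rule topspace_subtopology_subset)
  have "openin (manifold_topology (unit_ball_manifold V N)) W \<longleftrightarrow>
    W \<subseteq> ?D \<and> openin (subtopology ?c ?D) {s \<in> ?D. chart_inv ?u s \<in> W}"
    unfolding manifold_topology_def openin_final_topology man by (simp add: ran top del: topspace_subtopology)
  also have "{s \<in> ?D. chart_inv ?u s \<in> W} = ?D \<inter> W" using inv by auto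
  finally show ?thesis
    unfolding openin_subtopology by (metis Int_absorb1 Int_commute)
qed

lemma topspace_unit_ball_manifold:
  assumes N: "normed_on V N"
  shows "topspace (manifold_topology (unit_ball_manifold V N)) = unit_ball V N"
proof
  have "c t \<in> V" if "smooth_curve (norm_topology V N) c" for c t
    using that topspace_norm_topology[OF N] unfolding smooth_curve_def by metis
  then have "openin (cinf_topology (norm_topology V N)) V"
    by (simp add: openin_cinf_topology topspace_norm_topology[OF N])
  then have "openin (manifold_topology (unit_ball_manifold V N)) (unit_ball V N)"
    unfolding openin_unit_ball_manifold[OF N] by (intro conjI exI[of _ V]) (auto simp: unit_ball_def)
  then show "unit_ball V N \<subseteq> topspace (manifold_topology (unit_ball_manifold V N))" by (rule openin_subset)
  show "topspace (manifold_topology (unit_ball_manifold V N)) \<subseteq> unit_ball V N"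
    using openin_topspace[of "manifold_topology (unit_ball_manifold V N)"]
    unfolding openin_unit_ball_manifold[OF N] by blast
qed

lemma CQ_plot_iff:
  fixes X :: "('x, 'e::real_vector) manifold"
  shows "CQ_plot Q V N X c \<longleftrightarrow> banach_on V N \<and> c ` unit_ball V N \<subseteq> points X \<and>
     continuous_map (manifold_topology (unit_ball_manifold V N)) (manifold_topology X) c \<and>
     (\<forall>v\<in>atlas X. CQ_map Q (norm_topology V N) {z \<in> unit_ball V N. c z \<in> chart_dom v}
        (chart_model v) (chart_fun v \<circ> c))"
proof -
  let ?D = "unit_ball V N"
  let ?u = "\<lparr>chart_model = norm_topology V N, chart_dom = ?D, chart_fun = (\<lambda>x. x)\<rparr>"
  have man: "points (unit_ball_manifold V N) = ?D" "atlas (unit_ball_manifold V N) = {?u}"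
    by (simp_all add: unit_ball_manifold_def unit_ball_def Let_def)
  have "CQ_map Q (norm_topology V N) (?D \<inter> c -` chart_dom v) (chart_model v) (chart_fun v \<circ> c \<circ> chart_inv ?u) \<longleftrightarrow>
    CQ_map Q (norm_topology V N) {z \<in> ?D. c z \<in> chart_dom v} (chart_model v) (chart_fun v \<circ> c)" for v :: "('x, 'e) chart"
  proof -
    have "?D \<inter> c -` chart_dom v = {z \<in> ?D. c z \<in> chart_dom v}" by auto
    moreover have "chart_inv ?u s = s" if "s \<in> ?D" for s
      using f_inv_into_f[of s "\<lambda>x. x" ?D] that by (simp add: chart_inv_def)
    ultimately show ?thesis by (simp only:) (rule CQ_map_cong, simp)
  qed
  then show ?thesis
    unfolding CQ_plot_def CQ_manifold_map_def man by simp
qed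

lemma continuous_map_unit_ball_preimage:
  assumes N: "normed_on V N"
    and c: "continuous_map (manifold_topology (unit_ball_manifold V N)) Z c" and W: "openin Z W"
  obtains P where "openin (cinf_topology (norm_topology V N)) P"
    "{z \<in> unit_ball V N. c z \<in> W} = unit_ball V N \<inter> P"
  using openin_continuous_map_preimage[OF c W]
  unfolding topspace_unit_ball_manifold[OF N] openin_unit_ball_manifold[OF N] by blast

lemma cinf_open_unit_ball:
  assumes V: "banach_on V N"
  shows "openin (cinf_topology (norm_topology V N)) (unit_ball V N)"
proof (rule openin_imp_cinf_open[OF convenient_norm_topology[OF V]])
  have N: "normed_on V N" using V by (simp add: banach_on_def)
  have "{y \<in> V. N (y - 0) < 1} = unit_ball V N" by (simp add: unit_ball_def)
  then show "openin (norm_topology V N) (unit_ball V N)"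
    using openin_norm_ball[OF N subspace_0[OF normed_subspace[OF N]], of 1] by simp
qed

subsection \<open>Mappings of class \<open>C\<^sup>Q\<close> preserve plots\<close>

text \<open>Near each parameter a \<open>C\<^sup>L\<close>-curve in the ball agrees with a \<open>C\<^sup>L\<close>-curve whose image under the plot stays
  in one chart of \<open>X\<close>.\<close>

lemma CQ_manifold_map_imp_plot:
  assumes Q: "weight_sequence Q" and X: "CQ_manifold Q X" and Y: "CQ_manifold Q Y"
    and f: "CQ_manifold_map Q X Y f" and c: "CQ_plot Q V N X c"
  shows "CQ_plot Q V N Y (f \<circ> c)"
proof -
  let ?D = "unit_ball V N" and ?T = "norm_topology V N"
  have V: "banach_on V N" and cX: "c ` ?D \<subseteq> points X"
    and c_cont: "continuous_map (manifold_topology (unit_ball_manifold V N)) (manifold_topology X) c"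
    and c_chart: "\<And>u. u \<in> atlas X \<Longrightarrow> CQ_map Q ?T {z \<in> ?D. c z \<in> chart_dom u} (chart_model u) (chart_fun u \<circ> c)"
    using c unfolding CQ_plot_iff by blast+
  have fX: "f ` points X \<subseteq> points Y"
    and f_cont: "continuous_map (manifold_topology X) (manifold_topology Y) f"
    and f_chart: "\<And>u v. u \<in> atlas X \<Longrightarrow> v \<in> atlas Y \<Longrightarrow>
        CQ_map Q (chart_model u) (chart_fun u ` (chart_dom u \<inter> f -` chart_dom v)) (chart_model v) (chart_fun v \<circ> f \<circ> chart_inv u)"
    using f unfolding CQ_manifold_map_def by blast+
  have N: "normed_on V N" using V by (simp add: banach_on_def)
  have "CQ_map Q ?T {z \<in> ?D. (f \<circ> c) z \<in> chart_dom v} (chart_model v) (chart_fun v \<circ> (f \<circ> c))"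
    if v: "v \<in> atlas Y" for v
  proof (rule CQ_mapI)
    show "(chart_fun v \<circ> (f \<circ> c)) ` {z \<in> ?D. (f \<circ> c) z \<in> chart_dom v} \<subseteq> topspace (chart_model v)"
      using chart_range_topspace[OF Y v] by (auto simp: chart_range_def)
    fix L \<gamma> l
    assume L: "L \<in> nq_majorants Q" and \<gamma>: "CL_curve L ?T {z \<in> ?D. (f \<circ> c) z \<in> chart_dom v} \<gamma>"
      and l: "l \<in> continuous_dual (chart_model v)"
    note L' = nq_majorantsD[OF Q L]
    show "l \<circ> (chart_fun v \<circ> (f \<circ> c) \<circ> \<gamma>) \<in> CL_real L"
    proof (rule CL_real_cong_local[OF L'(1)])
      fix s
      have \<gamma>s: "\<gamma> s \<in> ?D" "f (c (\<gamma> s)) \<in> chart_dom v" using \<gamma> by (auto simp: CL_curve_def)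
      then have "c (\<gamma> s) \<in> points X" using cX by blast
      then obtain u where u: "u \<in> atlas X" "c (\<gamma> s) \<in> chart_dom u" by (rule manifold_covered[OF X])
      have "openin (manifold_topology X) {x \<in> topspace (manifold_topology X). f x \<in> chart_dom v}"
        by (rule openin_continuous_map_preimage[OF f_cont openin_chart_dom[OF Y v]])
      then have "openin (manifold_topology X) (chart_dom u \<inter> {x \<in> topspace (manifold_topology X). f x \<in> chart_dom v})"
        by (rule openin_Int[OF openin_chart_dom[OF X u(1)]])
      moreover have "chart_dom u \<subseteq> topspace (manifold_topology X)"
        using chart_dom_points[OF X u(1)] by (simp add: topspace_manifold_topology[OF X])
      then have "chart_dom u \<inter> {x \<in> topspace (manifold_topology X). f x \<in> chart_dom v} = chart_dom u \<inter> f -` chart_dom v"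
        by blast
      ultimately have "openin (manifold_topology X) (chart_dom u \<inter> f -` chart_dom v)" by simp
      then obtain P where P: "openin (cinf_topology ?T) P"
        "{z \<in> ?D. c z \<in> chart_dom u \<inter> f -` chart_dom v} = ?D \<inter> P"
        by (rule continuous_map_unit_ball_preimage[OF N c_cont]) (rule that)
      have op: "openin (cinf_topology ?T) (?D \<inter> P)"
        using cinf_open_unit_ball[OF V] P(1) by (rule openin_Int)
      have in_P: "z \<in> ?D \<inter> P \<longleftrightarrow> z \<in> ?D \<and> c z \<in> chart_dom u \<and> f (c z) \<in> chart_dom v" for z
        unfolding P(2)[symmetric] by blast
      have "CL_curve L ?T V \<gamma>" using \<gamma> by (auto simp: CL_curve_def unit_ball_def)
      moreover have "\<gamma> s \<in> ?D \<inter> P" unfolding in_P using \<gamma>s u by blast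
      ultimately obtain \<delta> where \<delta>: "CL_curve L ?T (?D \<inter> P) \<delta>" "eventually (\<lambda>t. \<delta> t = \<gamma> t) (nhds s)"
        by (rule localize_CL_curve[OF V L' _ op]) (rule that)
      have \<delta>P: "\<delta> t \<in> ?D \<and> c (\<delta> t) \<in> chart_dom u \<and> f (c (\<delta> t)) \<in> chart_dom v" for t
        using \<delta>(1) in_P unfolding CL_curve_def by blast
      have "CL_curve L ?T {z \<in> ?D. c z \<in> chart_dom u} \<delta>"
        using \<delta>(1) \<delta>P by (auto simp: CL_curve_def)
      then have "CL_curve L (chart_model u) (topspace (chart_model u)) (chart_fun u \<circ> c \<circ> \<delta>)"
        by (rule CQ_mapD[OF c_chart[OF u(1)] L])
      then have "CL_curve L (chart_model u) (chart_fun u ` (chart_dom u \<inter> f -` chart_dom v)) (chart_fun u \<circ> c \<circ> \<delta>)"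
        using \<delta>P by (auto simp: CL_curve_def)
      then have "CL_curve L (chart_model v) (topspace (chart_model v)) (chart_fun v \<circ> f \<circ> chart_inv u \<circ> (chart_fun u \<circ> c \<circ> \<delta>))"
        by (rule CQ_mapD[OF f_chart[OF u(1) v] L])
      then have "l \<circ> (chart_fun v \<circ> f \<circ> chart_inv u \<circ> (chart_fun u \<circ> c \<circ> \<delta>)) \<in> CL_real L"
        using l by (simp add: CL_curve_def)
      moreover have "chart_inv u (chart_fun u (c (\<delta> t))) = c (\<delta> t)" for t
        using \<delta>P by (intro chart_inv_chart_fun[OF X u(1)]) blast
      then have "l \<circ> (chart_fun v \<circ> f \<circ> chart_inv u \<circ> (chart_fun u \<circ> c \<circ> \<delta>)) = l \<circ> (chart_fun v \<circ> (f \<circ> c) \<circ> \<delta>)"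
        by (simp add: fun_eq_iff)
      ultimately have "l \<circ> (chart_fun v \<circ> (f \<circ> c) \<circ> \<delta>) \<in> CL_real L" by simp
      moreover have "eventually (\<lambda>t. (l \<circ> (chart_fun v \<circ> (f \<circ> c) \<circ> \<gamma>)) t = (l \<circ> (chart_fun v \<circ> (f \<circ> c) \<circ> \<delta>)) t) (nhds s)"
        using \<delta>(2) by eventually_elim simp
      ultimately show "\<exists>g\<in>CL_real L. eventually (\<lambda>t. (l \<circ> (chart_fun v \<circ> (f \<circ> c) \<circ> \<gamma>)) t = g t) (nhds s)"
        by blast
    qed
  qed
  moreover have "(f \<circ> c) ` ?D \<subseteq> points Y" using cX fX by auto
  ultimately show ?thesis
    unfolding CQ_plot_iff using V continuous_map_compose[OF c_cont f_cont] by blast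
qed

subsection \<open>Affine plots\<close>

lemma derivs_on_affine_comp:
  assumes g: "derivs_on UNIV (\<lambda>k. (deriv ^^ k) g)"
  shows "derivs_on UNIV (\<lambda>k. (deriv ^^ k) (\<lambda>t. a + r * g t))"
proof -
  define d where "d = (\<lambda>k t. (if k = 0 then a else 0) + r * (deriv ^^ k) g t)"
  have D: "derivs_on UNIV d"
    unfolding derivs_on_def
  proof (intro allI ballI)
    fix k t
    from DERIV_add[OF DERIV_const[of "if k = 0 then a else 0"] DERIV_cmult[OF derivs_onD[OF g UNIV_I, of k t], of r]]
    show "(d k has_real_derivative d (Suc k) t) (at t)"
      unfolding d_def by simp
  qed
  have "d k = (deriv ^^ k) (\<lambda>t. a + r * g t)" for k
    using derivs_on_eq_deriv[OF D open_UNIV, of "\<lambda>t. a + r * g t"] by (auto simp: d_def fun_eq_iff)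
  then have "d = (\<lambda>k. (deriv ^^ k) (\<lambda>t. a + r * g t))" by (rule ext)
  then show ?thesis using D by (simp only:)
qed

text \<open>Functionals of the model space restrict to functionals of the disk space, so affine maps carry \<open>C\<^sup>L\<close>-curves to
  \<open>C\<^sup>L\<close>-curves, and the chart changes do the rest.  Some multiple \<open>r\<close> of the unit ball fits into the
  \<open>c\<^sup>\<infinity>\<close>-open set \<open>W\<close>.\<close>

lemma ex_affine_plot:
  assumes Q: "weight_sequence Q" "L_intersectable Q" and X: "CQ_manifold Q X" and u: "u \<in> atlas X"
    and A: "weakly_bounded (chart_model u) A"
    and W: "openin (cinf_topology (chart_model u)) W" "W \<subseteq> chart_range u" "x0 \<in> W"
  obtains r where "r > 0"
    "\<And>z. z \<in> unit_ball (disk_prod (chart_model u) A :: ('e::real_vector \<times> 'b::real_vector) set) (disk_prod_norm (chart_model u) A) \<Longrightarrow>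
       x0 + r *\<^sub>R fst z \<in> W"
    "CQ_plot Q (disk_prod (chart_model u) A :: ('e \<times> 'b) set) (disk_prod_norm (chart_model u) A) X
       (\<lambda>z. chart_inv u (x0 + r *\<^sub>R fst z))"
proof -
  let ?T = "chart_model u"
  let ?V = "disk_prod ?T A :: ('e \<times> 'b) set" and ?N = "disk_prod_norm ?T A :: 'e \<times> 'b \<Rightarrow> real"
  let ?D = "unit_ball ?V ?N" and ?S = "norm_topology ?V ?N"
  obtain L0 where L0: "L0 \<in> nq_majorants Q" using nq_majorants_nonempty[OF Q] .
  have T: "convenient ?T" by (rule chart_convenient[OF X u])
  have V: "banach_on ?V ?N" by (rule banach_disk[OF T A])
  have N: "normed_on ?V ?N" using V by (simp add: banach_on_def)
  have S: "convenient ?S" by (rule convenient_norm_topology[OF V])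
  have topS: "topspace ?S = ?V" by (rule topspace_norm_topology[OF N])
  obtain \<delta> where \<delta>: "\<delta> > 0" "\<And>b s. b \<in> {x \<in> disk_space ?T A. disk_norm ?T A x \<le> 1} \<Longrightarrow> \<bar>s\<bar> < \<delta> \<Longrightarrow> x0 + s *\<^sub>R b \<in> W"
    by (rule cinf_open_absorbs_bounded[OF T nq_majorantsD[OF Q(1) L0] weakly_bounded_disk[OF A] W(1,3)]) (rule that)
  define r where "r = \<delta> / 2"
  have r: "r > 0" using \<delta>(1) by (simp add: r_def)
  let ?a = "\<lambda>z :: 'e \<times> 'b. x0 + r *\<^sub>R fst z"
  let ?c = "\<lambda>z :: 'e \<times> 'b. chart_inv u (x0 + r *\<^sub>R fst z)"
  have aW: "?a z \<in> W" if z: "z \<in> ?D" for z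
  proof (rule \<delta>(2))
    show "fst z \<in> {x \<in> disk_space ?T A. disk_norm ?T A x \<le> 1}"
      using z by (auto simp: unit_ball_def disk_prod_def disk_prod_norm_eq)
  qed (use \<delta>(1) in \<open>simp add: r_def\<close>)
  have x0: "x0 \<in> topspace ?T" using W by (auto simp: openin_cinf_topology)
  have E: "subspace (topspace ?T)" using T by (rule convenient_subspace)
  have fst_V: "fst z \<in> topspace ?T" if "z \<in> ?V" for z
    using that disk_space_topspace[OF A] by (auto simp: disk_prod_def)
  have la: "l (?a z) = l x0 + r * (l \<circ> fst) z" if "l \<in> continuous_dual ?T" "z \<in> ?V" for l z
    using dual_add[OF that(1) x0 subspace_scale[OF E fst_V[OF that(2)]]] dual_scale[OF that(1) fst_V[OF that(2)]]
    by simp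
  have aE: "?a z \<in> topspace ?T" if "z \<in> ?V" for z
    using x0 fst_V[OF that] E by (intro subspace_add subspace_scale)
  have fst_dual: "l \<circ> fst \<in> continuous_dual ?S" if "l \<in> continuous_dual ?T" for l
    by (rule dual_comp_fst[OF T A that])
  have a_smooth: "smooth_curve ?T (?a \<circ> \<beta>)" if \<beta>: "smooth_curve ?S \<beta>" for \<beta>
    unfolding smooth_curve_iff_scalarwise[OF T] scalarwise_smooth_def
  proof (intro conjI ballI)
    have sc: "scalarwise_smooth ?S \<beta>" using \<beta> by (simp add: smooth_curve_iff_scalarwise[OF S])
    then have \<beta>V: "\<beta> t \<in> ?V" for t by (auto simp: scalarwise_smooth_def topS)
    show "range (?a \<circ> \<beta>) \<subseteq> topspace ?T" using aE[OF \<beta>V] by auto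
    fix l assume l: "l \<in> continuous_dual ?T"
    have "l \<circ> (?a \<circ> \<beta>) = (\<lambda>t. l x0 + r * ((l \<circ> fst) \<circ> \<beta>) t)"
      using la[OF l \<beta>V] by (simp add: fun_eq_iff)
    moreover have "derivs_on UNIV (\<lambda>k. (deriv ^^ k) ((l \<circ> fst) \<circ> \<beta>))"
      using sc fst_dual[OF l] by (simp only: scalarwise_smooth_def)
    ultimately show "derivs_on UNIV (\<lambda>k. (deriv ^^ k) (l \<circ> (?a \<circ> \<beta>)))"
      using derivs_on_affine_comp by (simp only:)
  qed
  have c_points: "?c z \<in> points X" if "z \<in> ?D" for z
    using chart_fun_chart_inv(1)[of "?a z" u] aW[OF that] W(2) chart_dom_points[OF X u] by blast
  have cont: "continuous_map (manifold_topology (unit_ball_manifold ?V ?N)) (manifold_topology X) ?c"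
    unfolding continuous_map_def topspace_unit_ball_manifold[OF N] topspace_manifold_topology[OF X]
  proof (intro conjI allI impI)
    show "?c \<in> ?D \<rightarrow> points X" using c_points by blast
    fix G assume G: "openin (manifold_topology X) G"
    let ?G = "chart_fun u ` (G \<inter> chart_dom u)"
    have Gop: "openin (cinf_topology ?T) ?G" using G u unfolding openin_manifold_topology[OF X] by blast
    let ?P = "{z \<in> ?V. ?a z \<in> ?G}"
    have "openin (cinf_topology ?S) ?P"
      unfolding openin_cinf_topology
    proof (intro conjI allI impI)
      show "?P \<subseteq> topspace ?S" by (auto simp: topS)
      fix \<beta> assume \<beta>: "smooth_curve ?S \<beta>"
      then have "\<beta> t \<in> ?V" for t using topS unfolding smooth_curve_def by metis
      then have "{t. \<beta> t \<in> ?P} = {t. (?a \<circ> \<beta>) t \<in> ?G}" by auto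
      then show "open {t. \<beta> t \<in> ?P}" using Gop a_smooth[OF \<beta>] unfolding openin_cinf_topology by metis
    qed
    moreover have "{z \<in> ?D. ?c z \<in> G} = ?D \<inter> ?P"
    proof -
      have "z \<in> ?V" "?a z \<in> chart_range u" if "z \<in> ?D" for z
        using that aW[OF that] W(2) by (auto simp: unit_ball_def)
      then show ?thesis using chart_image_iff[OF X u, of _ G] by blast
    qed
    ultimately show "openin (manifold_topology (unit_ball_manifold ?V ?N)) {z \<in> ?D. ?c z \<in> G}"
      unfolding openin_unit_ball_manifold[OF N] by blast
  qed
  have charts: "CQ_map Q ?S {z \<in> ?D. ?c z \<in> chart_dom v} (chart_model v) (chart_fun v \<circ> ?c)" if v: "v \<in> atlas X" for v
  proof (rule CQ_mapI)
    show "(chart_fun v \<circ> ?c) ` {z \<in> ?D. ?c z \<in> chart_dom v} \<subseteq> topspace (chart_model v)"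
      using chart_range_topspace[OF X v] by (auto simp: chart_range_def)
    fix L \<beta> l
    assume L: "L \<in> nq_majorants Q" and \<beta>: "CL_curve L ?S {z \<in> ?D. ?c z \<in> chart_dom v} \<beta>"
      and l: "l \<in> continuous_dual (chart_model v)"
    have \<beta>D: "\<beta> t \<in> ?D" "?c (\<beta> t) \<in> chart_dom v" for t using \<beta> by (auto simp: CL_curve_def)
    then have \<beta>V: "\<beta> t \<in> ?V" for t by (auto simp: unit_ball_def)
    have "CL_curve L ?T (chart_fun u ` (chart_dom u \<inter> chart_dom v)) (?a \<circ> \<beta>)"
      unfolding CL_curve_def
    proof (intro conjI ballI)
      have "?a (\<beta> t) \<in> chart_fun u ` (chart_dom v \<inter> chart_dom u)" for t
        unfolding chart_image_iff[OF X u] using aW[OF \<beta>D(1)] W(2) \<beta>D(2) by blast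
      then show "range (?a \<circ> \<beta>) \<subseteq> chart_fun u ` (chart_dom u \<inter> chart_dom v)" by (auto simp: Int_commute)
      fix m assume m: "m \<in> continuous_dual ?T"
      have "m \<circ> (?a \<circ> \<beta>) = (\<lambda>t. m x0 + r * ((m \<circ> fst) \<circ> \<beta>) t)"
        using la[OF m \<beta>V] by (simp add: fun_eq_iff)
      moreover have "(m \<circ> fst) \<circ> \<beta> \<in> CL_real L"
        using \<beta> fst_dual[OF m] unfolding CL_curve_def by blast
      ultimately show "m \<circ> (?a \<circ> \<beta>) \<in> CL_real L"
        using CL_real_affine[OF nq_majorantsD(1)[OF Q(1) L]] by (simp only:)
    qed
    then have "CL_curve L (chart_model v) (topspace (chart_model v)) (chart_fun v \<circ> chart_inv u \<circ> (?a \<circ> \<beta>))"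
      by (rule CQ_mapD[OF chart_change(2)[OF X u v] L])
    then have "l \<circ> (chart_fun v \<circ> chart_inv u \<circ> (?a \<circ> \<beta>)) \<in> CL_real L" using l by (simp add: CL_curve_def)
    then show "l \<circ> (chart_fun v \<circ> ?c \<circ> \<beta>) \<in> CL_real L" by (simp add: o_def)
  qed
  show ?thesis
  proof (rule that[OF r aW])
    show "CQ_plot Q ?V ?N X ?c"
      unfolding CQ_plot_iff using V c_points cont charts by blast
  qed
qed

subsection \<open>Mappings that preserve plots are of class \<open>C\<^sup>Q\<close>\<close>

lemma disk_norm_of_mem:
  assumes A: "weakly_bounded T A" and a: "a \<in> A"
  shows "a \<in> disk_space T A" "disk_norm T A a \<le> 1"
proof -
  have "a \<in> topspace T" using assms by (auto simp: weakly_bounded_def)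
  moreover have "\<bar>l a\<bar> \<le> 1 * support_fun A l" if "l \<in> continuous_dual T" for l
    using support_fun_upper[OF A that a] by simp
  ultimately show "a \<in> disk_space T A" "disk_norm T A a \<le> 1"
    using disk_spaceI[of a T 1 A] by auto
qed

text \<open>A smooth curve \<open>\<gamma>\<close> in the model space is continuous at \<open>s\<close> as a curve in the Banach space generated by its
  difference quotients at \<open>s\<close>, because \<open>\<gamma> t - \<gamma> s\<close> has norm at most \<open>\<bar>t - s\<bar>\<close> there if \<open>\<bar>t - s\<bar> \<le> 1\<close>.\<close>

lemma preserves_plots_imp_continuous:
  fixes X :: "('x, 'e::real_vector) manifold"
  assumes Q: "weight_sequence Q" "L_intersectable Q" and X: "CQ_manifold Q X" and Y: "CQ_manifold Q Y"
    and fX: "f ` points X \<subseteq> points Y" and f: "maps_plots_to_plots TYPE('b::real_vector) Q X Y f"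
  shows "continuous_map (manifold_topology X) (manifold_topology Y) f"
  unfolding continuous_map_def topspace_manifold_topology[OF X] topspace_manifold_topology[OF Y]
proof (intro conjI allI impI)
  show "f \<in> points X \<rightarrow> points Y" using fX by blast
  fix W assume W: "openin (manifold_topology Y) W"
  obtain L0 where L0: "L0 \<in> nq_majorants Q" using nq_majorants_nonempty[OF Q] .
  show "openin (manifold_topology X) {x \<in> points X. f x \<in> W}"
    unfolding openin_manifold_topology[OF X]
  proof (intro conjI ballI)
    fix u assume u: "u \<in> atlas X"
    let ?T = "chart_model u" and ?G = "chart_fun u ` ({x \<in> points X. f x \<in> W} \<inter> chart_dom u)"
    have T: "convenient ?T" by (rule chart_convenient[OF X u])
    have inG: "y \<in> ?G \<longleftrightarrow> y \<in> chart_range u \<and> f (chart_inv u y) \<in> W" for y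
      unfolding chart_image_iff[OF X u] using chart_fun_chart_inv(1)[of y u] chart_dom_points[OF X u] by blast
    show "openin (cinf_topology ?T) ?G"
      unfolding openin_cinf_topology
    proof (intro conjI allI impI)
      show "?G \<subseteq> topspace ?T" using inG chart_range_topspace[OF X u] by blast
      fix \<gamma> assume "smooth_curve ?T \<gamma>"
      then have \<gamma>: "scalarwise_smooth ?T \<gamma>" by (simp add: smooth_curve_iff_scalarwise[OF T])
      show "open {t. \<gamma> t \<in> ?G}"
        unfolding open_dist
      proof (intro ballI)
        fix s assume "s \<in> {t. \<gamma> t \<in> ?G}"
        then have s: "\<gamma> s \<in> chart_range u" "f (chart_inv u (\<gamma> s)) \<in> W" using inG by auto
        let ?A = "{(1 / (t - s)) *\<^sub>R (\<gamma> t - \<gamma> s) | t. \<bar>t - s\<bar> \<le> 1}"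
        have A: "weakly_bounded ?T ?A" by (rule weakly_bounded_quotients[OF T \<gamma>])
        let ?V = "disk_prod ?T ?A :: ('e \<times> 'b) set" and ?N = "disk_prod_norm ?T ?A :: 'e \<times> 'b \<Rightarrow> real"
        obtain r where r: "r > 0" "\<And>z. z \<in> unit_ball ?V ?N \<Longrightarrow> \<gamma> s + r *\<^sub>R fst z \<in> chart_range u"
          "CQ_plot Q ?V ?N X (\<lambda>z. chart_inv u (\<gamma> s + r *\<^sub>R fst z))"
          by (rule ex_affine_plot[OF Q X u A chart_range_open[OF X u] order_refl s(1)]) (rule that)
        let ?c = "\<lambda>z :: 'e \<times> 'b. chart_inv u (\<gamma> s + r *\<^sub>R fst z)"
        have V: "banach_on ?V ?N" by (rule banach_disk[OF T A])
        then have N: "normed_on ?V ?N" by (simp add: banach_on_def)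
        have "CQ_plot Q ?V ?N Y (f \<circ> ?c)" using f r(3) unfolding maps_plots_to_plots_def by blast
        then have "continuous_map (manifold_topology (unit_ball_manifold ?V ?N)) (manifold_topology Y) (f \<circ> ?c)"
          unfolding CQ_plot_iff by blast
        then obtain P where P: "openin (cinf_topology (norm_topology ?V ?N)) P"
          "{z \<in> unit_ball ?V ?N. (f \<circ> ?c) z \<in> W} = unit_ball ?V ?N \<inter> P"
          by (rule continuous_map_unit_ball_preimage[OF N _ W]) (rule that)
        have zero: "0 \<in> ?V" "?N 0 = 0"
          using subspace_0[OF normed_subspace[OF N]] normed_zero[OF N, of 0] by auto
        then have "0 \<in> {z \<in> unit_ball ?V ?N. (f \<circ> ?c) z \<in> W}" using s(2) by (simp add: unit_ball_def)
        then have "0 \<in> P" using P(2) by blast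
        then obtain \<epsilon> where \<epsilon>: "\<epsilon> > 0" "\<And>z. z \<in> ?V \<Longrightarrow> ?N (z - 0) < \<epsilon> \<Longrightarrow> z \<in> P"
          by (rule cinf_open_contains_norm_ball[OF V nq_majorantsD[OF Q(1) L0] P(1)]) (rule that)
        \<comment> \<open>Below \<open>r\<close> the point stays in the unit ball, below \<open>r * \<epsilon>\<close> it stays in \<open>P\<close>.\<close>
        define e where "e = min 1 (r * min 1 \<epsilon>)"
        have "\<gamma> t \<in> ?G" if t: "dist t s < e" for t
        proof -
          let ?a = "(1 / (t - s)) *\<^sub>R (\<gamma> t - \<gamma> s)"
          let ?z = "((t - s) / r) *\<^sub>R (?a, 0 :: 'b)"
          have ts: "\<bar>t - s\<bar> < 1" "\<bar>t - s\<bar> < r * min 1 \<epsilon>" using t by (auto simp: e_def dist_real_def)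
          have "?a \<in> ?A" using ts by auto
          note a = disk_norm_of_mem[OF A this]
          have aV: "(?a, 0) \<in> ?V" using a by (simp add: disk_prod_def)
          have "?N ?z = \<bar>(t - s) / r\<bar> * disk_norm ?T ?A ?a"
            using normed_scale[OF N aV, of "(t - s) / r"] by (simp only: disk_prod_norm_eq[OF a(1)])
          also have "\<dots> \<le> \<bar>(t - s) / r\<bar> * 1" using a(2) by (intro mult_left_mono) auto
          also have "\<dots> = \<bar>t - s\<bar> / r" using r(1) by simp
          also have "\<dots> < min 1 \<epsilon>" using ts(2) r(1) by (simp only: pos_divide_less_eq mult.commute)
          finally have Nz: "?N ?z < min 1 \<epsilon>" .
          have zV: "?z \<in> ?V" by (rule subspace_scale[OF normed_subspace[OF N] aV])
          have "?z \<in> P" using \<epsilon>(2)[OF zV] Nz by simp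
          moreover have zD: "?z \<in> unit_ball ?V ?N" using zV Nz by (simp add: unit_ball_def)
          ultimately have "(f \<circ> ?c) ?z \<in> W" using P(2) by blast
          moreover have "\<gamma> s + r *\<^sub>R fst ?z = \<gamma> t" using r(1) by (cases "t = s") simp_all
          ultimately show ?thesis
            using r(2)[OF zD] inG by (simp only: o_apply)
        qed
        moreover have "e > 0" using r(1) \<epsilon>(1) by (simp add: e_def)
        ultimately show "\<exists>e>0. \<forall>t. dist t s < e \<longrightarrow> t \<in> {t. \<gamma> t \<in> ?G}" by blast
      qed
    qed
  qed auto
qed


lemma derivs_on_shift: "derivs_on I d \<Longrightarrow> derivs_on I (\<lambda>j. d (k + j))"
  by (auto simp: derivs_on_def)

definition jet_set :: "(nat \<Rightarrow> real) \<Rightarrow> (nat \<Rightarrow> real \<Rightarrow> 'e::real_vector) \<Rightarrow> real \<Rightarrow> 'e set" where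
  "jet_set M d s = {(1 / (fact k * M k)) *\<^sub>R d k t | k t. \<bar>t - s\<bar> \<le> 1}"

text \<open>A \<open>C\<^sup>L\<close>-curve \<open>\<gamma>\<close> need not be a \<open>C\<^sup>L\<close>-curve in any Banach space, as the constants \<open>\<rho>\<close> depend on the
  functional.  A superexponential factor \<open>R\<close> absorbs all of them: \<open>\<rho> ^ k \<le> B * R k\<close>.\<close>

lemma weakly_bounded_jet_set:
  assumes T: "convenient T" and L: "\<forall>k. L k > 0" and R: "superexponential R"
    and \<gamma>: "CL_curve L T U \<gamma>"
    and d: "\<And>k t. d k t \<in> topspace T"
    "\<And>l k t. l \<in> continuous_dual T \<Longrightarrow> l (d k t) = (deriv ^^ k) (l \<circ> \<gamma>) t"
  shows "weakly_bounded T (jet_set (\<lambda>k. L k * R k) d s)"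
  unfolding weakly_bounded_def
proof (intro conjI ballI)
  show "jet_set (\<lambda>k. L k * R k) d s \<subseteq> topspace T"
    unfolding jet_set_def using d(1) subspace_scale[OF convenient_subspace[OF T]] by blast
  fix l assume l: "l \<in> continuous_dual T"
  have "l \<circ> \<gamma> \<in> CL_real L" using \<gamma> l by (simp add: CL_curve_def)
  then obtain C \<rho> where C: "C > 0" "\<rho> > 0"
    "\<And>k t. \<bar>t\<bar> \<le> \<bar>s\<bar> + 1 \<Longrightarrow> \<bar>(deriv ^^ k) (l \<circ> \<gamma>) t\<bar> \<le> C * \<rho> ^ k * fact k * L k"
    unfolding CL_real_global_iff by meson
  obtain B where B: "B > 0" "\<And>k. \<rho> ^ k \<le> B * R k"
    using R C(2) unfolding superexponential_def by blast
  have "\<bar>l ((1 / (fact k * (L k * R k))) *\<^sub>R d k t)\<bar> \<le> C * B" if t: "\<bar>t - s\<bar> \<le> 1" for k t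
  proof -
    have "R k \<ge> 1" using R by (simp add: superexponential_def)
    then have w: "fact k * (L k * R k) > 0" using L by simp
    have "\<bar>l (d k t)\<bar> \<le> C * \<rho> ^ k * fact k * L k"
      unfolding d(2)[OF l] using t by (intro C(3)) auto
    also have "\<dots> = (C * fact k * L k) * \<rho> ^ k" by simp
    also have "\<dots> \<le> (C * fact k * L k) * (B * R k)"
      using B(2) C(1) L by (intro mult_left_mono) (auto intro: less_imp_le)
    finally have "\<bar>l (d k t)\<bar> \<le> C * B * (fact k * (L k * R k))" by (simp add: mult_ac)
    then have "\<bar>l (d k t)\<bar> / (fact k * (L k * R k)) \<le> C * B" using w by (simp only: pos_divide_le_eq)
    moreover have "l ((1 / (fact k * (L k * R k))) *\<^sub>R d k t) = l (d k t) / (fact k * (L k * R k))"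
      using dual_scale[OF l d(1), of "1 / (fact k * (L k * R k))"] by simp
    ultimately show ?thesis using w by (simp only: abs_divide abs_of_pos)
  qed
  then show "\<exists>M. \<forall>a\<in>jet_set (\<lambda>k. L k * R k) d s. \<bar>l a\<bar> \<le> M"
    unfolding jet_set_def by blast
qed

lemma jet_set_bounds:
  assumes T: "convenient T" and M: "\<forall>k. M k > 0" and \<gamma>: "scalarwise_smooth T (d 0)"
    and d: "\<And>k t. d k t \<in> topspace T"
    "\<forall>l\<in>continuous_dual T. \<forall>k t. l (d k t) = (deriv ^^ k) (l \<circ> d 0) t"
    and A: "weakly_bounded T (jet_set M d s)"
  shows jet_in_disk: "\<bar>t - s\<bar> \<le> 1 \<Longrightarrow> d k t \<in> disk_space T (jet_set M d s)"
    and jet_disk_norm: "\<bar>t - s\<bar> \<le> 1 \<Longrightarrow> disk_norm T (jet_set M d s) (d k t) \<le> fact k * M k"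
    and jet_increment: "\<bar>t - s\<bar> \<le> 1 \<Longrightarrow> disk_norm T (jet_set M d s) (d 0 t - d 0 s) \<le> M 1 * \<bar>t - s\<bar>"
    and jet_quotient: "\<bar>t - s\<bar> \<le> 1 \<Longrightarrow> \<bar>t + h - s\<bar> \<le> 1 \<Longrightarrow> h \<noteq> 0 \<Longrightarrow>
      disk_norm T (jet_set M d s) ((1 / h) *\<^sub>R (d k (t + h) - d k t) - d (Suc k) t) \<le> (fact (k + 2) * M (k + 2)) * \<bar>h\<bar>"
proof -
  let ?A = "jet_set M d s" and ?N = "disk_norm T (jet_set M d s)"
  have lcs: "locally_convex_space T" and E: "subspace (topspace T)"
    using T by (auto simp: convenient_lcs convenient_subspace)
  have w: "fact k * M k > 0" for k using M by simp
  have scalar: "\<bar>l (d k t)\<bar> \<le> (fact k * M k) * support_fun ?A l" if l: "l \<in> continuous_dual T" and t: "\<bar>t - s\<bar> \<le> 1" for l k t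
  proof -
    have "(1 / (fact k * M k)) *\<^sub>R d k t \<in> ?A" using t by (auto simp: jet_set_def)
    then have "\<bar>l ((1 / (fact k * M k)) *\<^sub>R d k t)\<bar> \<le> support_fun ?A l" by (rule support_fun_upper[OF A l])
    moreover have "l ((1 / (fact k * M k)) *\<^sub>R d k t) = l (d k t) / (fact k * M k)"
      using dual_scale[OF l d(1), of "1 / (fact k * M k)"] by simp
    ultimately have "\<bar>l (d k t)\<bar> / (fact k * M k) \<le> support_fun ?A l"
      using w[of k] by (simp only: abs_divide abs_of_pos)
    then show ?thesis using w[of k] by (simp only: pos_divide_le_eq mult.commute)
  qed
  have D: "derivs_on UNIV (\<lambda>k t. l (d k t))" if l: "l \<in> continuous_dual T" for l
  proof -
    have "(\<lambda>k t. l (d k t)) = (\<lambda>k. (deriv ^^ k) (l \<circ> d 0))" using d(2)[rule_format, OF l] by (intro ext)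
    then show ?thesis using \<gamma> l by (simp only: scalarwise_smooth_def)
  qed
  show "d k t \<in> disk_space T ?A" "?N (d k t) \<le> fact k * M k" if "\<bar>t - s\<bar> \<le> 1"
    using disk_spaceI[OF d(1), of "fact k * M k" k t ?A] scalar that w[of k] by (auto intro: less_imp_le)
  show "?N (d 0 t - d 0 s) \<le> M 1 * \<bar>t - s\<bar>" if t: "\<bar>t - s\<bar> \<le> 1"
  proof (rule disk_spaceI(2))
    show "d 0 t - d 0 s \<in> topspace T" using d(1) E by (simp add: subspace_diff)
    show "0 \<le> M 1 * \<bar>t - s\<bar>" using M by (simp add: less_imp_le)
    fix l assume l: "l \<in> continuous_dual T"
    have "norm (l (d 0 t) - l (d 0 s)) \<le> (M 1 * support_fun ?A l) * norm (t - s)"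
    proof (rule field_differentiable_bound[of "cball s 1"])
      show "((\<lambda>t. l (d 0 t)) has_field_derivative l (d 1 z)) (at z within cball s 1)" for z
        using derivs_onD[OF D[OF l], of z 0] has_field_derivative_at_within by auto
      show "norm (l (d 1 z)) \<le> M 1 * support_fun ?A l" if "z \<in> cball s 1" for z
        using scalar[OF l, of z 1] that by (simp add: dist_real_def abs_minus_commute)
    qed (use t in \<open>auto simp: dist_real_def abs_minus_commute\<close>)
    then show "\<bar>l (d 0 t - d 0 s)\<bar> \<le> M 1 * \<bar>t - s\<bar> * support_fun ?A l"
      using dual_diff[OF lcs l d(1) d(1), of 0 t 0 s] by (simp add: mult_ac)
  qed
  show "?N ((1 / h) *\<^sub>R (d k (t + h) - d k t) - d (Suc k) t) \<le> (fact (k + 2) * M (k + 2)) * \<bar>h\<bar>"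
    if t: "\<bar>t - s\<bar> \<le> 1" "\<bar>t + h - s\<bar> \<le> 1" and h: "h \<noteq> 0"
  proof (rule disk_spaceI(2))
    have q: "(1 / h) *\<^sub>R (d k (t + h) - d k t) \<in> topspace T" using d(1) E by (intro subspace_scale subspace_diff)
    then show "(1 / h) *\<^sub>R (d k (t + h) - d k t) - d (Suc k) t \<in> topspace T" using d(1) E by (intro subspace_diff)
    show "0 \<le> (fact (k + 2) * M (k + 2)) * \<bar>h\<bar>" using M by (intro mult_nonneg_nonneg) (auto intro: less_imp_le)
    fix l assume l: "l \<in> continuous_dual T"
    have "\<bar>(l (d (k + 0) (t + h)) - l (d (k + 0) t)) / h - l (d (k + 1) t)\<bar> \<le>
        ((fact (k + 2) * M (k + 2)) * support_fun ?A l) * \<bar>h\<bar>"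
      by (rule quotient_minus_derivative[OF derivs_on_shift[OF D[OF l], of k] _ t h]) (rule scalar[OF l])
    moreover have "l ((1 / h) *\<^sub>R (d k (t + h) - d k t) - d (Suc k) t) = (l (d k (t + h)) - l (d k t)) / h - l (d (Suc k) t)"
      using dual_diff[OF lcs l q d(1)] dual_scale[OF l subspace_diff[OF E d(1) d(1)]] dual_diff[OF lcs l d(1) d(1)] by simp
    ultimately show "\<bar>l ((1 / h) *\<^sub>R (d k (t + h) - d k t) - d (Suc k) t)\<bar> \<le> (fact (k + 2) * M (k + 2)) * \<bar>h\<bar> * support_fun ?A l"
      by (simp add: mult_ac)
  qed
qed

text \<open>By construction of the norm, \<open>d k t\<close> has norm at most \<open>k! M\<^sub>k\<close>, and the difference quotients of \<open>d k\<close> converge to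
  \<open>d (k + 1)\<close> in norm, since the scalar error estimates are uniform relative to the support function.\<close>

lemma CL_curve_in_jet_disk:
  fixes d :: "nat \<Rightarrow> real \<Rightarrow> 'e::real_vector"
  assumes T: "convenient T" and M: "\<forall>k. M k > 0" and \<gamma>: "scalarwise_smooth T (d 0)"
    and d: "\<And>k t. d k t \<in> topspace T"
    "\<forall>l\<in>continuous_dual T. \<forall>k t. l (d k t) = (deriv ^^ k) (l \<circ> d 0) t"
    and A: "weakly_bounded T (jet_set M d s)"
    and m: "m \<in> continuous_dual (norm_topology (disk_prod T (jet_set M d s) :: ('e \<times> 'b::real_vector) set) (disk_prod_norm T (jet_set M d s)))"
  shows "CL_derivs M {s - 1<..<s + 1} (\<lambda>k t. m (d k t, 0))"
proof -
  let ?A = "jet_set M d s"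
  let ?V = "disk_prod T ?A :: ('e \<times> 'b) set" and ?N = "disk_prod_norm T ?A :: 'e \<times> 'b \<Rightarrow> real"
  note jet = jet_set_bounds[OF T M \<gamma> d A]
  have N: "normed_on ?V ?N" using banach_disk[OF T A, where 'b = 'b] by (simp add: banach_on_def)
  have sub: "subspace ?V" using N by (rule normed_subspace)
  have top: "topspace (norm_topology ?V ?N) = ?V" by (rule topspace_norm_topology[OF N])
  have lcs: "locally_convex_space (norm_topology ?V ?N)" by (rule locally_convex_norm_topology[OF N])
  obtain C where C: "C > 0" "\<And>z. z \<in> ?V \<Longrightarrow> \<bar>m z\<bar> \<le> C * ?N z" by (rule dual_norm_bound[OF N m]) (rule that)
  have mem: "(d k t, 0) \<in> ?V" if "\<bar>t - s\<bar> \<le> 1" for k t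
    using jet(1)[OF that] by (simp add: disk_prod_def)
  show ?thesis
  proof (rule CL_derivsI[of _ _ C 1])
    show "derivs_on {s - 1<..<s + 1} (\<lambda>k t. m (d k t, 0))"
      unfolding derivs_on_def DERIV_def
    proof (intro allI ballI)
      fix k t assume t: "t \<in> {s - 1<..<s + 1}"
      define e where "e = 1 - \<bar>t - s\<bar>"
      have e: "e > 0" using t by (auto simp: e_def)
      have ts: "\<bar>t - s\<bar> \<le> 1" using t by auto
      let ?K = "fact (k + 2) * M (k + 2)"
      have est: "\<bar>(m (d k (t + h), 0) - m (d k t, 0)) / h - m (d (Suc k) t, 0)\<bar> \<le> C * ?K * \<bar>h\<bar>"
        if h: "h \<noteq> 0" "\<bar>h\<bar> < e" for h
      proof -
        have th: "\<bar>t + h - s\<bar> \<le> 1" using h(2) by (auto simp: e_def)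
        let ?q = "(1 / h) *\<^sub>R ((d k (t + h), 0 :: 'b) - (d k t, 0)) - (d (Suc k) t, 0)"
        have diffV: "(d k (t + h), 0) - (d k t, 0) \<in> ?V" by (rule subspace_diff[OF sub mem[OF th] mem[OF ts]])
        have qV: "?q \<in> ?V" by (rule subspace_diff[OF sub subspace_scale[OF sub diffV] mem[OF ts]])
        have q: "?q = ((1 / h) *\<^sub>R (d k (t + h) - d k t) - d (Suc k) t, 0)" by simp
        have "m ?q = (m (d k (t + h), 0) - m (d k t, 0)) / h - m (d (Suc k) t, 0)"
        proof -
          have "m ?q = m ((1 / h) *\<^sub>R ((d k (t + h), 0 :: 'b) - (d k t, 0))) - m (d (Suc k) t, 0)"
            using subspace_scale[OF sub diffV] mem[OF ts] by (intro dual_diff[OF lcs m]) (simp_all only: top)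
          also have "m ((1 / h) *\<^sub>R ((d k (t + h), 0 :: 'b) - (d k t, 0))) = (1 / h) * m ((d k (t + h), 0 :: 'b) - (d k t, 0))"
            using diffV by (intro dual_scale[OF m]) (simp only: top)
          also have "m ((d k (t + h), 0 :: 'b) - (d k t, 0)) = m (d k (t + h), 0) - m (d k t, 0)"
            using mem[OF th] mem[OF ts] by (intro dual_diff[OF lcs m]) (simp_all only: top)
          finally show ?thesis by simp
        qed
        moreover have "\<bar>m ?q\<bar> \<le> C * ?N ?q" by (rule C(2)[OF qV])
        moreover have "?N ?q \<le> ?K * \<bar>h\<bar>"
        proof -
          have "(1 / h) *\<^sub>R (d k (t + h) - d k t) - d (Suc k) t \<in> disk_space T ?A"
            using qV unfolding q by (simp add: disk_prod_def)
          then show ?thesis unfolding q using jet(4)[OF ts th h(1), of k] by (simp only: disk_prod_norm_eq)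
        qed
        then have "C * ?N ?q \<le> C * (?K * \<bar>h\<bar>)" using C(1) by (intro mult_left_mono) auto
        ultimately show ?thesis by (simp only: mult.assoc)
      qed
      show "((\<lambda>h. (m (d k (t + h), 0) - m (d k t, 0)) / h) \<longlongrightarrow> m (d (Suc k) t, 0)) (at 0)"
      proof (rule LIM_zero_cancel)
        show "((\<lambda>h. (m (d k (t + h), 0) - m (d k t, 0)) / h - m (d (Suc k) t, 0)) \<longlongrightarrow> 0) (at 0)"
        proof (rule Lim_null_comparison)
          show "\<forall>\<^sub>F h in at 0. norm ((m (d k (t + h), 0) - m (d k t, 0)) / h - m (d (Suc k) t, 0)) \<le> C * ?K * \<bar>h\<bar>"
            unfolding eventually_at using e est by (intro exI[of _ e]) (simp add: dist_real_def)
          have "((\<lambda>h. C * ?K * \<bar>h\<bar>) \<longlongrightarrow> C * ?K * \<bar>0\<bar>) (at 0)"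
            by (intro tendsto_intros)
          then show "((\<lambda>h. C * ?K * \<bar>h\<bar>) \<longlongrightarrow> 0) (at 0)" by simp
        qed
      qed
    qed
    fix k t assume "t \<in> {s - 1<..<s + 1}"
    then have t: "\<bar>t - s\<bar> \<le> 1" by auto
    have "\<bar>m (d k t, 0)\<bar> \<le> C * ?N (d k t, 0)" by (rule C(2)[OF mem[OF t]])
    also have "\<dots> \<le> C * (fact k * M k)"
      using jet(1,2)[OF t, of k] C(1) by (intro mult_left_mono) (simp_all add: disk_prod_norm_eq)
    finally show "\<bar>m (d k t, 0)\<bar> \<le> C * 1 ^ k * fact k * M k" by (simp add: mult.assoc)
  qed (use C(1) in auto)
qed

text \<open>For a superexponential \<open>R\<close>, the sequence \<open>M = L R\<close> is again in \<open>\<L>(Q)\<close>, so mappings of class \<open>C\<^sup>Q\<close> also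
  preserve \<open>C\<^sup>M\<close>-curves.  Near \<open>s\<close>, a \<open>C\<^sup>L\<close>-curve \<open>\<gamma>\<close> is a \<open>C\<^sup>M\<close>-curve in the Banach space generated by its jets.  A cutoff
  contracts it into the unit ball, where an affine plot turns it back into \<open>\<gamma>\<close>.  Hence the image of \<open>\<gamma>\<close> is of class
  \<open>C\<^sup>M\<close>; as \<open>R\<close> is arbitrary, it is of class \<open>C\<^sup>L\<close>.\<close>

lemma preserves_plots_imp_charts:
  fixes X :: "('x, 'e::real_vector) manifold"
  assumes Q: "weight_sequence Q" "L_intersectable Q" and X: "CQ_manifold Q X" and Y: "CQ_manifold Q Y"
    and fX: "f ` points X \<subseteq> points Y" and f: "maps_plots_to_plots TYPE('b::real_vector) Q X Y f"
    and u: "u \<in> atlas X" and v: "v \<in> atlas Y"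
  shows "CQ_map Q (chart_model u) (chart_fun u ` (chart_dom u \<inter> f -` chart_dom v)) (chart_model v) (chart_fun v \<circ> f \<circ> chart_inv u)"
proof (rule CQ_mapI)
  let ?T = "chart_model u" and ?U = "chart_fun u ` (chart_dom u \<inter> f -` chart_dom v)"
  let ?h = "chart_fun v \<circ> f \<circ> chart_inv u"
  have T: "convenient ?T" by (rule chart_convenient[OF X u])
  have inU: "y \<in> ?U \<longleftrightarrow> y \<in> chart_range u \<and> f (chart_inv u y) \<in> chart_dom v" for y
    using chart_image_iff[OF X u, of y "f -` chart_dom v"] by (simp add: Int_commute)
  show "?h ` ?U \<subseteq> topspace (chart_model v)"
    using inU chart_range_topspace[OF Y v] by (auto simp: chart_range_def)
  have Uop: "openin (cinf_topology ?T) ?U"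
  proof -
    have "openin (manifold_topology X) {x \<in> topspace (manifold_topology X). f x \<in> chart_dom v}"
      by (rule openin_continuous_map_preimage[OF preserves_plots_imp_continuous[OF Q X Y fX f] openin_chart_dom[OF Y v]])
    then have "openin (cinf_topology ?T) (chart_fun u ` ({x \<in> points X. f x \<in> chart_dom v} \<inter> chart_dom u))"
      using u unfolding topspace_manifold_topology[OF X] openin_manifold_topology[OF X] by blast
    moreover have "{x \<in> points X. f x \<in> chart_dom v} \<inter> chart_dom u = chart_dom u \<inter> f -` chart_dom v"
      using chart_dom_points[OF X u] by blast
    ultimately show ?thesis by simp
  qed
  fix L \<gamma> l
  assume L: "L \<in> nq_majorants Q" and \<gamma>: "CL_curve L ?T ?U \<gamma>" and l: "l \<in> continuous_dual (chart_model v)"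
  have UT: "?U \<subseteq> topspace ?T" using Uop by (auto simp: openin_cinf_topology)
  have \<gamma>U: "\<gamma> t \<in> ?U" for t using \<gamma> by (auto simp: CL_curve_def)
  have sc: "scalarwise_smooth ?T \<gamma>" by (rule CL_curve_scalarwise_smooth[OF \<gamma> UT])
  obtain d where d: "d 0 = \<gamma>" "\<And>k t. d k t \<in> topspace ?T"
    "\<And>l k t. l \<in> continuous_dual ?T \<Longrightarrow> l (d k t) = (deriv ^^ k) (l \<circ> \<gamma>) t"
    by (rule scalarwise_smooth_derivatives[OF T sc]) (rule that)
  have d3: "\<forall>l\<in>continuous_dual ?T. \<forall>k t. l (d k t) = (deriv ^^ k) (l \<circ> d 0) t"
    using d(3) unfolding d(1) by blast
  show "l \<circ> (?h \<circ> \<gamma>) \<in> CL_real L"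
  proof (rule CL_real_of_multiples[OF nq_majorantsD(1)[OF Q(1) L]])
    fix R assume R: "superexponential R"
    define M where "M = (\<lambda>k. L k * R k)"
    have M: "M \<in> nq_majorants Q" unfolding M_def by (rule nq_majorants_superexponential[OF Q(1) L R])
    note M' = nq_majorantsD[OF Q(1) M]
    have "l \<circ> (?h \<circ> \<gamma>) \<in> CL_real M"
    proof (rule CL_real_cong_local[OF M'(1)])
      fix s
      let ?A = "jet_set M d s"
      have A: "weakly_bounded ?T ?A"
        unfolding M_def by (rule weakly_bounded_jet_set[OF T nq_majorantsD(1)[OF Q(1) L] R \<gamma> d(2,3)])
      note jet = jet_set_bounds[OF T M'(1) sc[folded d(1)] d(2) d3 A]
      let ?V = "disk_prod ?T ?A :: ('e \<times> 'b) set" and ?N = "disk_prod_norm ?T ?A :: 'e \<times> 'b \<Rightarrow> real"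
      have "?U \<subseteq> chart_range u" using inU by blast
      then obtain r where r: "r > 0" "\<And>z. z \<in> unit_ball ?V ?N \<Longrightarrow> \<gamma> s + r *\<^sub>R fst z \<in> ?U"
        "CQ_plot Q ?V ?N X (\<lambda>z. chart_inv u (\<gamma> s + r *\<^sub>R fst z))"
        by (rule ex_affine_plot[OF Q X u A Uop _ \<gamma>U]) (rule that)
      let ?c = "\<lambda>z :: 'e \<times> 'b. chart_inv u (\<gamma> s + r *\<^sub>R fst z)"
      have V: "banach_on ?V ?N" by (rule banach_disk[OF T A])
      then have N: "normed_on ?V ?N" by (simp add: banach_on_def)
      have sub: "subspace ?V" using N by (rule normed_subspace)
      have top: "topspace (norm_topology ?V ?N) = ?V" by (rule topspace_norm_topology[OF N])
      have "CQ_plot Q ?V ?N Y (f \<circ> ?c)" using f r(3) unfolding maps_plots_to_plots_def by blast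
      then have fc: "CQ_map Q (norm_topology ?V ?N) {z \<in> unit_ball ?V ?N. (f \<circ> ?c) z \<in> chart_dom v} (chart_model v) (chart_fun v \<circ> (f \<circ> ?c))"
        unfolding CQ_plot_iff using v by blast
      define \<eta> where "\<eta> = min (1 / 2) (r / (2 * M 1))"
      have M1: "M 1 > 0" using M'(1) by blast
      have \<eta>: "\<eta> > 0" "\<eta> < 1" "M 1 * \<eta> \<le> r / 2"
      proof -
        show "\<eta> > 0" "\<eta> < 1" using r(1) M1 by (auto simp: \<eta>_def)
        have "\<eta> \<le> r / (2 * M 1)" by (simp add: \<eta>_def)
        then show "M 1 * \<eta> \<le> r / 2" using M1 by (simp add: field_simps)
      qed
      obtain \<phi> where \<phi>: "CL_derivs M UNIV \<phi>" "\<And>t. 0 \<le> \<phi> 0 t" "\<And>t. \<phi> 0 t \<le> 1"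
        "\<And>t. \<bar>t - s\<bar> \<le> \<eta> / 2 \<Longrightarrow> \<phi> 0 t = 1" "\<And>k t. \<bar>t - s\<bar> \<ge> \<eta> \<Longrightarrow> \<phi> k t = 0"
        by (rule ex_CL_cutoff[OF M' \<eta>(1), of s]) (rule that)
      define \<beta> where "\<beta> = (\<lambda>t. ((\<phi> 0 t / r) *\<^sub>R (\<gamma> t - \<gamma> s), 0 :: 'b))"
      have near: "(\<gamma> t - \<gamma> s, 0) \<in> ?V" "?N (\<gamma> t - \<gamma> s, 0) \<le> M 1 * \<bar>t - s\<bar>" if t: "\<bar>t - s\<bar> \<le> 1" for t
      proof -
        have mem: "\<gamma> t - \<gamma> s \<in> disk_space ?T ?A"
          using jet(1)[OF t, of 0] jet(1)[of s 0] unfolding d(1)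
          by (intro subspace_diff[OF disk_normed(1)[OF convenient_lcs[OF T] convenient_Hausdorff[OF T] A]]) auto
        then show "(\<gamma> t - \<gamma> s, 0) \<in> ?V" by (simp add: disk_prod_def)
        show "?N (\<gamma> t - \<gamma> s, 0) \<le> M 1 * \<bar>t - s\<bar>"
          using jet(3)[OF t] unfolding d(1) by (simp only: disk_prod_norm_eq[OF mem])
      qed
      have \<beta>_far: "\<beta> t = 0" if "\<bar>t - s\<bar> \<ge> \<eta>" for t using \<phi>(5)[OF that, of 0] by (simp add: \<beta>_def zero_prod_def)
      have \<beta>_eq: "\<beta> t = (\<phi> 0 t / r) *\<^sub>R (\<gamma> t - \<gamma> s, 0)" for t by (simp add: \<beta>_def)
      have \<beta>D: "\<beta> t \<in> unit_ball ?V ?N" for t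
      proof (cases "\<bar>t - s\<bar> < \<eta>")
        case True
        then have ts: "\<bar>t - s\<bar> \<le> 1" using \<eta> by simp
        have "?N (\<beta> t) = \<bar>\<phi> 0 t / r\<bar> * ?N (\<gamma> t - \<gamma> s, 0)" unfolding \<beta>_eq by (rule normed_scale[OF N near(1)[OF ts]])
        also have "\<dots> \<le> (1 / r) * (M 1 * \<eta>)"
        proof (intro mult_mono)
          show "\<bar>\<phi> 0 t / r\<bar> \<le> 1 / r" using \<phi>(2,3)[of t] r(1) by (simp add: divide_right_mono)
          have "M 1 * \<bar>t - s\<bar> \<le> M 1 * \<eta>" using True M1 by (intro mult_left_mono) auto
          then show "?N (\<gamma> t - \<gamma> s, 0) \<le> M 1 * \<eta>" using near(2)[OF ts] by linarith
        qed (use r(1) normed_nonneg[OF N] in auto)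
        also have "\<dots> \<le> (1 / r) * (r / 2)" using \<eta>(3) r(1) by (intro mult_left_mono) auto
        also have "\<dots> < 1" using r(1) by simp
        finally have "?N (\<beta> t) < 1" .
        moreover have "\<beta> t \<in> ?V" unfolding \<beta>_eq by (rule subspace_scale[OF sub near(1)[OF ts]])
        ultimately show ?thesis by (simp add: unit_ball_def)
      next
        case False
        then have "\<beta> t = 0" by (intro \<beta>_far) simp
        then show ?thesis using subspace_0[OF sub] normed_zero[OF N, of 0] by (simp add: unit_ball_def)
      qed
      have \<beta>_dom: "(f \<circ> ?c) (\<beta> t) \<in> chart_dom v" for t
        using r(2)[OF \<beta>D] inU by (simp only: o_apply)
      have "m \<circ> \<beta> \<in> CL_real M" if m: "m \<in> continuous_dual (norm_topology ?V ?N)" for m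
      proof -
        let ?e = "\<lambda>k t. (1 / r) * ((if k = 0 then - m (\<gamma> s, 0) else 0) + m (d k t, 0))"
        let ?g = "\<lambda>t. (1 / r) * (- m (\<gamma> s, 0) + m (\<gamma> t, 0))"
        have e: "CL_derivs M {s - 1<..<s + 1} ?e"
          by (intro CL_derivs_scale CL_derivs_add CL_derivs_const M'(1)
              CL_curve_in_jet_disk[OF T M'(1) sc[folded d(1)] d(2) d3 A m])
        have "(\<lambda>t. 0 + \<phi> 0 t * ?g t) \<in> CL_real M"
          by (rule CL_real_cutoff[OF M'(1,2) \<phi>(1,5) \<eta>(2) e]) (simp_all add: d(1))
        moreover have "(m \<circ> \<beta>) t = 0 + \<phi> 0 t * ?g t" for t
        proof (cases "\<bar>t - s\<bar> < \<eta>")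
          case True
          then have ts: "\<bar>t - s\<bar> \<le> 1" using \<eta> by simp
          have mem: "(\<gamma> t, 0) \<in> ?V" "(\<gamma> s, 0) \<in> ?V"
            using jet(1)[OF ts, of 0] jet(1)[of s 0] unfolding d(1) by (simp_all add: disk_prod_def)
          have "m (\<beta> t) = (\<phi> 0 t / r) * m (\<gamma> t - \<gamma> s, 0)"
            unfolding \<beta>_eq using near(1)[OF ts] by (intro dual_scale[OF m]) (simp only: top)
          also have "m (\<gamma> t - \<gamma> s, 0) = m ((\<gamma> t, 0) - (\<gamma> s, 0))" by simp
          also have "\<dots> = m (\<gamma> t, 0) - m (\<gamma> s, 0)"
            using mem by (intro dual_diff[OF locally_convex_norm_topology[OF N] m]) (simp_all only: top)
          finally show ?thesis by (simp add: algebra_simps)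
        next
          case False
          then have "\<beta> t = 0" "\<phi> 0 t = 0" using \<beta>_far \<phi>(5) by auto
          moreover have "m 0 = 0" using dual_scale[OF m, of 0 0] subspace_0[OF sub] top by simp
          ultimately show ?thesis by simp
        qed
        then have "m \<circ> \<beta> = (\<lambda>t. 0 + \<phi> 0 t * ?g t)" by (rule ext)
        ultimately show ?thesis by (simp only:)
      qed
      then have "CL_curve M (norm_topology ?V ?N) {z \<in> unit_ball ?V ?N. (f \<circ> ?c) z \<in> chart_dom v} \<beta>"
        unfolding CL_curve_def using \<beta>D \<beta>_dom by blast
      then have "CL_curve M (chart_model v) (topspace (chart_model v)) (chart_fun v \<circ> (f \<circ> ?c) \<circ> \<beta>)"
        by (rule CQ_mapD[OF fc M])
      then have "l \<circ> (chart_fun v \<circ> (f \<circ> ?c) \<circ> \<beta>) \<in> CL_real M" using l by (simp only: CL_curve_def)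
      moreover have "(l \<circ> (?h \<circ> \<gamma>)) t = (l \<circ> (chart_fun v \<circ> (f \<circ> ?c) \<circ> \<beta>)) t" if "dist t s < \<eta> / 2" for t
      proof -
        have "\<phi> 0 t = 1" using that by (intro \<phi>(4)) (simp add: dist_real_def)
        then have "\<gamma> s + r *\<^sub>R fst (\<beta> t) = \<gamma> t" using r(1) by (simp add: \<beta>_def)
        then show ?thesis by simp
      qed
      then have "eventually (\<lambda>t. (l \<circ> (?h \<circ> \<gamma>)) t = (l \<circ> (chart_fun v \<circ> (f \<circ> ?c) \<circ> \<beta>)) t) (nhds s)"
        unfolding eventually_nhds_metric using \<eta>(1) by (intro exI[of _ "\<eta> / 2"]) auto
      ultimately show "\<exists>g\<in>CL_real M. eventually (\<lambda>t. (l \<circ> (?h \<circ> \<gamma>)) t = g t) (nhds s)" by blast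
    qed
    then show "l \<circ> (?h \<circ> \<gamma>) \<in> CL_real (\<lambda>k. L k * R k)" by (simp only: M_def)
  qed
qed

theorem lemma5p2:
  fixes Q :: "nat \<Rightarrow> real"
    and X :: "('x, 'e::real_vector) manifold"
    and Y :: "('y, 'f::real_vector) manifold"
    and f :: "'x \<Rightarrow> 'y"
  assumes "weight_sequence Q" and "quasianalytic Q" and "L_intersectable Q" and "moderate_growth Q"
    and "CQ_manifold Q X" and "CQ_manifold Q Y"
    and "f ` points X \<subseteq> points Y"
  shows "CQ_manifold_map Q X Y f \<longleftrightarrow> maps_plots_to_plots TYPE('b::real_vector) Q X Y f"
proof
  assume "CQ_manifold_map Q X Y f"
  then show "maps_plots_to_plots TYPE('b) Q X Y f"
    unfolding maps_plots_to_plots_def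
    using CQ_manifold_map_imp_plot[OF assms(1,5,6)] by blast
next
  assume f: "maps_plots_to_plots TYPE('b) Q X Y f"
  show "CQ_manifold_map Q X Y f"
    unfolding CQ_manifold_map_def
    using preserves_plots_imp_continuous[OF assms(1,3,5,6,7) f]
      preserves_plots_imp_charts[OF assms(1,3,5,6,7) f] assms(7) by blast
qed

end
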